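(* Let $n\ge2$ and $1<q<\infty$. For the Stokes equations $$u_t-\Delta u+\nabla\pi=0,\qquad \operatorname{div}u=0\quad\text{in } B_2^+\times(0,4),$$ and likewise for the Navier-Stokes equations $$u_t-\Delta u+(u\cdot\nabla)u+\nabla\pi=0,\qquad \operatorname{div}u=0\quad\text{in } B_2^+\times(0,4),$$ there exists a solution $u$, with associated pressure $\pi$, satisfying the no-slip condition $u=0$ on $(B_2\cap\{x_n=0\})\times(0,4)$, such that $$\|\nabla^2u\|_{L^{3q/2}(Q_1^+)}+\|D_tu\|_{L^q(Q_1^+)}+\|\nabla\pi\|_{L^q(Q_1^+)}<\infty,$$ but for any $r_1>q$ and any $r_2>\frac{3q}2$, $$\|D_tu\|_{L^{r_1}(Q_{1/2}^+)}=\infty,\qquad \|\nabla\pi\|_{L^{r_1}(Q_{1/2}^+)}=\infty,\qquad \|\nabla^2u\|_{L^{r_2}(Q_{1/2}^+)}=\infty .$$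
   Context: Notation: $x=(x',x_n)\in\mathbb R^{n-1}\times\mathbb R$, $B_r=\{x\in\mathbb R^n:|x|<r\}$, $B_r^+=\{x\in\mathbb R^n: |x|<r,\ x_n>0\}$, $Q_r^+=B_r^+\times(1-r^2,1)$, $D_tu=\partial_tu$. $L^s(Q_r^+)$ is the Lebesgue space over space-time. A solution is understood in the sense of distributions with a pressure $\pi$. *)

theory Defs
  imports "HOL-Analysis.Analysis"
begin

section \<open>Test functions and weak derivatives\<close>

definition dir_deriv :: "'a::euclidean_space \<Rightarrow> ('a \<Rightarrow> real) \<Rightarrow> 'a \<Rightarrow> real" where
  "dir_deriv d f x = frechet_derivative f (at x) d"

primrec C_k :: "nat \<Rightarrow> ('a::euclidean_space \<Rightarrow> real) \<Rightarrow> bool" where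
  "C_k 0 f \<longleftrightarrow> continuous_on UNIV f"
| "C_k (Suc k) f \<longleftrightarrow> (\<forall>x. f differentiable (at x)) \<and> (\<forall>b\<in>Basis. C_k k (dir_deriv b f))"

text \<open>The space of smooth functions with compact support in the open set \<open>\<Omega>\<close>; its elements are
  regarded as functions on the whole space.\<close>

definition test_functions :: "'a::euclidean_space set \<Rightarrow> ('a \<Rightarrow> real) set" where
  "test_functions \<Omega> =
     {\<phi>. (\<forall>k. C_k k \<phi>) \<and> (\<exists>K. compact K \<and> K \<subseteq> \<Omega> \<and> (\<forall>x. x \<notin> K \<longrightarrow> \<phi> x = 0))}"

definition locally_integrable :: "'a::euclidean_space set \<Rightarrow> ('a \<Rightarrow> 'b::euclidean_space) \<Rightarrow> bool" where
  "locally_integrable \<Omega> f \<longleftrightarrow> (\<forall>K. compact K \<and> K \<subseteq> \<Omega> \<longrightarrow> f absolutely_integrable_on K)"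

text \<open>\<open>weak_deriv \<Omega> [d1, ..., dk] f g\<close>: the locally integrable function \<open>g\<close> is the iterated
  distributional derivative of \<open>f\<close> on \<open>\<Omega>\<close> in the directions \<open>d1, ..., dk\<close>.\<close>

definition weak_deriv ::
  "'a::euclidean_space set \<Rightarrow> 'a list \<Rightarrow> ('a \<Rightarrow> 'b::euclidean_space) \<Rightarrow> ('a \<Rightarrow> 'b) \<Rightarrow> bool" where
  "weak_deriv \<Omega> ds f g \<longleftrightarrow>
     locally_integrable \<Omega> f \<and> locally_integrable \<Omega> g \<and>
     (\<forall>\<phi>\<in>test_functions \<Omega>.
        (LINT x:\<Omega>|lebesgue. foldr dir_deriv ds \<phi> x *\<^sub>R f x) =
          (-1) ^ length ds *\<^sub>R (LINT x:\<Omega>|lebesgue. \<phi> x *\<^sub>R g x))"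

text \<open>The norm of \<open>L\<^sup>p(S)\<close> for \<open>0 < p < \<infinity>\<close>, with value \<open>\<infinity>\<close> for measurable \<open>f\<close> outside
  \<open>L\<^sup>p(S)\<close>.\<close>

definition Lp_norm :: "real \<Rightarrow> 'a::euclidean_space set \<Rightarrow> ('a \<Rightarrow> 'b::real_normed_vector) \<Rightarrow> ennreal" where
  "Lp_norm p S f =
     (let I = (\<integral>\<^sup>+x\<in>S. ennreal (norm (f x) powr p) \<partial>lebesgue)
      in if I = \<infinity> then \<infinity> else ennreal (enn2real I powr (1 / p)))"

section \<open>The Stokes and Navier--Stokes equations\<close>

text \<open>Space-time points are pairs \<open>(x, t)\<close>; below, \<open>(b, 0)\<close> with \<open>b \<in> Basis\<close> is a spatial
  coordinate direction and \<open>(0, 1)\<close> the time direction.\<close>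

definition grad_x :: "('a::euclidean_space \<times> real \<Rightarrow> real) \<Rightarrow> 'a \<times> real \<Rightarrow> 'a" where
  "grad_x \<phi> z = (\<Sum>b\<in>Basis. dir_deriv (b, 0) \<phi> z *\<^sub>R b)"

definition laplace_x :: "('a::euclidean_space \<times> real \<Rightarrow> real) \<Rightarrow> 'a \<times> real \<Rightarrow> real" where
  "laplace_x \<phi> z = (\<Sum>b\<in>Basis. dir_deriv (b, 0) (dir_deriv (b, 0) \<phi>) z)"

definition D_t :: "('a::euclidean_space \<times> real \<Rightarrow> real) \<Rightarrow> 'a \<times> real \<Rightarrow> real" where
  "D_t \<phi> z = dir_deriv (0, 1) \<phi> z"

text \<open>\<open>u\<^sub>t - \<Delta>u + N + \<nabla>\<pi> = 0\<close> and \<open>div u = 0\<close> as distributions on \<open>\<Omega>\<close>. The momentum equation is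
  an identity of vectors: its \<open>i\<close>-th component is the \<open>i\<close>-th scalar equation tested with \<open>\<phi>\<close>.\<close>

definition distributional_solution ::
  "('a::euclidean_space \<times> real) set \<Rightarrow> ('a \<times> real \<Rightarrow> 'a) \<Rightarrow> ('a \<times> real \<Rightarrow> 'a) \<Rightarrow>
     ('a \<times> real \<Rightarrow> real) \<Rightarrow> bool" where
  "distributional_solution \<Omega> N u \<pi> \<longleftrightarrow>
     locally_integrable \<Omega> N \<and> locally_integrable \<Omega> u \<and> locally_integrable \<Omega> \<pi> \<and>
     (\<forall>\<phi>\<in>test_functions \<Omega>.
        (LINT z:\<Omega>|lebesgue.
           - D_t \<phi> z *\<^sub>R u z - laplace_x \<phi> z *\<^sub>R u z + \<phi> z *\<^sub>R N z - \<pi> z *\<^sub>R grad_x \<phi> z) = 0) \<and>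
     (\<forall>\<phi>\<in>test_functions \<Omega>. (LINT z:\<Omega>|lebesgue. u z \<bullet> grad_x \<phi> z) = 0)"

definition stokes_solution ::
  "('a::euclidean_space \<times> real) set \<Rightarrow> ('a \<times> real \<Rightarrow> 'a) \<Rightarrow> ('a \<times> real \<Rightarrow> real) \<Rightarrow> bool" where
  "stokes_solution \<Omega> u \<pi> \<longleftrightarrow> distributional_solution \<Omega> (\<lambda>z. 0) u \<pi>"

text \<open>\<open>G b\<close> is the weak derivative of \<open>u\<close> in the direction \<open>b\<close>, so that the sum below is the
  function \<open>(u \<cdot> \<nabla>)u\<close>, required to be locally integrable.\<close>

definition navier_stokes_solution ::
  "('a::euclidean_space \<times> real) set \<Rightarrow> ('a \<times> real \<Rightarrow> 'a) \<Rightarrow> ('a \<times> real \<Rightarrow> real) \<Rightarrow> bool" where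
  "navier_stokes_solution \<Omega> u \<pi> \<longleftrightarrow>
     (\<exists>G. (\<forall>b\<in>Basis. weak_deriv \<Omega> [(b, 0)] u (G b)) \<and>
          distributional_solution \<Omega> (\<lambda>z. \<Sum>b\<in>Basis. (u z \<bullet> b) *\<^sub>R G b z) u \<pi>)"

text \<open>\<open>v\<close> is the weak time derivative \<open>D\<^sub>t u\<close>, \<open>H b c\<close> the weak derivative \<open>\<partial>\<^sub>b \<partial>\<^sub>c u\<close>, and \<open>p\<close>
  the weak spatial gradient of \<open>\<pi>\<close>.\<close>

definition weak_time_deriv ::
  "('a::euclidean_space \<times> real) set \<Rightarrow> ('a \<times> real \<Rightarrow> 'a) \<Rightarrow> ('a \<times> real \<Rightarrow> 'a) \<Rightarrow> bool" where
  "weak_time_deriv \<Omega> u v \<longleftrightarrow> weak_deriv \<Omega> [(0, 1)] u v"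

definition weak_hessian ::
  "('a::euclidean_space \<times> real) set \<Rightarrow> ('a \<times> real \<Rightarrow> 'a) \<Rightarrow> ('a \<Rightarrow> 'a \<Rightarrow> 'a \<times> real \<Rightarrow> 'a) \<Rightarrow> bool" where
  "weak_hessian \<Omega> u H \<longleftrightarrow> (\<forall>b\<in>Basis. \<forall>c\<in>Basis. weak_deriv \<Omega> [(b, 0), (c, 0)] u (H b c))"

definition weak_gradient ::
  "('a::euclidean_space \<times> real) set \<Rightarrow> ('a \<times> real \<Rightarrow> real) \<Rightarrow> ('a \<times> real \<Rightarrow> 'a) \<Rightarrow> bool" where
  "weak_gradient \<Omega> \<pi> p \<longleftrightarrow> (\<forall>b\<in>Basis. weak_deriv \<Omega> [(b, 0)] \<pi> (\<lambda>z. p z \<bullet> b))"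

definition hessian_norm :: "('a::euclidean_space \<Rightarrow> 'a \<Rightarrow> 'a \<times> real \<Rightarrow> 'a) \<Rightarrow> 'a \<times> real \<Rightarrow> real" where
  "hessian_norm H z = sqrt (\<Sum>b\<in>Basis. \<Sum>c\<in>Basis. (norm (H b c z))\<^sup>2)"

section \<open>Half balls and the no-slip condition\<close>

text \<open>\<open>\<real>\<^sup>n\<close> is written as \<open>\<real>\<^sup>n\<^sup>-\<^sup>1 \<times> \<real>\<close>, \<open>x = (x', x\<^sub>n)\<close>, with \<open>n = CARD('m) + 1\<close>. As \<open>'m\<close> ranges
  over all (nonempty) finite types, \<open>n\<close> ranges over all integers \<open>\<ge> 2\<close>. The norm of the product
  type is the Euclidean one.\<close>

type_synonym 'm space = "(real ^ 'm) \<times> real"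

definition half_ball :: "real \<Rightarrow> ('m::finite) space set" where
  "half_ball r = {x. norm x < r \<and> snd x > 0}"

definition half_cylinder :: "real \<Rightarrow> (('m::finite) space \<times> real) set" where
  "half_cylinder r = half_ball r \<times> {1 - r\<^sup>2 <..< 1}"

definition flow_domain :: "(('m::finite) space \<times> real) set" where
  "flow_domain = half_ball 2 \<times> {0 <..< 4}"

definition flat_boundary :: "(('m::finite) space \<times> real) set" where
  "flat_boundary = {x. norm x < 2 \<and> snd x = 0} \<times> {0 <..< 4}"

text \<open>\<open>u = 0\<close> on the flat part of the boundary. Prescribing values on a null set alone would be void
  for a function determined up to null sets, so the value is also required to be attained as a limit
  from inside the domain.\<close>

definition no_slip :: "(('m::finite) space \<times> real \<Rightarrow> 'm space) \<Rightarrow> bool" where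
  "no_slip u \<longleftrightarrow> (\<forall>p\<in>flat_boundary. u p = 0 \<and> (u \<longlongrightarrow> 0) (at p within flow_domain))"

end

theory Submission
  imports Defs
begin

text \<open>The solution is a shear flow: \<open>u = v(y, t) e\<close> with a unit vector \<open>e\<close> parallel to the wall, where
\<open>y\<close> is the distance to the wall, and \<open>\<pi> = - f(t) (x \<bullet> e)\<close>. Such a field is divergence free and
\<open>(u \<bullet> \<nabla>) u = 0\<close>, because \<open>u\<close> is parallel to the wall and varies only across it. Hence one and the same pair
solves the Stokes and the Navier--Stokes equations as soon as
\<open>v\<^sub>t - v\<^sub>y\<^sub>y = f(t)\<close> and \<open>v(0, t) = 0\<close>.

Let \<open>f\<close> have size \<open>a\<close> during a time \<open>\<tau>\<close>. Away from the wall the fluid follows the pressure, so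
\<open>v\<^sub>t \<approx> f\<close>, and both \<open>D\<^sub>t u\<close> and \<open>\<nabla>\<pi>\<close> contribute about \<open>a\<^sup>r \<tau>\<close> to the integral of their \<open>r\<close>-th
power. At the wall \<open>v\<close> vanishes, and \<open>v\<^sub>y\<^sub>y \<approx> - f\<close> has to balance the pressure in a boundary layer of
thickness \<open>\<tau>\<^sup>1\<^sup>/\<^sup>2\<close>, so the second derivatives contribute only \<open>a\<^sup>r \<tau>\<^sup>3\<^sup>/\<^sup>2\<close>. With \<open>a = \<tau>\<^sup>-\<^sup>1\<^sup>/\<^sup>q\<close> the
first quantity is bounded exactly for \<open>r \<le> q\<close> and the second exactly for \<open>r \<le> 3 q / 2\<close> as
\<open>\<tau> \<rightarrow> 0\<close>.

Therefore \<open>f\<close> is a sum of bursts of durations \<open>\<tau>\<^sub>k = 4\<^sup>-\<^sup>(\<^sup>k\<^sup>+\<^sup>1\<^sup>)\<^sup>2\<close> and strengths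
\<open>4\<^sup>-\<^sup>(\<^sup>k\<^sup>+\<^sup>1\<^sup>) \<tau>\<^sub>k\<^sup>-\<^sup>1\<^sup>/\<^sup>q\<close>. The geometric factor makes the series converge at the critical exponents
(\<open>force_powr_integral_finite\<close>, \<open>velocity_yy_powr_integral_finite\<close>), and because \<open>\<tau>\<^sub>k\<close> decays faster than
geometrically, for every larger exponent already the single terms are unbounded
(\<open>shear_Lp_norms_infinite\<close>). All bursts end at time \<open>1\<close>, which is the upper end of the half cylinders: up to
then every term of the series for \<open>v\<^sub>t\<close>, and for \<open>- v\<^sub>y\<^sub>y\<close>, is nonnegative, so there are no cancellations and
a single term bounds the series from below.

The response to one burst is explicit. With \<open>flow\<close> the solution for \<open>f = 1\<close> on \<open>t > 0\<close>, started from rest, it is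
the difference of two time translates of \<open>flow\<close>. As \<open>flow\<close>, its \<open>y\<close>-derivative and \<open>layer\<close> (minus its second
\<open>y\<close>-derivative) are nondecreasing and Lipschitz continuous in time at a fixed distance from the wall, the series
for \<open>v\<close>, \<open>v\<^sub>y\<close> and \<open>v\<^sub>y\<^sub>y\<close> converge absolutely, locally uniformly off the wall, also at and after time \<open>1\<close>. The weak derivatives of the terms
come from integration by parts along lines (\<open>weak_deriv_along_lines\<close>), those of the series from dominated
convergence (\<open>weak_deriv_suminf\<close>).\<close>

section \<open>Weak derivatives of functions that are differentiable along lines\<close>

lemma test_function_C_k: "\<phi> \<in> test_functions \<Omega> \<Longrightarrow> C_k k \<phi>"
  by (simp add: test_functions_def)

lemma test_function_differentiable: "\<phi> \<in> test_functions \<Omega> \<Longrightarrow> \<phi> differentiable (at x)"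
  using test_function_C_k[of \<phi> \<Omega> "Suc 0"] by simp

lemma test_function_continuous: "\<phi> \<in> test_functions \<Omega> \<Longrightarrow> continuous_on UNIV \<phi>"
  using test_function_C_k[of \<phi> \<Omega> 0] by simp

lemma test_function_support:
  assumes "\<phi> \<in> test_functions \<Omega>"
  obtains K where "compact K" "K \<subseteq> \<Omega>" "\<And>x. x \<notin> K \<Longrightarrow> \<phi> x = 0"
  using assms by (auto simp: test_functions_def)

lemma dir_deriv_eq_0_off_support:
  assumes "closed K" "\<And>x. x \<notin> K \<Longrightarrow> \<phi> x = 0" "x \<notin> K"
  shows "dir_deriv d \<phi> x = 0"
proof -
  have "((\<lambda>x. 0) has_derivative (\<lambda>h. 0)) (at x)" by simp
  then have "(\<phi> has_derivative (\<lambda>h. 0)) (at x)"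
    by (rule has_derivative_transform_within_open[of _ _ _ _ "- K"]) (use assms in auto)
  then show ?thesis
    using frechet_derivative_at[of \<phi> "\<lambda>h. 0" x] by (metis dir_deriv_def)
qed

lemma dir_deriv_test_function:
  assumes "\<phi> \<in> test_functions \<Omega>" "b \<in> Basis"
  shows "dir_deriv b \<phi> \<in> test_functions \<Omega>"
proof -
  obtain K where K: "compact K" "K \<subseteq> \<Omega>" "\<And>x. x \<notin> K \<Longrightarrow> \<phi> x = 0"
    using test_function_support[OF assms(1)] by blast
  have "C_k k (dir_deriv b \<phi>)" for k
    using test_function_C_k[OF assms(1), of "Suc k"] assms(2) by simp
  moreover have "\<forall>x. x \<notin> K \<longrightarrow> dir_deriv b \<phi> x = 0"
    using dir_deriv_eq_0_off_support[of K \<phi>] K compact_imp_closed by blast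
  ultimately show ?thesis
    using K(1,2) by (auto simp: test_functions_def)
qed

lemma foldr_dir_deriv_test_function:
  assumes "\<phi> \<in> test_functions \<Omega>" "set ds \<subseteq> Basis"
  shows "foldr dir_deriv ds \<phi> \<in> test_functions \<Omega>"
  using assms(2) by (induction ds) (auto intro: dir_deriv_test_function assms(1))

lemma test_function_measurable [measurable]:
  "\<phi> \<in> test_functions \<Omega> \<Longrightarrow> \<phi> \<in> borel_measurable borel"
  using test_function_continuous by (rule borel_measurable_continuous_onI)

lemma test_function_bounded:
  assumes "\<phi> \<in> test_functions \<Omega>"
  obtains B where "B \<ge> 0" "\<And>x. \<bar>\<phi> x\<bar> \<le> B"
proof -
  obtain K where "compact K" "K \<subseteq> \<Omega>" and K: "\<And>x. x \<notin> K \<Longrightarrow> \<phi> x = 0"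
    using test_function_support[OF assms] by blast
  have "compact (\<phi> ` K)"
    using \<open>compact K\<close> continuous_on_subset[OF test_function_continuous[OF assms]]
    by (intro compact_continuous_image) auto
  then obtain B where B: "\<And>x. x \<in> K \<Longrightarrow> \<bar>\<phi> x\<bar> \<le> B"
    unfolding compact_eq_bounded_closed bounded_iff by auto
  have "\<bar>\<phi> x\<bar> \<le> max B 0" for x
    using B[of x] K[of x] by (cases "x \<in> K") auto
  then show ?thesis
    using that[of "max B 0"] by auto
qed

lemma integrable_test_function_times:
  fixes f :: "'a::euclidean_space \<Rightarrow> 'b::euclidean_space"
  assumes \<phi>: "\<phi> \<in> test_functions \<Omega>" and f: "locally_integrable \<Omega> f"
  shows "integrable lebesgue (\<lambda>x. \<phi> x *\<^sub>R f x)"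
proof -
  obtain K where K: "compact K" "K \<subseteq> \<Omega>" "\<And>x. x \<notin> K \<Longrightarrow> \<phi> x = 0"
    using test_function_support[OF \<phi>] by blast
  have K': "K \<in> sets lebesgue"
    using K(1) by (simp add: compact_imp_closed borel_closed)
  have "\<phi> \<in> borel_measurable (lebesgue_on K)"
    by (intro measurable_restrict_space1 measurable_completion)
       (simp add: test_function_measurable[OF \<phi>])
  moreover have "bounded (\<phi> ` K)"
    by (rule test_function_bounded[OF \<phi>]) (auto simp: bounded_iff)
  ultimately have "(\<lambda>x. \<phi> x *\<^sub>R f x) absolutely_integrable_on K"
    using f K(1,2) K' bilinear_conv_bounded_bilinear bounded_bilinear_scaleR
    by (intro absolutely_integrable_bounded_measurable_product[where h = "\<lambda>a b. a *\<^sub>R b"])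
       (auto simp: locally_integrable_def)
  then have "integrable lebesgue (\<lambda>x. indicator K x *\<^sub>R (\<phi> x *\<^sub>R f x))"
    by (simp add: set_integrable_def)
  moreover have "(\<lambda>x. indicator K x *\<^sub>R (\<phi> x *\<^sub>R f x)) = (\<lambda>x. \<phi> x *\<^sub>R f x)"
    using K(3) by (auto simp: indicator_def fun_eq_iff)
  ultimately show ?thesis by simp
qed

lemma set_integral_test_function_times:
  fixes f :: "'a::euclidean_space \<Rightarrow> 'b::euclidean_space"
  assumes \<phi>: "\<phi> \<in> test_functions \<Omega>"
  shows "(LINT x:\<Omega>|lebesgue. \<phi> x *\<^sub>R f x) = (LINT x|lebesgue. \<phi> x *\<^sub>R f x)"
proof -
  obtain K where K: "compact K" "K \<subseteq> \<Omega>" "\<And>x. x \<notin> K \<Longrightarrow> \<phi> x = 0"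
    using test_function_support[OF \<phi>] by blast
  have "(\<lambda>x. indicator \<Omega> x *\<^sub>R (\<phi> x *\<^sub>R f x)) = (\<lambda>x. \<phi> x *\<^sub>R f x)"
    using K by (auto simp: indicator_def fun_eq_iff)
  then show ?thesis by (simp add: set_lebesgue_integral_def)
qed

lemma weak_deriv_iff:
  assumes "set ds \<subseteq> Basis"
  shows "weak_deriv \<Omega> ds f g \<longleftrightarrow> locally_integrable \<Omega> f \<and> locally_integrable \<Omega> g \<and>
    (\<forall>\<phi>\<in>test_functions \<Omega>. (LINT x|lebesgue. foldr dir_deriv ds \<phi> x *\<^sub>R f x) =
          (-1) ^ length ds *\<^sub>R (LINT x|lebesgue. \<phi> x *\<^sub>R g x))"
  unfolding weak_deriv_def
  by (auto simp: set_integral_test_function_times foldr_dir_deriv_test_function[OF _ assms])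

lemma lborel_integral_translate:
  fixes f :: "'a::euclidean_space \<Rightarrow> real"
  assumes [measurable]: "f \<in> borel_measurable borel"
  shows "(LINT x|lborel. f (x + a)) = (LINT x|lborel. f x)"
    and "integrable lborel (\<lambda>x. f (x + a)) \<longleftrightarrow> integrable lborel f"
proof -
  have "(LINT x|lborel. f x) = (LINT x|distr lborel borel ((+) a). f x)"
    by (simp add: lborel_distr_plus)
  also have "\<dots> = (LINT x|lborel. f (x + a))"
    by (subst integral_distr) (auto simp: add.commute)
  finally show "(LINT x|lborel. f (x + a)) = (LINT x|lborel. f x)" ..
  have "integrable lborel f = integrable (distr lborel borel ((+) a)) f"
    by (simp add: lborel_distr_plus)
  also have "\<dots> = integrable lborel (\<lambda>x. f (x + a))"
    by (subst integrable_distr_eq) (auto simp: add.commute)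
  finally show "integrable lborel (\<lambda>x. f (x + a)) \<longleftrightarrow> integrable lborel f" ..
qed

text \<open>Averaging the increments of \<open>P\<close> over all of space gives \<open>0\<close> by translation invariance, and
  by Fubini it also gives the integral of the derivative \<open>Q\<close>.\<close>

lemma integral_directional_derivative_eq_0:
  fixes P Q :: "'a::euclidean_space \<Rightarrow> real"
  assumes P: "P \<in> borel_measurable borel" "integrable lborel P"
    and Q: "Q \<in> borel_measurable borel" "integrable lborel Q"
    and ftc: "\<And>x. ((\<lambda>s. Q (x + s *\<^sub>R d)) has_integral (P (x + d) - P x)) {0..1}"
  shows "(LINT x|lborel. Q x) = 0"
proof -
  note [measurable] = P(1) Q(1)
  define F where "F = (\<lambda>(s::real, x::'a). indicator {0..1} s * Q (x + s *\<^sub>R d))"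
  have F_meas [measurable]: "F \<in> borel_measurable (lborel \<Otimes>\<^sub>M lborel)"
    unfolding F_def by measurable
  have int_s: "integrable lborel (\<lambda>x. Q (x + s *\<^sub>R d))" for s
    using lborel_integral_translate(2)[OF Q(1)] Q(2) by simp
  have F_int: "integrable (lborel \<Otimes>\<^sub>M lborel) F"
  proof (rule lborel_pair.Fubini_integrable)
    have "(LINT x|lborel. norm (F (s, x))) = indicator {0..1} s * (LINT x|lborel. \<bar>Q x\<bar>)" for s
      using lborel_integral_translate(1)[of "\<lambda>x. \<bar>Q x\<bar>" "s *\<^sub>R d"]
      by (simp add: F_def abs_mult)
    then show "integrable lborel (\<lambda>s. LINT x|lborel. norm (F (s, x)))"
      by (simp del: real_norm_def)
    show "AE s in lborel. integrable lborel (\<lambda>x. F (s, x))"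
      by (simp add: F_def int_s)
  qed measurable
  have slice: "(LINT s|lborel. F (s, x)) = P (x + d) - P x"
    if "integrable lborel (\<lambda>s. F (s, x))" for x
  proof -
    have "((\<lambda>s. F (s, x)) has_integral (LINT s|lborel. F (s, x))) UNIV"
      using has_integral_integral_lborel[OF that] .
    moreover have "((\<lambda>s. F (s, x)) has_integral (P (x + d) - P x)) UNIV"
    proof -
      have "((\<lambda>s. if s \<in> {0..1} then Q (x + s *\<^sub>R d) else 0) has_integral (P (x + d) - P x)) UNIV"
        using ftc[of x] by (simp only: has_integral_restrict_UNIV)
      moreover have "(\<lambda>s. if s \<in> {0..1} then Q (x + s *\<^sub>R d) else 0) = (\<lambda>s. F (s, x))"
        by (auto simp: F_def fun_eq_iff)
      ultimately show ?thesis by simp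
    qed
    ultimately show ?thesis by (rule has_integral_unique)
  qed
  have "AE x in lborel. integrable lborel (\<lambda>s. F (s, x))"
    using lborel_pair.AE_integrable_snd[of "\<lambda>s x. F (s, x)"] F_int by simp
  then have AE: "AE x in lborel. (LINT s|lborel. F (s, x)) = P (x + d) - P x"
    using slice by (auto elim: eventually_mono)
  have P_shift: "integrable lborel (\<lambda>x. P (x + d))"
    using lborel_integral_translate(2)[OF P(1)] P(2) by simp
  have "(LINT x|lborel. Q x) = (LINT s|lborel. indicator {0..1::real} s * (LINT x|lborel. Q x))"
    by simp
  also have "\<dots> = (LINT s|lborel. LINT x|lborel. F (s, x))"
    using lborel_integral_translate(1)[OF Q(1)] by (simp add: F_def)
  also have "\<dots> = (LINT x|lborel. LINT s|lborel. F (s, x))"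
    using lborel_pair.Fubini_integral[of "\<lambda>s x. F (s, x)"] F_int by simp
  also have "\<dots> = (LINT x|lborel. P (x + d) - P x)"
    by (rule integral_cong_AE) (use AE in auto)
  also have "\<dots> = 0"
    using P_shift P(2) lborel_integral_translate(1)[OF P(1)] by simp
  finally show ?thesis .
qed

text \<open>The product \<open>\<phi> f\<close>, extended by \<open>0\<close> outside the support of \<open>\<phi>\<close>, satisfies the fundamental theorem of calculus on
every full line in direction \<open>d\<close>. The finite exceptional set on each line admits functions with corners,
such as a velocity whose driving force jumps.\<close>

lemma weak_deriv_along_lines:
  fixes f g :: "'a::euclidean_space \<Rightarrow> real"
  assumes "open \<Omega>" and d: "d \<in> Basis"
    and f_meas: "f \<in> borel_measurable borel" and g_meas: "g \<in> borel_measurable borel"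
    and f: "locally_integrable \<Omega> f" and g: "locally_integrable \<Omega> g"
    and cont: "\<And>x s. x + s *\<^sub>R d \<in> \<Omega> \<Longrightarrow> isCont (\<lambda>s. f (x + s *\<^sub>R d)) s"
    and der: "\<And>x. \<exists>S. finite S \<and> (\<forall>s. s \<notin> S \<longrightarrow> x + s *\<^sub>R d \<in> \<Omega> \<longrightarrow>
      ((\<lambda>s. f (x + s *\<^sub>R d)) has_real_derivative g (x + s *\<^sub>R d)) (at s))"
  shows "weak_deriv \<Omega> [d] f g"
proof -
  have "(LINT x|lebesgue. dir_deriv d \<phi> x *\<^sub>R f x) = - (LINT x|lebesgue. \<phi> x *\<^sub>R g x)"
    if \<phi>: "\<phi> \<in> test_functions \<Omega>" for \<phi>
  proof -
    obtain K where K: "compact K" "K \<subseteq> \<Omega>" "\<And>x. x \<notin> K \<Longrightarrow> \<phi> x = 0"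
      using test_function_support[OF \<phi>] by blast
    note D\<phi> = dir_deriv_test_function[OF \<phi> d]
    note [measurable] = test_function_measurable[OF \<phi>] test_function_measurable[OF D\<phi>]
      f_meas g_meas
    define P where "P = (\<lambda>x. \<phi> x * f x)"
    define Q where "Q = (\<lambda>x. dir_deriv d \<phi> x * f x + \<phi> x * g x)"
    have i1: "integrable lborel (\<lambda>x. dir_deriv d \<phi> x * f x)"
      and i2: "integrable lborel (\<lambda>x. \<phi> x * g x)" and i3: "integrable lborel P"
      using integrable_test_function_times[OF D\<phi> f] integrable_test_function_times[OF \<phi> g]
        integrable_test_function_times[OF \<phi> f]
      by (simp_all add: integrable_completion P_def)
    have \<phi>_line: "((\<lambda>s. \<phi> (x + s *\<^sub>R d)) has_real_derivative dir_deriv d \<phi> (x + s *\<^sub>R d)) (at s)"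
      for x s
    proof -
      have "(\<phi> has_derivative frechet_derivative \<phi> (at (x + s *\<^sub>R d))) (at (x + s *\<^sub>R d))"
        using test_function_differentiable[OF \<phi>] frechet_derivative_works by blast
      moreover have "((\<lambda>s. x + s *\<^sub>R d) has_vector_derivative d) (at s)"
        by (auto intro!: derivative_eq_intros)
      ultimately show ?thesis
        unfolding dir_deriv_def has_real_derivative_iff_has_vector_derivative
        using vector_derivative_diff_chain_within[of "\<lambda>s. x + s *\<^sub>R d" d s UNIV \<phi>]
        by (auto simp: o_def intro: has_derivative_at_withinI)
    qed
    have off: "eventually (\<lambda>s'. \<phi> (x + s' *\<^sub>R d) = 0) (nhds s)" if "x + s *\<^sub>R d \<notin> K" for x s
    proof -
      have "open ((\<lambda>s. x + s *\<^sub>R d) -` (- K))"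
        using K(1) by (intro open_vimage continuous_intros) (auto simp: compact_imp_closed open_Compl)
      then have "eventually (\<lambda>s'. s' \<in> (\<lambda>s. x + s *\<^sub>R d) -` (- K)) (nhds s)"
        using that by (intro eventually_nhds_in_open) auto
      then show ?thesis
        by eventually_elim (use K(3) in auto)
    qed
    have P_cont: "isCont (\<lambda>s. P (x + s *\<^sub>R d)) s" for x s
    proof (cases "x + s *\<^sub>R d \<in> K")
      case True
      then show ?thesis
        using cont K(2) DERIV_isCont[OF \<phi>_line] unfolding P_def
        by (intro continuous_intros) auto
    next
      case False
      have "eventually (\<lambda>s'. P (x + s' *\<^sub>R d) = 0) (nhds s)"
        using off[OF False] by eventually_elim (simp add: P_def)
      then show ?thesis
        using isCont_cong[of "\<lambda>s. P (x + s *\<^sub>R d)" "\<lambda>s. 0" s] by simp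
    qed
    have "((\<lambda>s. Q (x + s *\<^sub>R d)) has_integral (P (x + d) - P x)) {0..1}" for x
    proof -
      obtain S where S: "finite S" "\<And>s. s \<notin> S \<Longrightarrow> x + s *\<^sub>R d \<in> \<Omega> \<Longrightarrow>
          ((\<lambda>s. f (x + s *\<^sub>R d)) has_real_derivative g (x + s *\<^sub>R d)) (at s)"
        using der[of x] by blast
      have "((\<lambda>s. P (x + s *\<^sub>R d)) has_vector_derivative Q (x + s *\<^sub>R d)) (at s)" if "s \<notin> S" for s
      proof (cases "x + s *\<^sub>R d \<in> K")
        case True
        then have "((\<lambda>s. f (x + s *\<^sub>R d)) has_real_derivative g (x + s *\<^sub>R d)) (at s)"
          using S(2) that K(2) by blast
        then show ?thesis
          unfolding has_real_derivative_iff_has_vector_derivative[symmetric] P_def Q_def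
          by (intro DERIV_cong[OF DERIV_mult[OF \<phi>_line]]) (auto simp: mult.commute)
      next
        case False
        have "eventually (\<lambda>s'. P (x + s' *\<^sub>R d) = 0) (nhds s)"
          using off[OF False] by eventually_elim (simp add: P_def)
        then have "((\<lambda>s. P (x + s *\<^sub>R d)) has_real_derivative 0) (at s)"
          using DERIV_cong_ev[of s s "\<lambda>s. P (x + s *\<^sub>R d)" "\<lambda>s. 0" 0 0] by simp
        moreover have "Q (x + s *\<^sub>R d) = 0"
          using dir_deriv_eq_0_off_support[OF compact_imp_closed[OF K(1)] K(3) False] K(3)[OF False]
          by (simp add: Q_def)
        ultimately show ?thesis
          by (simp add: has_real_derivative_iff_has_vector_derivative)
      qed
      then have "((\<lambda>s. Q (x + s *\<^sub>R d)) has_integral (P (x + 1 *\<^sub>R d) - P (x + 0 *\<^sub>R d))) {0..1}"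
        using S(1) P_cont
        by (intro fundamental_theorem_of_calculus_strong[of S])
           (auto intro!: continuous_at_imp_continuous_on)
      then show ?thesis by simp
    qed
    then have "(LINT x|lborel. Q x) = 0"
      using i1 i2 i3
      by (intro integral_directional_derivative_eq_0[of P Q d]) (auto simp: P_def Q_def)
    then have "(LINT x|lborel. dir_deriv d \<phi> x * f x) = - (LINT x|lborel. \<phi> x * g x)"
      using i1 i2 by (simp add: Q_def)
    then show ?thesis
      by (simp add: integral_completion)
  qed
  then show ?thesis
    using f g d by (simp add: weak_deriv_iff)
qed

section \<open>Operations on weak derivatives\<close>

lemma locally_integrable_subset:
  "locally_integrable \<Omega> f \<Longrightarrow> \<Omega>' \<subseteq> \<Omega> \<Longrightarrow> locally_integrable \<Omega>' f"
  by (auto simp: locally_integrable_def)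

lemma test_functions_mono: "\<Omega>' \<subseteq> \<Omega> \<Longrightarrow> test_functions \<Omega>' \<subseteq> test_functions \<Omega>"
  by (force simp: test_functions_def)

lemma weak_deriv_subset:
  assumes "weak_deriv \<Omega> ds f g" "\<Omega>' \<subseteq> \<Omega>" "set ds \<subseteq> Basis"
  shows "weak_deriv \<Omega>' ds f g"
  using assms test_functions_mono[OF assms(2)]
  by (auto simp: weak_deriv_iff intro: locally_integrable_subset)

text \<open>A derivative of a test function is a test function, so the formula for \<open>g\<close> may be applied to it.\<close>

lemma weak_deriv_compose:
  assumes "weak_deriv \<Omega> [b] f g" "weak_deriv \<Omega> [c] g h" "b \<in> Basis" "c \<in> Basis"
  shows "weak_deriv \<Omega> [b, c] f h"
  using assms by (auto simp: weak_deriv_iff dir_deriv_test_function)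

lemma locally_integrable_scaleR:
  fixes f :: "'a::euclidean_space \<Rightarrow> real" and e :: "'b::euclidean_space"
  assumes "locally_integrable \<Omega> f"
  shows "locally_integrable \<Omega> (\<lambda>x. f x *\<^sub>R e)"
  unfolding locally_integrable_def
proof (intro allI impI)
  fix K assume "compact K \<and> K \<subseteq> \<Omega>"
  then have "f absolutely_integrable_on K"
    using assms by (simp add: locally_integrable_def)
  then have "((\<lambda>r. r *\<^sub>R e) \<circ> f) absolutely_integrable_on K"
    by (intro absolutely_integrable_linear bounded_linear_scaleR_left)
  then show "(\<lambda>x. f x *\<^sub>R e) absolutely_integrable_on K"
    by (simp add: o_def)
qed

lemma weak_deriv_scaleR:
  fixes f g :: "'a::euclidean_space \<Rightarrow> real" and e :: "'b::euclidean_space"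
  assumes fg: "weak_deriv \<Omega> ds f g" and ds: "set ds \<subseteq> Basis"
  shows "weak_deriv \<Omega> ds (\<lambda>x. f x *\<^sub>R e) (\<lambda>x. g x *\<^sub>R e)"
proof -
  have f: "locally_integrable \<Omega> f" and g: "locally_integrable \<Omega> g"
    using fg by (auto simp: weak_deriv_def)
  have "(LINT x|lebesgue. foldr dir_deriv ds \<phi> x *\<^sub>R f x *\<^sub>R e) =
      (-1) ^ length ds *\<^sub>R (LINT x|lebesgue. \<phi> x *\<^sub>R g x *\<^sub>R e)"
    if \<phi>: "\<phi> \<in> test_functions \<Omega>" for \<phi>
  proof -
    have "(LINT x|lebesgue. foldr dir_deriv ds \<phi> x *\<^sub>R f x *\<^sub>R e) =
        (LINT x|lebesgue. foldr dir_deriv ds \<phi> x *\<^sub>R f x) *\<^sub>R e"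
      using integrable_test_function_times[OF foldr_dir_deriv_test_function[OF \<phi> ds] f]
      by (subst integral_scaleR_left[symmetric]) auto
    also have "\<dots> = (-1) ^ length ds *\<^sub>R ((LINT x|lebesgue. \<phi> x *\<^sub>R g x) *\<^sub>R e)"
      using fg \<phi> ds by (simp add: weak_deriv_iff)
    also have "(LINT x|lebesgue. \<phi> x *\<^sub>R g x) *\<^sub>R e = (LINT x|lebesgue. \<phi> x *\<^sub>R g x *\<^sub>R e)"
      using integrable_test_function_times[OF \<phi> g]
      by (subst integral_scaleR_left[symmetric]) auto
    finally show ?thesis .
  qed
  then show ?thesis
    using f g ds by (simp add: weak_deriv_iff locally_integrable_scaleR)
qed

lemma weak_deriv_0:
  "set ds \<subseteq> Basis \<Longrightarrow> weak_deriv \<Omega> ds (\<lambda>x. 0) (\<lambda>x. 0)"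
  by (simp add: weak_deriv_iff locally_integrable_def set_integrable_def)

lemma abs_bounded_imp_summable:
  fixes f :: "nat \<Rightarrow> real"
  assumes "\<And>n. (\<Sum>k<n. \<bar>f k\<bar>) \<le> B"
  shows "summable f"
  by (rule summable_rabs_cancel, rule bounded_imp_summable[of _ B])
     (use assms[of "Suc _"] in \<open>auto simp: lessThan_Suc_atMost\<close>)

text \<open>Dominated convergence carries the integration by parts formula from the partial sums to the series. The bound
\<open>F\<close> only has to be locally integrable, so the sums may blow up at the boundary of \<open>\<Omega>\<close>.\<close>

lemma integral_test_function_suminf:
  fixes f :: "nat \<Rightarrow> 'a::euclidean_space \<Rightarrow> real"
  assumes \<phi>: "\<phi> \<in> test_functions \<Omega>"
    and f: "\<And>k. f k \<in> borel_measurable borel" "\<And>k. locally_integrable \<Omega> (f k)"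
    and F: "locally_integrable \<Omega> F" "\<And>x n. x \<in> \<Omega> \<Longrightarrow> (\<Sum>k<n. \<bar>f k x\<bar>) \<le> F x"
  shows "(\<lambda>n. \<Sum>k<n. LINT x|lebesgue. \<phi> x *\<^sub>R f k x) \<longlonglongrightarrow> (LINT x|lebesgue. \<phi> x *\<^sub>R (\<Sum>k. f k x))"
proof -
  note [measurable] = test_function_measurable[OF \<phi>] f(1)
  obtain K where K: "compact K" "K \<subseteq> \<Omega>" "\<And>x. x \<notin> K \<Longrightarrow> \<phi> x = 0"
    using test_function_support[OF \<phi>] by blast
  have "(\<lambda>n. LINT x|lebesgue. \<phi> x * (\<Sum>k<n. f k x)) \<longlonglongrightarrow> (LINT x|lebesgue. \<phi> x * (\<Sum>k. f k x))"
  proof (rule integral_dominated_convergence)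
    show "(\<lambda>x. \<phi> x * (\<Sum>k. f k x)) \<in> borel_measurable lebesgue"
      by (rule measurable_completion) simp
    show "(\<lambda>x. \<phi> x * (\<Sum>k<n. f k x)) \<in> borel_measurable lebesgue" for n
      by (rule measurable_completion) simp
    show "integrable lebesgue (\<lambda>x. \<bar>\<phi> x *\<^sub>R F x\<bar>)"
      by (intro integrable_abs integrable_test_function_times[OF \<phi> F(1)])
    show "AE x in lebesgue. (\<lambda>n. \<phi> x * (\<Sum>k<n. f k x)) \<longlonglongrightarrow> \<phi> x * (\<Sum>k. f k x)"
    proof (rule AE_I2)
      fix x
      show "(\<lambda>n. \<phi> x * (\<Sum>k<n. f k x)) \<longlonglongrightarrow> \<phi> x * (\<Sum>k. f k x)"
      proof (cases "x \<in> K")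
        case True
        then have "summable (\<lambda>k. f k x)"
          using F(2)[of x] K(2) by (intro abs_bounded_imp_summable) auto
        then show ?thesis
          by (intro tendsto_intros summable_LIMSEQ)
      qed (use K(3) in auto)
    qed
    show "AE x in lebesgue. norm (\<phi> x * (\<Sum>k<n. f k x)) \<le> \<bar>\<phi> x *\<^sub>R F x\<bar>" for n
    proof (rule AE_I2)
      fix x
      show "norm (\<phi> x * (\<Sum>k<n. f k x)) \<le> \<bar>\<phi> x *\<^sub>R F x\<bar>"
      proof (cases "x \<in> K")
        case True
        have "\<bar>\<Sum>k<n. f k x\<bar> \<le> (\<Sum>k<n. \<bar>f k x\<bar>)" by (rule sum_abs)
        also have "\<dots> \<le> \<bar>F x\<bar>" using F(2)[of x n] K(2) True by fastforce
        finally show ?thesis by (simp add: abs_mult mult_left_mono)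
      qed (use K(3) in auto)
    qed
  qed
  moreover have "(LINT x|lebesgue. \<phi> x * (\<Sum>k<n. f k x)) = (\<Sum>k<n. LINT x|lebesgue. \<phi> x *\<^sub>R f k x)"
    for n
    using integrable_test_function_times[OF \<phi> f(2)]
    by (subst Bochner_Integration.integral_sum[symmetric]) (auto simp: sum_distrib_left)
  ultimately show ?thesis by simp
qed

lemma locally_integrable_bounded_by:
  fixes f :: "'a::euclidean_space \<Rightarrow> real"
  assumes f: "f \<in> borel_measurable borel"
    and F: "locally_integrable \<Omega> F" and le: "\<And>x. x \<in> \<Omega> \<Longrightarrow> \<bar>f x\<bar> \<le> F x"
  shows "locally_integrable \<Omega> f"
  unfolding locally_integrable_def
proof (intro allI impI)
  fix K assume K: "compact K \<and> K \<subseteq> \<Omega>"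
  then have "F absolutely_integrable_on K"
    using F by (simp add: locally_integrable_def)
  moreover have "f \<in> borel_measurable (lebesgue_on K)"
    using f by (intro measurable_restrict_space1 measurable_completion) simp
  moreover have "K \<in> sets lebesgue" using K by (simp add: compact_imp_closed borel_closed)
  ultimately show "f absolutely_integrable_on K"
    using le K
    by (intro measurable_bounded_by_integrable_imp_absolutely_integrable[of f K F])
       (auto simp: set_lebesgue_integral_eq_integral)
qed

lemma locally_integrable_suminf:
  fixes f :: "nat \<Rightarrow> 'a::euclidean_space \<Rightarrow> real"
  assumes f: "\<And>k. f k \<in> borel_measurable borel"
    and F: "locally_integrable \<Omega> F" "\<And>x n. x \<in> \<Omega> \<Longrightarrow> (\<Sum>k<n. \<bar>f k x\<bar>) \<le> F x"
  shows "locally_integrable \<Omega> (\<lambda>x. \<Sum>k. f k x)"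
proof (rule locally_integrable_bounded_by[OF _ F(1)])
  show "(\<lambda>x. \<Sum>k. f k x) \<in> borel_measurable borel"
    using f by simp
  fix x assume x: "x \<in> \<Omega>"
  have "summable (\<lambda>k. \<bar>f k x\<bar>)"
    using F(2)[OF x] by (intro abs_bounded_imp_summable) auto
  then have "\<bar>\<Sum>k. f k x\<bar> \<le> (\<Sum>k. \<bar>f k x\<bar>)"
    by (rule summable_rabs)
  also have "\<dots> \<le> F x"
    using \<open>summable (\<lambda>k. \<bar>f k x\<bar>)\<close> F(2)[OF x] by (intro suminf_le_const) auto
  finally show "\<bar>\<Sum>k. f k x\<bar> \<le> F x" .
qed

lemma weak_deriv_suminf:
  fixes f g :: "nat \<Rightarrow> 'a::euclidean_space \<Rightarrow> real"
  assumes ds: "set ds \<subseteq> Basis" and fg: "\<And>k. weak_deriv \<Omega> ds (f k) (g k)"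
    and f: "\<And>k. f k \<in> borel_measurable borel" and g: "\<And>k. g k \<in> borel_measurable borel"
    and F: "locally_integrable \<Omega> F" "\<And>x n. x \<in> \<Omega> \<Longrightarrow> (\<Sum>k<n. \<bar>f k x\<bar>) \<le> F x"
    and G: "locally_integrable \<Omega> G" "\<And>x n. x \<in> \<Omega> \<Longrightarrow> (\<Sum>k<n. \<bar>g k x\<bar>) \<le> G x"
  shows "weak_deriv \<Omega> ds (\<lambda>x. \<Sum>k. f k x) (\<lambda>x. \<Sum>k. g k x)"
proof -
  have lf: "locally_integrable \<Omega> (f k)" and lg: "locally_integrable \<Omega> (g k)" for k
    using fg by (auto simp: weak_deriv_def)
  have "(LINT x|lebesgue. foldr dir_deriv ds \<phi> x *\<^sub>R (\<Sum>k. f k x)) =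
      (-1) ^ length ds *\<^sub>R (LINT x|lebesgue. \<phi> x *\<^sub>R (\<Sum>k. g k x))"
    if \<phi>: "\<phi> \<in> test_functions \<Omega>" for \<phi>
  proof (rule LIMSEQ_unique)
    show "(\<lambda>n. \<Sum>k<n. LINT x|lebesgue. foldr dir_deriv ds \<phi> x *\<^sub>R f k x)
        \<longlonglongrightarrow> (LINT x|lebesgue. foldr dir_deriv ds \<phi> x *\<^sub>R (\<Sum>k. f k x))"
      by (rule integral_test_function_suminf[OF foldr_dir_deriv_test_function[OF \<phi> ds] f lf F])
    have "(\<lambda>n. (-1) ^ length ds *\<^sub>R (\<Sum>k<n. LINT x|lebesgue. \<phi> x *\<^sub>R g k x))
        \<longlonglongrightarrow> (-1) ^ length ds *\<^sub>R (LINT x|lebesgue. \<phi> x *\<^sub>R (\<Sum>k. g k x))"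
      by (intro tendsto_intros integral_test_function_suminf[OF \<phi> g lg G])
    moreover have "(-1) ^ length ds *\<^sub>R (\<Sum>k<n. LINT x|lebesgue. \<phi> x *\<^sub>R g k x) =
        (\<Sum>k<n. LINT x|lebesgue. foldr dir_deriv ds \<phi> x *\<^sub>R f k x)" for n
      using fg \<phi> ds by (simp add: weak_deriv_iff sum_distrib_left)
    ultimately show "(\<lambda>n. \<Sum>k<n. LINT x|lebesgue. foldr dir_deriv ds \<phi> x *\<^sub>R f k x)
        \<longlonglongrightarrow> (-1) ^ length ds *\<^sub>R (LINT x|lebesgue. \<phi> x *\<^sub>R (\<Sum>k. g k x))"
      by (simp only:)
  qed
  then show ?thesis
    using locally_integrable_suminf[OF f F] locally_integrable_suminf[OF g G] ds
    by (simp add: weak_deriv_iff)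
qed

lemma Basis_pair: "b \<in> Basis \<Longrightarrow> (b, 0) \<in> Basis" "c \<in> Basis \<Longrightarrow> (0, c) \<in> Basis"
  by (auto simp: Basis_prod_def)

text \<open>If all derivatives in the equations exist as locally integrable functions, it suffices to verify the equations
pointwise: each derivative is moved from the test function to \<open>u\<close> or \<open>\<pi>\<close> separately.\<close>

lemma distributional_solution_of_weak_derivs:
  fixes u v :: "'a::euclidean_space \<times> real \<Rightarrow> 'a"
  assumes v: "weak_time_deriv \<Omega> u v" and H: "weak_hessian \<Omega> u H" and p: "weak_gradient \<Omega> \<pi> p"
    and G: "\<And>b. b \<in> Basis \<Longrightarrow> weak_deriv \<Omega> [(b, 0)] u (G b)"
    and N: "locally_integrable \<Omega> N"
    and momentum: "\<And>z. z \<in> \<Omega> \<Longrightarrow> v z - (\<Sum>b\<in>Basis. H b b z) + N z + p z = 0"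
    and divergence: "\<And>z. z \<in> \<Omega> \<Longrightarrow> (\<Sum>b\<in>Basis. G b z \<bullet> b) = 0"
  shows "distributional_solution \<Omega> N u \<pi>"
proof -
  have lu: "locally_integrable \<Omega> u" and lv: "locally_integrable \<Omega> v"
    using v by (auto simp: weak_time_deriv_def weak_deriv_def)
  have lH: "locally_integrable \<Omega> (H b b)" if "b \<in> Basis" for b
    using H that by (auto simp: weak_hessian_def weak_deriv_def)
  have lG: "locally_integrable \<Omega> (G b)" if "b \<in> Basis" for b
    using G that by (auto simp: weak_deriv_def)
  have l\<pi>: "locally_integrable \<Omega> \<pi>"
    using p SOME_Basis by (auto simp: weak_gradient_def weak_deriv_def)
  have lp: "locally_integrable \<Omega> (\<lambda>z. p z \<bullet> b)" if "b \<in> Basis" for b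
    using p that by (auto simp: weak_gradient_def weak_deriv_def)
  have momentum_int: "(LINT z:\<Omega>|lebesgue.
      - D_t \<phi> z *\<^sub>R u z - laplace_x \<phi> z *\<^sub>R u z + \<phi> z *\<^sub>R N z - \<pi> z *\<^sub>R grad_x \<phi> z) = 0"
    if \<phi>: "\<phi> \<in> test_functions \<Omega>" for \<phi>
  proof -
    obtain K where K: "compact K" "K \<subseteq> \<Omega>" "\<And>x. x \<notin> K \<Longrightarrow> \<phi> x = 0"
      using test_function_support[OF \<phi>] by blast
    have T\<phi>: "dir_deriv d \<phi> \<in> test_functions \<Omega>" if "d \<in> Basis" for d
      using dir_deriv_test_function[OF \<phi> that] .
    have time: "(0, 1) \<in> (Basis :: ('a \<times> real) set)"
      by (simp add: Basis_pair)
    have T2\<phi>: "dir_deriv d (dir_deriv d \<phi>) \<in> test_functions \<Omega>" if "d \<in> Basis" for d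
      using dir_deriv_test_function[OF T\<phi>[OF that] that] .
    have off: "dir_deriv d \<phi> z = 0" "dir_deriv d (dir_deriv d \<phi>) z = 0" if "z \<notin> K" for d z
      using dir_deriv_eq_0_off_support[of K] compact_imp_closed[OF K(1)] K(3) that by metis+
    let ?I = "integrable lebesgue"
    have i1: "?I (\<lambda>z. D_t \<phi> z *\<^sub>R u z)"
      using integrable_test_function_times[OF T\<phi>[OF time] lu] by (simp add: D_t_def)
    have i2: "?I (\<lambda>z. dir_deriv (b, 0) (dir_deriv (b, 0) \<phi>) z *\<^sub>R u z)" if "b \<in> Basis" for b
      using integrable_test_function_times[OF T2\<phi> lu] that by (simp add: Basis_pair)
    have i3: "?I (\<lambda>z. \<phi> z *\<^sub>R N z)"
      by (rule integrable_test_function_times[OF \<phi> N])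
    have i4: "?I (\<lambda>z. dir_deriv (b, 0) \<phi> z * \<pi> z)" if "b \<in> Basis" for b
      using integrable_test_function_times[OF T\<phi> l\<pi>] that by (simp add: Basis_pair)
    have i5: "?I (\<lambda>z. \<phi> z *\<^sub>R v z)"
      by (rule integrable_test_function_times[OF \<phi> lv])
    have i6: "?I (\<lambda>z. \<phi> z *\<^sub>R H b b z)" if "b \<in> Basis" for b
      by (rule integrable_test_function_times[OF \<phi> lH[OF that]])
    have i7: "?I (\<lambda>z. \<phi> z * (p z \<bullet> b))" if "b \<in> Basis" for b
      using integrable_test_function_times[OF \<phi> lp[OF that]] by simp
    have e1: "(LINT z|lebesgue. D_t \<phi> z *\<^sub>R u z) = - (LINT z|lebesgue. \<phi> z *\<^sub>R v z)"
      using v \<phi> time by (simp add: weak_time_deriv_def weak_deriv_iff D_t_def)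
    have e2: "(LINT z|lebesgue. dir_deriv (b, 0) (dir_deriv (b, 0) \<phi>) z *\<^sub>R u z) =
        (LINT z|lebesgue. \<phi> z *\<^sub>R H b b z)" if "b \<in> Basis" for b
      using H \<phi> that by (simp add: weak_hessian_def weak_deriv_iff Basis_pair)
    have e4: "(LINT z|lebesgue. dir_deriv (b, 0) \<phi> z * \<pi> z) = - (LINT z|lebesgue. \<phi> z * (p z \<bullet> b))"
      if "b \<in> Basis" for b
      using p \<phi> that by (simp add: weak_gradient_def weak_deriv_iff Basis_pair)
    have "(LINT z:\<Omega>|lebesgue.
        - D_t \<phi> z *\<^sub>R u z - laplace_x \<phi> z *\<^sub>R u z + \<phi> z *\<^sub>R N z - \<pi> z *\<^sub>R grad_x \<phi> z) =
      (LINT z|lebesgue. - (D_t \<phi> z *\<^sub>R u z)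
        - (\<Sum>b\<in>Basis. dir_deriv (b, 0) (dir_deriv (b, 0) \<phi>) z *\<^sub>R u z) + \<phi> z *\<^sub>R N z
        - (\<Sum>b\<in>Basis. (dir_deriv (b, 0) \<phi> z * \<pi> z) *\<^sub>R b))"
      unfolding set_lebesgue_integral_def
    proof (rule Bochner_Integration.integral_cong[OF refl])
      fix z
      show "indicat_real \<Omega> z *\<^sub>R (- D_t \<phi> z *\<^sub>R u z - laplace_x \<phi> z *\<^sub>R u z + \<phi> z *\<^sub>R N z
          - \<pi> z *\<^sub>R grad_x \<phi> z) =
        - (D_t \<phi> z *\<^sub>R u z)
        - (\<Sum>b\<in>Basis. dir_deriv (b, 0) (dir_deriv (b, 0) \<phi>) z *\<^sub>R u z) + \<phi> z *\<^sub>R N z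
        - (\<Sum>b\<in>Basis. (dir_deriv (b, 0) \<phi> z * \<pi> z) *\<^sub>R b)"
        using off[of z] K(2) K(3)[of z]
        by (cases "z \<in> K")
           (auto simp: D_t_def laplace_x_def grad_x_def scaleR_sum_left scaleR_sum_right mult.commute)
    qed
    also have "\<dots> = - (LINT z|lebesgue. D_t \<phi> z *\<^sub>R u z)
        - (\<Sum>b\<in>Basis. LINT z|lebesgue. dir_deriv (b, 0) (dir_deriv (b, 0) \<phi>) z *\<^sub>R u z)
        + (LINT z|lebesgue. \<phi> z *\<^sub>R N z)
        - (\<Sum>b\<in>Basis. (LINT z|lebesgue. dir_deriv (b, 0) \<phi> z * \<pi> z) *\<^sub>R b)"
      using i1 i2 i3 i4 by simp
    also have "\<dots> = (LINT z|lebesgue. \<phi> z *\<^sub>R v z) - (\<Sum>b\<in>Basis. LINT z|lebesgue. \<phi> z *\<^sub>R H b b z)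
        + (LINT z|lebesgue. \<phi> z *\<^sub>R N z) + (\<Sum>b\<in>Basis. (LINT z|lebesgue. \<phi> z * (p z \<bullet> b)) *\<^sub>R b)"
      by (simp add: e1 e2 e4 sum_negf)
    also have "\<dots> = (LINT z|lebesgue. \<phi> z *\<^sub>R v z - (\<Sum>b\<in>Basis. \<phi> z *\<^sub>R H b b z) + \<phi> z *\<^sub>R N z
        + (\<Sum>b\<in>Basis. (\<phi> z * (p z \<bullet> b)) *\<^sub>R b))"
      using i5 i6 i3 i7 by simp
    also have "\<dots> = (LINT z|(lebesgue :: ('a \<times> real) measure). (0 :: 'a))"
    proof (rule Bochner_Integration.integral_cong[OF refl])
      fix z
      have "(\<Sum>b\<in>Basis. (\<phi> z * (p z \<bullet> b)) *\<^sub>R b) = \<phi> z *\<^sub>R p z"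
        by (subst (2) euclidean_representation[of "p z", symmetric])
           (simp only: scaleR_sum_right scaleR_scaleR)
      then have "\<phi> z *\<^sub>R v z - (\<Sum>b\<in>Basis. \<phi> z *\<^sub>R H b b z) + \<phi> z *\<^sub>R N z
          + (\<Sum>b\<in>Basis. (\<phi> z * (p z \<bullet> b)) *\<^sub>R b) =
        \<phi> z *\<^sub>R (v z - (\<Sum>b\<in>Basis. H b b z) + N z + p z)"
        by (simp add: scaleR_sum_right algebra_simps)
      also have "\<dots> = 0"
        using momentum[of z] K(2) K(3)[of z] by (cases "z \<in> K") auto
      finally show "\<phi> z *\<^sub>R v z - (\<Sum>b\<in>Basis. \<phi> z *\<^sub>R H b b z) + \<phi> z *\<^sub>R N z
          + (\<Sum>b\<in>Basis. (\<phi> z * (p z \<bullet> b)) *\<^sub>R b) = 0" .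
    qed
    finally show ?thesis by simp
  qed
  have divergence_int: "(LINT z:\<Omega>|lebesgue. u z \<bullet> grad_x \<phi> z) = 0"
    if \<phi>: "\<phi> \<in> test_functions \<Omega>" for \<phi>
  proof -
    obtain K where K: "compact K" "K \<subseteq> \<Omega>" "\<And>x. x \<notin> K \<Longrightarrow> \<phi> x = 0"
      using test_function_support[OF \<phi>] by blast
    have T\<phi>: "dir_deriv d \<phi> \<in> test_functions \<Omega>" if "d \<in> Basis" for d
      using dir_deriv_test_function[OF \<phi> that] .
    have off: "dir_deriv d \<phi> z = 0" if "z \<notin> K" for d z
      using dir_deriv_eq_0_off_support[of K] compact_imp_closed[OF K(1)] K(3) that by metis
    have i1: "integrable lebesgue (\<lambda>z. dir_deriv (b, 0) \<phi> z *\<^sub>R u z)" if "b \<in> Basis" for b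
      using integrable_test_function_times[OF T\<phi> lu] that by (simp add: Basis_pair)
    have i2: "integrable lebesgue (\<lambda>z. \<phi> z *\<^sub>R G b z)" if "b \<in> Basis" for b
      using integrable_test_function_times[OF \<phi> lG] that by simp
    have e: "(LINT z|lebesgue. dir_deriv (b, 0) \<phi> z *\<^sub>R u z) = - (LINT z|lebesgue. \<phi> z *\<^sub>R G b z)"
      if "b \<in> Basis" for b
      using G[OF that] \<phi> that by (simp add: weak_deriv_iff Basis_pair)
    have "(LINT z:\<Omega>|lebesgue. u z \<bullet> grad_x \<phi> z) =
      (LINT z|lebesgue. (\<Sum>b\<in>Basis. (dir_deriv (b, 0) \<phi> z *\<^sub>R u z) \<bullet> b))"
      unfolding set_lebesgue_integral_def
    proof (rule Bochner_Integration.integral_cong[OF refl])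
      fix z
      show "indicat_real \<Omega> z *\<^sub>R (u z \<bullet> grad_x \<phi> z) =
          (\<Sum>b\<in>Basis. (dir_deriv (b, 0) \<phi> z *\<^sub>R u z) \<bullet> b)"
        using off[of z] K(2)
        by (cases "z \<in> K") (auto simp: grad_x_def inner_sum_right mult.commute)
    qed
    also have "\<dots> = (\<Sum>b\<in>Basis. (LINT z|lebesgue. dir_deriv (b, 0) \<phi> z *\<^sub>R u z) \<bullet> b)"
      using i1 by (subst Bochner_Integration.integral_sum) (auto simp del: inner_scaleR_left)
    also have "\<dots> = - (\<Sum>b\<in>Basis. (LINT z|lebesgue. \<phi> z *\<^sub>R G b z) \<bullet> b)"
      by (simp add: e sum_negf)
    also have "\<dots> = - (LINT z|lebesgue. (\<Sum>b\<in>Basis. (\<phi> z *\<^sub>R G b z) \<bullet> b))"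
      using i2 by (subst Bochner_Integration.integral_sum) (auto simp del: inner_scaleR_left)
    also have "\<dots> = - (LINT z|(lebesgue :: ('a \<times> real) measure). (0 :: real))"
    proof (rule arg_cong[where f = uminus], rule Bochner_Integration.integral_cong[OF refl])
      fix z
      have "(\<Sum>b\<in>Basis. (\<phi> z *\<^sub>R G b z) \<bullet> b) = \<phi> z * (\<Sum>b\<in>Basis. G b z \<bullet> b)"
        by (simp add: sum_distrib_left)
      also have "\<dots> = 0"
        using divergence[of z] K(2) K(3)[of z] by (cases "z \<in> K") auto
      finally show "(\<Sum>b\<in>Basis. (\<phi> z *\<^sub>R G b z) \<bullet> b) = 0" .
    qed
    finally show ?thesis by simp
  qed
  show ?thesis
    unfolding distributional_solution_def
    using N lu l\<pi> momentum_int divergence_int by blast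
qed

section \<open>The flow set in motion by a constant pressure gradient\<close>

definition gauss_primitive :: "real \<Rightarrow> real" where
  "gauss_primitive z = integral {0..z} (\<lambda>s. exp (- (s\<^sup>2)))"

text \<open>The integral of \<open>exp (- s\<^sup>2)\<close> over the half line, that is \<open>\<surd>\<pi> / 2\<close>. It normalises \<open>erfc\<close> to decrease from \<open>1\<close> at
\<open>0\<close> to the limit \<open>0\<close>.\<close>

definition gauss_mass :: real where
  "gauss_mass = (SUP z\<in>{0..}. gauss_primitive z)"

definition erfc :: "real \<Rightarrow> real" where
  "erfc z = 1 - gauss_primitive z / gauss_mass"

lemma gauss_primitive_DERIV:
  assumes "z > 0"
  shows "(gauss_primitive has_real_derivative exp (- (z\<^sup>2))) (at z)"
proof -
  have "((\<lambda>z. integral {0..z} (\<lambda>s. exp (- (s\<^sup>2)))) has_real_derivative exp (- (z\<^sup>2)))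
      (at z within {0..z + 1})"
    using assms by (intro integral_has_real_derivative continuous_intros) auto
  then show ?thesis
    using assms by (simp add: gauss_primitive_def [abs_def] at_within_Icc_at)
qed

text \<open>The last bound uses \<open>- s\<^sup>2 \<le> 1/4 - s\<close>. It is uniform in \<open>b\<close>, which gives both the finiteness of the total mass and the
exponential decay of \<open>erfc\<close>.\<close>

lemma gauss_primitive_diff_bounds:
  assumes "0 \<le> a" "a \<le> b"
  shows "(b - a) * exp (- (b\<^sup>2)) \<le> gauss_primitive b - gauss_primitive a"
    and "gauss_primitive b - gauss_primitive a \<le> b - a"
    and "gauss_primitive b - gauss_primitive a \<le> exp (1/4) * exp (- a)"
proof -
  have i: "(\<lambda>s. exp (- (s\<^sup>2))) integrable_on {x..y}" for x y :: real
    by (intro integrable_continuous_interval continuous_intros)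
  have eq: "gauss_primitive b - gauss_primitive a = integral {a..b} (\<lambda>s. exp (- (s\<^sup>2)))"
    unfolding gauss_primitive_def
    using Henstock_Kurzweil_Integration.integral_combine[OF assms i] by simp
  have "integral {a..b} (\<lambda>s. exp (- (b\<^sup>2))) \<le> integral {a..b} (\<lambda>s. exp (- (s\<^sup>2)))"
    by (intro integral_le i) (use assms in \<open>auto intro: power_mono\<close>)
  then show "(b - a) * exp (- (b\<^sup>2)) \<le> gauss_primitive b - gauss_primitive a"
    using assms by (simp add: eq)
  have "integral {a..b} (\<lambda>s. exp (- (s\<^sup>2))) \<le> integral {a..b} (\<lambda>s. 1)"
    by (intro integral_le i) auto
  then show "gauss_primitive b - gauss_primitive a \<le> b - a"
    using assms by (simp add: eq)
  have "((\<lambda>s. exp (1/4) * exp (- s)) has_integral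
      (- (exp (1/4) * exp (- b)) - - (exp (1/4) * exp (- a)))) {a..b}"
    using assms(2)
    by (intro fundamental_theorem_of_calculus)
       (auto simp: has_real_derivative_iff_has_vector_derivative[symmetric] intro!: derivative_eq_intros)
  moreover have "exp (- (s\<^sup>2)) \<le> exp (1/4) * exp (- s)" for s :: real
  proof -
    have "0 \<le> (s - 1/2)\<^sup>2" by simp
    then have "- (s\<^sup>2) \<le> 1/4 + - s" by (simp add: power2_diff power_divide)
    then have "exp (- (s\<^sup>2)) \<le> exp (1/4 + - s)" by (simp only: exp_le_cancel_iff)
    then show ?thesis by (simp only: exp_add)
  qed
  ultimately have "integral {a..b} (\<lambda>s. exp (- (s\<^sup>2)))
      \<le> - (exp (1/4) * exp (- b)) - - (exp (1/4) * exp (- a))"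
    by (intro has_integral_le[OF integrable_integral[OF i]]) auto
  also have "\<dots> \<le> exp (1/4) * exp (- a)" by simp
  finally show "gauss_primitive b - gauss_primitive a \<le> exp (1/4) * exp (- a)"
    by (simp add: eq)
qed

lemma gauss_primitive_0 [simp]: "gauss_primitive 0 = 0"
  by (simp add: gauss_primitive_def)

lemma gauss_primitive_strict_mono:
  assumes "0 \<le> a" "a < b"
  shows "gauss_primitive a < gauss_primitive b"
proof -
  have "0 < (b - a) * exp (- (b\<^sup>2))" using assms by simp
  then show ?thesis using gauss_primitive_diff_bounds(1)[of a b] assms by linarith
qed

lemma gauss_primitive_less_mass:
  assumes "0 \<le> z"
  shows "gauss_primitive z < gauss_mass"
proof -
  have "bdd_above (gauss_primitive ` {0..})"
    using gauss_primitive_diff_bounds(3)[of 0] by (auto intro!: bdd_aboveI[of _ "exp (1/4)"])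
  then have "gauss_primitive (z + 1) \<le> gauss_mass"
    unfolding gauss_mass_def using assms by (intro cSUP_upper) auto
  then show ?thesis
    using gauss_primitive_strict_mono[OF assms, of "z + 1"] by simp
qed

lemma gauss_mass_pos: "gauss_mass > 0"
  using gauss_primitive_less_mass[of 0] by simp

lemma gauss_mass_le:
  assumes "0 \<le> z"
  shows "gauss_mass \<le> gauss_primitive z + exp (1/4) * exp (- z)"
  unfolding gauss_mass_def
proof (rule cSUP_least)
  fix w :: real assume w: "w \<in> {0..}"
  have "0 < exp (1/4) * exp (- z)" by simp
  moreover have "gauss_primitive w < gauss_primitive z" if "w < z"
    using gauss_primitive_strict_mono w that by auto
  ultimately show "gauss_primitive w \<le> gauss_primitive z + exp (1/4) * exp (- z)"
    using gauss_primitive_diff_bounds(3)[of z w] assms by (cases "z \<le> w") linarith+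
qed auto

lemma erfc_0 [simp]: "erfc 0 = 1"
  by (simp add: erfc_def)

lemma erfc_pos: "0 \<le> z \<Longrightarrow> 0 < erfc z"
  using gauss_primitive_less_mass[of z] gauss_mass_pos by (simp add: erfc_def)

lemma erfc_strict_antimono: "0 \<le> a \<Longrightarrow> a < b \<Longrightarrow> erfc b < erfc a"
  using gauss_primitive_strict_mono gauss_mass_pos by (simp add: erfc_def divide_strict_right_mono)

lemma erfc_antimono: "0 \<le> a \<Longrightarrow> a \<le> b \<Longrightarrow> erfc b \<le> erfc a"
  using erfc_strict_antimono[of a b] by (cases "a = b") auto

lemma erfc_le_1: "0 \<le> z \<Longrightarrow> erfc z \<le> 1"
  using erfc_antimono[of 0 z] by simp

lemma erfc_less_1: "0 < z \<Longrightarrow> erfc z < 1"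
  using erfc_strict_antimono[of 0 z] by simp

lemma erfc_ge: "0 \<le> z \<Longrightarrow> 1 - erfc z \<le> z / gauss_mass"
  using gauss_primitive_diff_bounds(2)[of 0 z] gauss_mass_pos
  by (simp add: erfc_def divide_right_mono)

lemma erfc_le_exp:
  assumes "0 \<le> z"
  shows "erfc z \<le> exp (1/4) / gauss_mass * exp (- z)"
proof -
  have "gauss_mass - gauss_primitive z \<le> exp (1/4) * exp (- z)"
    using gauss_mass_le[OF assms] by simp
  then have "(gauss_mass - gauss_primitive z) / gauss_mass \<le> exp (1/4) * exp (- z) / gauss_mass"
    using gauss_mass_pos by (intro divide_right_mono) auto
  then show ?thesis
    using gauss_mass_pos by (simp add: erfc_def diff_divide_distrib)
qed

lemma erfc_DERIV:
  assumes "z > 0"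
  shows "(erfc has_real_derivative - (exp (- (z\<^sup>2)) / gauss_mass)) (at z)"
  unfolding erfc_def[abs_def]
  using gauss_mass_pos by (auto intro!: derivative_eq_intros gauss_primitive_DERIV[OF assms])

lemma exp_minus_le_inverse_square:
  fixes z :: real
  assumes "0 < z"
  shows "exp (- z) \<le> 2 / z\<^sup>2"
proof -
  have "z\<^sup>2 / 2 \<le> exp z"
    using exp_lower_Taylor_quadratic[of z] assms by simp
  then show ?thesis
    using assms by (simp add: exp_minus field_simps)
qed

text \<open>The solution of \<open>v\<^sub>t - v\<^sub>y\<^sub>y = 1\<close> for \<open>t > 0\<close>, started from rest, with \<open>v = 0\<close> at \<open>y = 0\<close>: it is \<open>t\<close> minus \<open>4 t\<close> times the
twice iterated integral of \<open>erfc\<close> at \<open>z = y / (2 \<surd>t)\<close>. The next two functions are \<open>v\<^sub>y\<close> and \<open>- v\<^sub>y\<^sub>y\<close>.\<close>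

definition flow :: "real \<Rightarrow> real \<Rightarrow> real" where
  "flow y t = (if t \<le> 0 then 0 else t - (t + y\<^sup>2 / 2) * erfc (y / (2 * sqrt t))
      + y * sqrt t * exp (- (y\<^sup>2 / (4 * t))) / (2 * gauss_mass))"

definition flow_y :: "real \<Rightarrow> real \<Rightarrow> real" where
  "flow_y y t = (if t \<le> 0 then 0 else sqrt t * exp (- (y\<^sup>2 / (4 * t))) / gauss_mass
      - y * erfc (y / (2 * sqrt t)))"

definition layer :: "real \<Rightarrow> real \<Rightarrow> real" where
  "layer y t = (if t \<le> 0 then 0 else erfc (y / (2 * sqrt t)))"

lemma erfc_similarity_DERIV_t:
  assumes "y > 0" "t > 0"
  shows "((\<lambda>t. erfc (y / (2 * sqrt t))) has_real_derivative
    exp (- (y\<^sup>2 / (4 * t))) * y / (4 * t * sqrt t * gauss_mass)) (at t)"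
proof -
  have d: "((\<lambda>t. y / (2 * sqrt t)) has_real_derivative - (y / (4 * t * sqrt t))) (at t)"
    using assms by (auto intro!: derivative_eq_intros simp: field_simps power2_eq_square)
  have sq: "(y / (2 * sqrt t))\<^sup>2 = y\<^sup>2 / (4 * t)"
    using assms by (simp add: power_divide power_mult_distrib)
  have pos: "y / (2 * sqrt t) > 0"
    using assms by simp
  show ?thesis
    by (rule DERIV_cong[OF DERIV_chain2[OF erfc_DERIV[OF pos] d]])
      (use assms in \<open>simp add: power_divide power_mult_distrib mult.commute\<close>)
qed

lemma erfc_similarity_DERIV_y:
  assumes "y > 0" "t > 0"
  shows "((\<lambda>y. erfc (y / (2 * sqrt t))) has_real_derivative
    - (exp (- (y\<^sup>2 / (4 * t))) / (2 * sqrt t * gauss_mass))) (at y)"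
proof -
  have d: "((\<lambda>y. y / (2 * sqrt t)) has_real_derivative 1 / (2 * sqrt t)) (at y)"
    by (rule DERIV_cdivide[OF DERIV_ident])
  have sq: "(y / (2 * sqrt t))\<^sup>2 = y\<^sup>2 / (4 * t)"
    using assms by (simp add: power_divide power_mult_distrib)
  have pos: "y / (2 * sqrt t) > 0"
    using assms by simp
  show ?thesis
    by (rule DERIV_cong[OF DERIV_chain2[OF erfc_DERIV[OF pos] d]])
      (use assms in \<open>simp add: power_divide power_mult_distrib mult.commute\<close>)
qed

lemma gaussian_DERIV_t:
  fixes y t :: real
  assumes "t > 0"
  shows "((\<lambda>t. exp (- (y\<^sup>2 / (4 * t)))) has_real_derivative
    exp (- (y\<^sup>2 / (4 * t))) * (y\<^sup>2 / (4 * t\<^sup>2))) (at t)"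
  using assms by (auto intro!: derivative_eq_intros simp: power2_eq_square)

lemma gaussian_DERIV_y:
  fixes y t :: real
  assumes "t > 0"
  shows "((\<lambda>y. exp (- (y\<^sup>2 / (4 * t)))) has_real_derivative
    - (exp (- (y\<^sup>2 / (4 * t))) * (y / (2 * t)))) (at y)"
  using assms by (auto intro!: derivative_eq_intros simp: power2_eq_square)

lemma sqrt_DERIV:
  assumes "t > 0"
  shows "(sqrt has_real_derivative 1 / (2 * sqrt t)) (at t)"
  using assms by (auto intro!: derivative_eq_intros simp: field_simps)

lemma DERIV_if_positive:
  assumes "t > 0" "(g has_real_derivative D) (at t)"
  shows "((\<lambda>t. if t \<le> 0 then 0 else g t) has_real_derivative D) (at t)"
  using assms(2) by (rule has_field_derivative_transform_within_open[of _ _ _ "{0<..}"]) (use assms in auto)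

lemma flow_DERIV_t:
  assumes "y > 0" "t > 0"
  shows "(flow y has_real_derivative 1 - layer y t) (at t)"
proof -
  define E where "E = exp (- (y\<^sup>2 / (4 * t)))"
  define e where "e = erfc (y / (2 * sqrt t))"
  obtain r where r: "r > 0" "t = r * r" "sqrt t = r"
    using that[of "sqrt t"] assms by simp
  have "((\<lambda>t. t - (t + y\<^sup>2 / 2) * erfc (y / (2 * sqrt t))
      + y * sqrt t * exp (- (y\<^sup>2 / (4 * t))) / (2 * gauss_mass)) has_real_derivative
      1 - erfc (y / (2 * sqrt t))) (at t)"
    apply (rule DERIV_cong[OF DERIV_add[OF
          DERIV_diff[OF DERIV_ident DERIV_mult[OF DERIV_add[OF DERIV_ident DERIV_const]
            erfc_similarity_DERIV_t[OF assms]]]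
          DERIV_cdivide[OF DERIV_mult[OF DERIV_cmult[OF sqrt_DERIV[OF assms(2)]]
            gaussian_DERIV_t[OF assms(2)]]]]])
    \<comment> \<open>With the exponential and \<open>erfc\<close> as atoms and \<open>t = r\<^sup>2\<close>, a rational identity is left.\<close>
    unfolding E_def[symmetric] e_def[symmetric] r(3)
    unfolding r(2) using r(1) gauss_mass_pos
    by (simp add: field_simps power2_eq_square)
  then show ?thesis
    unfolding flow_def[abs_def] layer_def using assms by (simp add: DERIV_if_positive)
qed

lemma flow_DERIV_y:
  assumes "y > 0"
  shows "((\<lambda>y. flow y t) has_real_derivative flow_y y t) (at y)"
proof (cases "t \<le> 0")
  case False
  then have t: "t > 0" by simp
  define E where "E = exp (- (y\<^sup>2 / (4 * t)))"
  define e where "e = erfc (y / (2 * sqrt t))"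
  obtain r where r: "r > 0" "t = r * r" "sqrt t = r"
    using that[of "sqrt t"] t by simp
  have "((\<lambda>y. t - (t + y\<^sup>2 / 2) * erfc (y / (2 * sqrt t))
      + y * sqrt t * exp (- (y\<^sup>2 / (4 * t))) / (2 * gauss_mass)) has_real_derivative
      sqrt t * exp (- (y\<^sup>2 / (4 * t))) / gauss_mass - y * erfc (y / (2 * sqrt t))) (at y)"
    apply (rule DERIV_cong[OF DERIV_add[OF
          DERIV_diff[OF DERIV_const DERIV_mult[OF
            DERIV_add[OF DERIV_const DERIV_cdivide[OF DERIV_pow[of 2]]]
            erfc_similarity_DERIV_y[OF assms t]]]
          DERIV_cdivide[OF DERIV_mult[OF DERIV_mult[OF DERIV_ident DERIV_const]
            gaussian_DERIV_y[OF t]]]]])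
    \<comment> \<open>With the exponential and \<open>erfc\<close> as atoms and \<open>t = r\<^sup>2\<close>, a rational identity is left.\<close>
    unfolding E_def[symmetric] e_def[symmetric] r(3)
    unfolding r(2) using r(1) gauss_mass_pos
    by (simp add: field_simps power2_eq_square)
  then show ?thesis
    using False by (simp add: flow_def flow_y_def)
qed (simp add: flow_def flow_y_def)

lemma flow_y_DERIV_y:
  assumes "y > 0"
  shows "((\<lambda>y. flow_y y t) has_real_derivative - layer y t) (at y)"
proof (cases "t \<le> 0")
  case False
  then have t: "t > 0" by simp
  define E where "E = exp (- (y\<^sup>2 / (4 * t)))"
  define e where "e = erfc (y / (2 * sqrt t))"
  obtain r where r: "r > 0" "t = r * r" "sqrt t = r"
    using that[of "sqrt t"] t by simp
  have "((\<lambda>y. sqrt t * exp (- (y\<^sup>2 / (4 * t))) / gauss_mass - y * erfc (y / (2 * sqrt t)))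
      has_real_derivative - erfc (y / (2 * sqrt t))) (at y)"
    apply (rule DERIV_cong[OF DERIV_diff[OF DERIV_cdivide[OF DERIV_cmult[OF gaussian_DERIV_y[OF t]]]
          DERIV_mult[OF DERIV_ident erfc_similarity_DERIV_y[OF assms t]]]])
    \<comment> \<open>With the exponential and \<open>erfc\<close> as atoms and \<open>t = r\<^sup>2\<close>, a rational identity is left.\<close>
    unfolding E_def[symmetric] e_def[symmetric] r(3)
    unfolding r(2) using r(1) gauss_mass_pos
    by (simp add: field_simps power2_eq_square)
  then show ?thesis
    using False by (simp add: flow_y_def layer_def)
qed (simp add: flow_y_def layer_def)

lemma flow_y_DERIV_t:
  assumes "y > 0" "t > 0"
  shows "(flow_y y has_real_derivative exp (- (y\<^sup>2 / (4 * t))) / (2 * sqrt t * gauss_mass)) (at t)"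
proof -
  define E where "E = exp (- (y\<^sup>2 / (4 * t)))"
  define e where "e = erfc (y / (2 * sqrt t))"
  obtain r where r: "r > 0" "t = r * r" "sqrt t = r"
    using that[of "sqrt t"] assms by simp
  have "((\<lambda>t. sqrt t * exp (- (y\<^sup>2 / (4 * t))) / gauss_mass - y * erfc (y / (2 * sqrt t)))
      has_real_derivative exp (- (y\<^sup>2 / (4 * t))) / (2 * sqrt t * gauss_mass)) (at t)"
    apply (rule DERIV_cong[OF DERIV_diff[OF
          DERIV_cdivide[OF DERIV_mult[OF sqrt_DERIV[OF assms(2)] gaussian_DERIV_t[OF assms(2)]]]
          DERIV_cmult[OF erfc_similarity_DERIV_t[OF assms]]]])
    \<comment> \<open>With the exponential and \<open>erfc\<close> as atoms and \<open>t = r\<^sup>2\<close>, a rational identity is left.\<close>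
    unfolding E_def[symmetric] e_def[symmetric] r(3)
    unfolding r(2) using r(1) gauss_mass_pos
    by (simp add: field_simps power2_eq_square)
  then show ?thesis
    unfolding flow_y_def[abs_def] using assms by (simp add: DERIV_if_positive)
qed

lemma layer_DERIV_t:
  assumes "y > 0" "t > 0"
  shows "(layer y has_real_derivative exp (- (y\<^sup>2 / (4 * t))) * y / (4 * t * sqrt t * gauss_mass)) (at t)"
  unfolding layer_def[abs_def]
  using assms by (intro DERIV_if_positive erfc_similarity_DERIV_t)


section \<open>Monotone and Lipschitz dependence of the flow on time\<close>

lemma isCont_0_of_bound:
  fixes g h :: "real \<Rightarrow> real"
  assumes "\<And>t. t \<le> 0 \<Longrightarrow> g t = 0" "\<And>t. t > 0 \<Longrightarrow> \<bar>g t\<bar> \<le> h t" "isCont h 0" "h 0 = 0"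
  shows "isCont g 0"
proof -
  have "((\<lambda>t. \<bar>h t\<bar>) \<longlongrightarrow> 0) (at 0)"
    using assms(3,4) by (intro tendsto_rabs_zero) (auto simp: isCont_def)
  moreover have "norm (g t) \<le> \<bar>h t\<bar>" for t
    using assms(1,2)[of t] by (cases "t \<le> 0") auto
  ultimately have "(g \<longlongrightarrow> 0) (at 0)"
    by (intro Lim_null_comparison[of g "\<lambda>t. \<bar>h t\<bar>"] always_eventually allI)
  then show ?thesis
    using assms(1)[of 0] by (simp add: isCont_def)
qed

text \<open>The increments over an interval that contains \<open>0\<close> are covered as well: on the negative axis \<open>g\<close> is constant, and
continuity at \<open>0\<close> joins the two parts.\<close>

lemma increment_bounds:
  fixes g :: "real \<Rightarrow> real"
  assumes zero: "\<And>t. t \<le> 0 \<Longrightarrow> g t = 0" and cont: "isCont g 0"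
    and der: "\<And>t. t > 0 \<Longrightarrow> (g has_real_derivative g' t) (at t)"
    and g': "\<And>t. t > 0 \<Longrightarrow> 0 \<le> g' t \<and> g' t \<le> L" and "\<tau> \<ge> 0"
  shows "0 \<le> g (t + \<tau>) - g t" "g (t + \<tau>) - g t \<le> L * \<tau>"
proof -
  have L: "L \<ge> 0" using g'[of 1] by simp
  have isCont: "isCont g t" if "t \<ge> 0" for t
    using that cont DERIV_isCont[OF der] by (cases "t = 0") auto
  have pos: "g a \<le> g b \<and> g b - g a \<le> L * (b - a)" if "0 \<le> a" "a \<le> b" for a b
  proof (cases "a = b")
    case False
    then have ab: "a < b" using that by simp
    have c: "continuous_on {a..b} g"
      using isCont that by (intro continuous_at_imp_continuous_on) auto
    have "g a \<le> g b"
    proof (rule DERIV_nonneg_imp_increasing_open[OF that(2)])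
      fix x assume "a < x" "x < b"
      then show "\<exists>y. DERIV g x :> y \<and> 0 \<le> y" using der[of x] g'[of x] that by auto
    qed (fact c)
    moreover have "L * a - g a \<le> L * b - g b"
    proof (rule DERIV_nonneg_imp_increasing_open[OF that(2)])
      fix x assume "a < x" "x < b"
      then have "((\<lambda>x. L * x - g x) has_real_derivative L - g' x) (at x)" "0 \<le> L - g' x"
        using der[of x] g'[of x] that by (auto intro!: derivative_eq_intros)
      then show "\<exists>y. DERIV (\<lambda>x. L * x - g x) x :> y \<and> 0 \<le> y" by blast
    qed (intro continuous_intros c)
    ultimately show ?thesis by (simp add: algebra_simps)
  qed simp
  have split: "g s = g (max 0 s)" for s
    using zero[of s] zero[of 0] by (cases "s \<le> 0") (auto simp: max_def)
  have mono: "g (max 0 t) \<le> g (max 0 (t + \<tau>))"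
    and lip: "g (max 0 (t + \<tau>)) - g (max 0 t) \<le> L * (max 0 (t + \<tau>) - max 0 t)"
    using pos[of "max 0 t" "max 0 (t + \<tau>)"] \<open>\<tau> \<ge> 0\<close> by auto
  show "0 \<le> g (t + \<tau>) - g t" using mono split by simp
  have "L * (max 0 (t + \<tau>) - max 0 t) \<le> L * \<tau>"
    using L \<open>\<tau> \<ge> 0\<close> by (intro mult_left_mono) auto
  then show "g (t + \<tau>) - g t \<le> L * \<tau>" using lip split by (metis order_trans)
qed

lemma layer_bounds:
  assumes "y \<ge> 0"
  shows "0 \<le> layer y t" "layer y t \<le> 1"
  using erfc_pos[of "y / (2 * sqrt t)"] erfc_le_1[of "y / (2 * sqrt t)"] assms
  by (auto simp: layer_def not_le)

text \<open>For small times the boundary layer has not reached the distance \<open>y\<close>. The linear bound replaces the much faster true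
decay and suffices for continuity at the starting time.\<close>

lemma layer_le_linear:
  assumes "y > 0" "t > 0"
  shows "layer y t \<le> 8 * exp (1/4) / (gauss_mass * y\<^sup>2) * t"
proof -
  define z where "z = y / (2 * sqrt t)"
  have z: "z > 0" "z\<^sup>2 = y\<^sup>2 / (4 * t)"
    using assms by (auto simp: z_def power_divide power_mult_distrib)
  have "layer y t \<le> exp (1/4) / gauss_mass * exp (- z)"
    using erfc_le_exp[of z] z(1) assms by (simp add: layer_def z_def)
  also have "\<dots> \<le> exp (1/4) / gauss_mass * (2 / z\<^sup>2)"
    using exp_minus_le_inverse_square[OF z(1)] gauss_mass_pos by (intro mult_left_mono) auto
  also have "\<dots> = 8 * exp (1/4) / (gauss_mass * y\<^sup>2) * t"
    using assms gauss_mass_pos by (simp add: z(2))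
  finally show ?thesis .
qed

lemma layer_isCont_0:
  assumes "y > 0"
  shows "isCont (layer y) 0"
proof -
  define K where "K = 8 * exp (1/4) / (gauss_mass * y\<^sup>2)"
  show ?thesis
  proof (rule isCont_0_of_bound[of _ "\<lambda>t. K * t"])
    show "\<bar>layer y t\<bar> \<le> K * t" if "t > 0" for t
      using layer_le_linear[OF assms that] layer_bounds[of y t] assms by (simp add: K_def)
    show "isCont (\<lambda>t. K * t) 0" by (intro continuous_intros)
  qed (auto simp: layer_def)
qed

lemma flow_y_isCont_0:
  assumes "y > 0"
  shows "isCont (flow_y y) 0"
proof -
  define K where "K = 8 * exp (1/4) / (gauss_mass * y\<^sup>2)"
  show ?thesis
  proof (rule isCont_0_of_bound[of _ "\<lambda>t. sqrt t / gauss_mass + y * (K * t)"])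
    fix t :: real assume t: "t > 0"
    have "0 \<le> sqrt t * exp (- (y\<^sup>2 / (4 * t))) / gauss_mass"
      "sqrt t * exp (- (y\<^sup>2 / (4 * t))) / gauss_mass \<le> sqrt t * 1 / gauss_mass"
      using t gauss_mass_pos by (auto intro!: divide_right_mono mult_left_mono)
    moreover have "0 \<le> y * erfc (y / (2 * sqrt t))" "y * erfc (y / (2 * sqrt t)) \<le> y * (K * t)"
      using layer_le_linear[OF assms t, folded K_def] layer_bounds[of y t] assms t
      by (auto simp: layer_def intro!: mult_left_mono)
    ultimately show "\<bar>flow_y y t\<bar> \<le> sqrt t / gauss_mass + y * (K * t)"
      using t by (simp add: flow_y_def)
  next
    show "isCont (\<lambda>t. sqrt t / gauss_mass + y * (K * t)) 0"
      using gauss_mass_pos by (intro continuous_intros) auto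
  qed (auto simp: flow_y_def)
qed

lemma flow_isCont_0:
  assumes "y > 0"
  shows "isCont (flow y) 0"
proof -
  define K where "K = 8 * exp (1/4) / (gauss_mass * y\<^sup>2)"
  show ?thesis
  proof (rule isCont_0_of_bound[of _ "\<lambda>t. t + (t + y\<^sup>2 / 2) * (K * t) + y * sqrt t / (2 * gauss_mass)"])
    fix t :: real assume t: "t > 0"
    have "0 \<le> y * sqrt t * exp (- (y\<^sup>2 / (4 * t))) / (2 * gauss_mass)"
      "y * sqrt t * exp (- (y\<^sup>2 / (4 * t))) / (2 * gauss_mass) \<le> y * sqrt t * 1 / (2 * gauss_mass)"
      using assms t gauss_mass_pos by (auto intro!: divide_right_mono mult_left_mono)
    moreover have "0 \<le> (t + y\<^sup>2 / 2) * erfc (y / (2 * sqrt t))"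
      "(t + y\<^sup>2 / 2) * erfc (y / (2 * sqrt t)) \<le> (t + y\<^sup>2 / 2) * (K * t)"
      using layer_le_linear[OF assms t, folded K_def] layer_bounds[of y t] assms t
      by (auto simp: layer_def intro!: mult_left_mono)
    ultimately show "\<bar>flow y t\<bar> \<le> t + (t + y\<^sup>2 / 2) * (K * t) + y * sqrt t / (2 * gauss_mass)"
      using t by (simp add: flow_def)
  next
    show "isCont (\<lambda>t. t + (t + y\<^sup>2 / 2) * (K * t) + y * sqrt t / (2 * gauss_mass)) 0"
      using gauss_mass_pos by (intro continuous_intros) auto
  qed (auto simp: flow_def)
qed

text \<open>The time derivatives of \<open>flow\<close>, \<open>flow_y\<close> and \<open>layer\<close> are nonnegative, and bounded for fixed \<open>y\<close> by constants of order
\<open>1\<close>, \<open>1 / y\<close> and \<open>1 / y\<^sup>2\<close>, as the parabolic scaling suggests.\<close>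

lemma flow_increment:
  assumes "y > 0" "\<tau> \<ge> 0"
  shows "0 \<le> flow y (t + \<tau>) - flow y t" "flow y (t + \<tau>) - flow y t \<le> \<tau>"
  using increment_bounds[of "flow y" "\<lambda>t. 1 - layer y t" 1 \<tau> t] flow_isCont_0 flow_DERIV_t
    layer_bounds[of y] assms
  by (auto simp: flow_def)

lemma flow_y_increment:
  assumes "y > 0" "\<tau> \<ge> 0"
  shows "0 \<le> flow_y y (t + \<tau>) - flow_y y t" "flow_y y (t + \<tau>) - flow_y y t \<le> 1 / (gauss_mass * y) * \<tau>"
proof -
  have "exp (- (y\<^sup>2 / (4 * t))) / (2 * sqrt t * gauss_mass) \<le> 1 / (gauss_mass * y)" if "t > 0" for t
  proof -
    define z where "z = y / (2 * sqrt t)"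
    have z: "z > 0" "y\<^sup>2 / (4 * t) = z\<^sup>2" "2 * sqrt t = y / z"
      using assms that by (auto simp: z_def power_divide power_mult_distrib)
    have "0 \<le> (z - 1)\<^sup>2" by simp
    then have "z \<le> 1 + z\<^sup>2" using z(1) by (simp add: power2_diff)
    also have "\<dots> \<le> exp (z\<^sup>2)" by (rule exp_ge_add_one_self)
    finally have "z * exp (- (z\<^sup>2)) \<le> 1" by (simp add: exp_minus field_simps)
    then have "z * exp (- (z\<^sup>2)) / (gauss_mass * y) \<le> 1 / (gauss_mass * y)"
      using assms gauss_mass_pos by (intro divide_right_mono) auto
    then show ?thesis
      unfolding z(2,3) by (simp add: mult.commute)
  qed
  then show "0 \<le> flow_y y (t + \<tau>) - flow_y y t" "flow_y y (t + \<tau>) - flow_y y t \<le> 1 / (gauss_mass * y) * \<tau>"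
    using increment_bounds[of "flow_y y" "\<lambda>t. exp (- (y\<^sup>2 / (4 * t))) / (2 * sqrt t * gauss_mass)"
        "1 / (gauss_mass * y)" \<tau> t] flow_y_isCont_0 flow_y_DERIV_t assms gauss_mass_pos
    by (auto simp: flow_y_def)
qed

lemma layer_increment:
  assumes "y > 0" "\<tau> \<ge> 0"
  shows "0 \<le> layer y (t + \<tau>) - layer y t" "layer y (t + \<tau>) - layer y t \<le> 2 / (gauss_mass * y\<^sup>2) * \<tau>"
proof -
  have "exp (- (y\<^sup>2 / (4 * t))) * y / (4 * t * sqrt t * gauss_mass) \<le> 2 / (gauss_mass * y\<^sup>2)" if "t > 0" for t
  proof -
    define z where "z = y / (2 * sqrt t)"
    have z: "z > 0" "y\<^sup>2 / (4 * t) = z\<^sup>2" "sqrt t = y / (2 * z)" "t = y\<^sup>2 / (4 * z\<^sup>2)"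
      using assms that by (auto simp: z_def power_divide power_mult_distrib)
    have "0 \<le> z\<^sup>2 * (z - 1)\<^sup>2" by simp
    then have "2 * z ^ 3 \<le> z\<^sup>2 + (z\<^sup>2)\<^sup>2"
      by (simp add: power2_diff algebra_simps power2_eq_square power3_eq_cube)
    also have "\<dots> \<le> 2 * exp (z\<^sup>2)"
      using exp_lower_Taylor_quadratic[of "z\<^sup>2"] zero_le_power2[of z] by linarith
    finally have "z ^ 3 * exp (- (z\<^sup>2)) \<le> 1" by (simp add: exp_minus field_simps)
    then have "z ^ 3 * exp (- (z\<^sup>2)) * (2 / (gauss_mass * y\<^sup>2)) \<le> 1 * (2 / (gauss_mass * y\<^sup>2))"
      using assms gauss_mass_pos by (intro mult_right_mono) auto
    moreover have "exp (- (z\<^sup>2)) * y / (4 * (y\<^sup>2 / (4 * z\<^sup>2)) * (y / (2 * z)) * gauss_mass) =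
        z ^ 3 * exp (- (z\<^sup>2)) * (2 / (gauss_mass * y\<^sup>2))"
      using z(1) assms gauss_mass_pos by (simp add: field_simps power2_eq_square power3_eq_cube)
    ultimately show ?thesis
      unfolding z(2,3) using z(4) by simp
  qed
  then show "0 \<le> layer y (t + \<tau>) - layer y t" "layer y (t + \<tau>) - layer y t \<le> 2 / (gauss_mass * y\<^sup>2) * \<tau>"
    using increment_bounds[of "layer y" "\<lambda>t. exp (- (y\<^sup>2 / (4 * t))) * y / (4 * t * sqrt t * gauss_mass)"
        "2 / (gauss_mass * y\<^sup>2)" \<tau> t] layer_isCont_0 layer_DERIV_t assms gauss_mass_pos
    by (auto simp: layer_def)
qed

lemma flow_at_wall [simp]: "flow 0 t = 0"
  by (simp add: flow_def)

lemma flow_le_wall_distance: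
  assumes "y > 0" "t > 0"
  shows "flow y t \<le> sqrt t / gauss_mass * y"
proof -
  define z where "z = y / (2 * sqrt t)"
  have z: "z > 0" "t * z = sqrt t * y / 2"
    using assms by (auto simp: z_def field_simps)
  have "flow y t = t * (1 - erfc z) - y\<^sup>2 / 2 * erfc z
      + y * sqrt t * exp (- (y\<^sup>2 / (4 * t))) / (2 * gauss_mass)"
    using assms by (simp add: flow_def z_def algebra_simps)
  also have "\<dots> \<le> t * (z / gauss_mass) - 0 + y * sqrt t * 1 / (2 * gauss_mass)"
    using assms erfc_ge[of z] erfc_pos[of z] z(1) gauss_mass_pos
    by (intro add_mono diff_mono divide_right_mono mult_left_mono) auto
  also have "\<dots> = sqrt t / gauss_mass * y"
    using gauss_mass_pos by (simp add: z(2))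
  finally show ?thesis .
qed

lemma gauss_primitive_measurable [measurable]: "gauss_primitive \<in> borel_measurable borel"
proof (rule borel_measurable_mono)
  have neg: "gauss_primitive z = 0" if "z \<le> 0" for z
    using that by (cases "z = 0") (auto simp: gauss_primitive_def)
  show "mono gauss_primitive"
  proof (rule monoI)
    fix a b :: real assume ab: "a \<le> b"
    consider "b \<le> 0" | "a \<le> 0" "0 < b" | "0 < a" by linarith
    then show "gauss_primitive a \<le> gauss_primitive b"
    proof cases
      case 2
      then show ?thesis using gauss_primitive_strict_mono[of 0 b] neg[of a] by simp
    next
      case 3
      then show ?thesis using gauss_primitive_strict_mono[of a b] ab by (cases "a = b") auto
    qed (use ab neg in auto)
  qed
qed

lemma erfc_measurable [measurable]: "erfc \<in> borel_measurable borel"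
  unfolding erfc_def[abs_def] by measurable

lemma flow_measurable [measurable (raw)]:
  assumes [measurable]: "f \<in> borel_measurable M" "g \<in> borel_measurable M"
  shows "(\<lambda>x. flow (f x) (g x)) \<in> borel_measurable M"
    and "(\<lambda>x. flow_y (f x) (g x)) \<in> borel_measurable M"
    and "(\<lambda>x. layer (f x) (g x)) \<in> borel_measurable M"
  unfolding flow_def flow_y_def layer_def by measurable

section \<open>Superposition of short bursts\<close>

text \<open>The exponent is quadratic in \<open>k\<close> so that every positive power of \<open>1 / duration k\<close> outgrows every geometric sequence.\<close>

definition duration :: "nat \<Rightarrow> real" where
  "duration k = (1/4) ^ ((k + 1)\<^sup>2)"

text \<open>The factor \<open>4\<^sup>-\<^sup>(\<^sup>k\<^sup>+\<^sup>1\<^sup>)\<close> pays twice for a factor \<open>2\<^sup>-\<^sup>(\<^sup>k\<^sup>+\<^sup>1\<^sup>)\<close>: one for summing the terms, one for summing the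
integrals of their powers.\<close>

definition strength :: "real \<Rightarrow> nat \<Rightarrow> real" where
  "strength q k = (1/4) ^ (k + 1) * duration k powr (- (1/q))"

definition pulse :: "real \<Rightarrow> nat \<Rightarrow> real \<Rightarrow> real" where
  "pulse q k t = strength q k * indicator {1 - duration k<..<1} t"

text \<open>If \<open>g\<close> is the response to the force \<open>1\<close> on \<open>t > 0\<close>, then by linearity this is the response to \<open>pulse q k\<close>.\<close>

definition burst :: "real \<Rightarrow> (real \<Rightarrow> real) \<Rightarrow> nat \<Rightarrow> real \<Rightarrow> real" where
  "burst q g k t = strength q k * (g (t - 1 + duration k) - g (t - 1))"

definition force :: "real \<Rightarrow> real \<Rightarrow> real" where
  "force q t = (\<Sum>k. pulse q k t)"

definition velocity :: "real \<Rightarrow> real \<Rightarrow> real \<Rightarrow> real" where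
  "velocity q y t = (\<Sum>k. burst q (flow y) k t)"

definition velocity_y :: "real \<Rightarrow> real \<Rightarrow> real \<Rightarrow> real" where
  "velocity_y q y t = (\<Sum>k. burst q (flow_y y) k t)"

definition velocity_yy :: "real \<Rightarrow> real \<Rightarrow> real \<Rightarrow> real" where
  "velocity_yy q y t = (\<Sum>k. - burst q (layer y) k t)"

definition velocity_t :: "real \<Rightarrow> real \<Rightarrow> real \<Rightarrow> real" where
  "velocity_t q y t = (\<Sum>k. pulse q k t - burst q (layer y) k t)"

lemma duration_pos [simp]: "duration k > 0"
  by (simp add: duration_def)

lemma duration_nonneg [simp]: "duration k \<ge> 0" and duration_nonzero [simp]: "duration k \<noteq> 0"
  using duration_pos[of k] by linarith+

lemma duration_not_le_0 [simp]: "\<not> duration k \<le> 0"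
  by (simp add: not_le)

lemma duration_le: "duration k \<le> 1/4"
proof -
  have "(1/4::real) ^ ((k + 1)\<^sup>2) \<le> (1/4) ^ 1"
    by (intro power_decreasing) auto
  then show ?thesis by (simp add: duration_def)
qed

lemma strength_pos: "strength q k > 0"
  by (simp add: strength_def)

lemma strength_times_duration_powr_le:
  assumes "1 < q" and a: "1/q \<le> a"
  shows "strength q k * duration k powr a \<le> (1/2) ^ (k + 1)"
proof -
  have "duration k powr (a - 1/q) \<le> 1"
    using a duration_le[of k] by (intro powr_le1) auto
  then have "(1/4) ^ (k + 1) * duration k powr (a - 1/q) \<le> (1/4) ^ (k + 1) * 1"
    by (intro mult_left_mono) auto
  also have "\<dots> \<le> (1/2) ^ (k + 1)"
    unfolding mult_1_right by (intro power_mono) auto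
  finally show ?thesis
    by (simp add: strength_def powr_add[symmetric] mult.assoc)
qed

lemma strength_times_duration_le:
  assumes "1 < q"
  shows "strength q k * duration k \<le> (1/2) ^ (k + 1)"
  using strength_times_duration_powr_le[of q 1 k] assms by simp

lemma sum_half_powers_le: "(\<Sum>k<n. (1/2::real) ^ (k + 1)) \<le> 1"
proof -
  have "(\<Sum>k<n. (1/2::real) ^ (k + 1)) = 1 - (1/2) ^ n"
    by (induction n) auto
  then show ?thesis by simp
qed

lemma sum_scaled_half_powers_le:
  fixes a :: "nat \<Rightarrow> real"
  assumes "\<And>k. a k \<le> M * (1/2) ^ (k + 1)" "0 \<le> M"
  shows "(\<Sum>k<n. a k) \<le> M"
proof -
  have "(\<Sum>k<n. a k) \<le> M * (\<Sum>k<n. (1/2) ^ (k + 1))"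
    using assms(1) by (simp add: sum_distrib_left sum_mono del: power_Suc)
  also have "\<dots> \<le> M * 1"
    using sum_half_powers_le assms(2) by (intro mult_left_mono)
  finally show ?thesis by simp
qed

lemma burst_nonneg:
  assumes "\<And>t \<tau>. 0 \<le> \<tau> \<Longrightarrow> 0 \<le> g (t + \<tau>) - g t"
  shows "0 \<le> burst q g k t"
  unfolding burst_def using assms[of "duration k" "t - 1"] strength_pos[of q k]
  by (simp del: diff_ge_0_iff_ge)

text \<open>A Lipschitz bound in time turns the short duration of a burst into smallness of its effect:
as \<open>1/q \<le> 1\<close>, \<open>strength q k * duration k\<close> is at most the geometric factor.\<close>

lemma burst_sum_le:
  assumes "1 < q" and mono: "\<And>t \<tau>. 0 \<le> \<tau> \<Longrightarrow> 0 \<le> g (t + \<tau>) - g t"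
    and lip: "\<And>t \<tau>. 0 \<le> \<tau> \<Longrightarrow> g (t + \<tau>) - g t \<le> L * \<tau>" and "0 \<le> L"
  shows "(\<Sum>k<n. \<bar>burst q g k t\<bar>) \<le> L"
proof (rule sum_scaled_half_powers_le)
  fix k
  have "\<bar>burst q g k t\<bar> = strength q k * (g (t - 1 + duration k) - g (t - 1))"
    using burst_nonneg[of g, OF mono] by (simp add: burst_def)
  also have "\<dots> \<le> strength q k * (L * duration k)"
    using lip[of "duration k" "t - 1"] strength_pos[of q k] by (intro mult_left_mono) auto
  also have "\<dots> \<le> L * (1/2) ^ (k + 1)"
    using mult_left_mono[OF strength_times_duration_le[OF assms(1), of k] assms(4)]
    by (simp add: mult_ac)
  finally show "\<bar>burst q g k t\<bar> \<le> L * (1/2) ^ (k + 1)" .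
qed fact

lemma pulse_nonneg: "pulse q k t \<ge> 0"
  using strength_pos[of q k] by (simp add: pulse_def)

text \<open>At a fixed time \<open>t < 1\<close> only finitely many pulses are active, and none is at \<open>t \<ge> 1\<close>.\<close>

lemma summable_pulse: "summable (\<lambda>k. pulse q k t)"
proof (cases "t < 1")
  case True
  have "k < nat \<lceil>1 / (1 - t)\<rceil>" if "pulse q k t \<noteq> 0" for k
  proof -
    have "1 - t < duration k"
      using that by (auto simp: pulse_def indicator_def split: if_splits)
    moreover have "duration k \<le> 1 / real (k + 1)"
    proof -
      have "real (k + 1) \<le> real (4 ^ ((k + 1)\<^sup>2))"
      proof (rule of_nat_mono)
        have "k + 1 \<le> (k + 1)\<^sup>2" by (simp add: power2_eq_square)
        also have "\<dots> \<le> 4 ^ ((k + 1)\<^sup>2)"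
          by (rule less_imp_le, rule less_exp[THEN order.strict_trans2]) (simp add: power_mono)
        finally show "k + 1 \<le> 4 ^ ((k + 1)\<^sup>2)" .
      qed
      then show ?thesis
        by (simp add: duration_def power_one_over frac_le del: of_nat_Suc of_nat_add)
    qed
    ultimately have "1 - t < 1 / real (k + 1)" by linarith
    then have "real (k + 1) < 1 / (1 - t)"
      using True by (simp add: field_simps)
    then show ?thesis by linarith
  qed
  then show ?thesis
    by (intro summable_finite[of "{..<nat \<lceil>1 / (1 - t)\<rceil>}"]) auto
qed (auto simp: pulse_def)

lemma force_nonneg: "force q t \<ge> 0"
  unfolding force_def by (intro suminf_nonneg summable_pulse pulse_nonneg)

lemma sum_pulse_le_force: "(\<Sum>k<n. \<bar>pulse q k t\<bar>) \<le> force q t"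
  unfolding force_def using pulse_nonneg by (simp add: sum_le_suminf[OF summable_pulse])

lemma pulse_le_force: "pulse q k t \<le> force q t"
  unfolding force_def using sum_le_suminf[OF summable_pulse, of "{k}"] pulse_nonneg by auto

lemma velocity_bound:
  assumes "1 < q" "y > 0"
  shows "(\<Sum>k<n. \<bar>burst q (flow y) k t\<bar>) \<le> 1"
    and "(\<Sum>k<n. \<bar>burst q (flow_y y) k t\<bar>) \<le> 1 / (gauss_mass * y)"
    and "(\<Sum>k<n. \<bar>burst q (layer y) k t\<bar>) \<le> 2 / (gauss_mass * y\<^sup>2)"
proof -
  show "(\<Sum>k<n. \<bar>burst q (flow y) k t\<bar>) \<le> 1"
    by (rule burst_sum_le[OF assms(1) flow_increment(1)[OF assms(2)]])
       (use flow_increment(2)[OF assms(2)] in auto)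
  show "(\<Sum>k<n. \<bar>burst q (flow_y y) k t\<bar>) \<le> 1 / (gauss_mass * y)"
    by (rule burst_sum_le[OF assms(1) flow_y_increment[OF assms(2)]])
       (use assms(2) gauss_mass_pos in auto)
  show "(\<Sum>k<n. \<bar>burst q (layer y) k t\<bar>) \<le> 2 / (gauss_mass * y\<^sup>2)"
    by (rule burst_sum_le[OF assms(1) layer_increment[OF assms(2)]])
       (use assms(2) gauss_mass_pos in auto)
qed

lemma velocity_equation:
  assumes "1 < q" "y > 0"
  shows "velocity_t q y t - velocity_yy q y t = force q t"
proof -
  have "summable (\<lambda>k. burst q (layer y) k t)"
    using velocity_bound(3)[OF assms] by (rule abs_bounded_imp_summable)
  then show ?thesis
    using summable_pulse[of q t]
    by (simp add: velocity_t_def velocity_yy_def force_def suminf_diff[symmetric] suminf_minus)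
qed

lemma velocity_at_wall [simp]: "velocity q 0 t = 0"
  by (simp add: velocity_def burst_def)

lemma min_le_powr_mult:
  fixes a b \<theta> :: real
  assumes "x \<le> a" "x \<le> b" "0 \<le> x" "0 < \<theta>" "\<theta> < 1"
  shows "x \<le> a powr (1 - \<theta>) * b powr \<theta>"
proof -
  have "x = x powr (1 - \<theta>) * x powr \<theta>"
    using assms(3) by (cases "x = 0") (auto simp: powr_add[symmetric])
  also have "\<dots> \<le> a powr (1 - \<theta>) * b powr \<theta>"
    using assms by (intro mult_mono powr_mono2) auto
  finally show ?thesis .
qed

text \<open>Each term is at most \<open>strength q k\<close> times the minimum of \<open>duration k\<close> (total impulse) and a multiple of \<open>y\<close> (no
slip). Interpolating with the exponent \<open>1/q\<close> on \<open>duration k\<close> uses up exactly the factor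
\<open>duration k powr (-1/q)\<close> in the strength and leaves a convergent series; what remains is a positive power of \<open>y\<close>, since
\<open>q > 1\<close>.\<close>

lemma velocity_le_wall_distance:
  assumes q: "1 < q" and y: "y > 0" and t: "t < 4"
  shows "0 \<le> velocity q y t" "velocity q y t \<le> (2 / gauss_mass * y) powr (1 - 1/q)"
proof -
  define \<theta> where "\<theta> = 1 - 1/q"
  have \<theta>: "0 < \<theta>" "\<theta> < 1" "1 - \<theta> = 1/q"
    using q by (auto simp: \<theta>_def)
  define D where "D = 2 / gauss_mass * y"
  have D: "D > 0" using y gauss_mass_pos by (simp add: D_def)
  have nonneg: "0 \<le> burst q (flow y) k t" for k
    using flow_increment(1)[OF y] by (rule burst_nonneg)
  have le: "burst q (flow y) k t \<le> D powr \<theta> * (1/2) ^ (k + 1)" for k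
  proof -
    define x where "x = flow y (t - 1 + duration k) - flow y (t - 1)"
    have x0: "0 \<le> x" and x1: "x \<le> duration k"
      unfolding x_def using flow_increment[OF y, of "duration k"] by auto
    have flow_nonneg: "0 \<le> flow y s" for s
      using flow_increment(1)[OF y, of "max 0 s" "min 0 s"]
      by (cases "s \<le> 0") (auto simp: flow_def[of _ 0] flow_def[of y s] min_def max_def)
    have "flow y s \<le> D" if "s < 4" for s
    proof (cases "s > 0")
      case True
      have "sqrt s \<le> 2" using that real_sqrt_le_mono[of s 4] by simp
      then have "sqrt s / gauss_mass * y \<le> D"
        unfolding D_def using gauss_mass_pos y by (intro mult_right_mono divide_right_mono) auto
      then show ?thesis using flow_le_wall_distance[OF y True] by simp
    qed (use D in \<open>simp add: flow_def\<close>)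
    then have "flow y (t - 1 + duration k) \<le> D"
      using t duration_le[of k] by simp
    then have x2: "x \<le> D"
      using flow_nonneg[of "t - 1"] by (simp add: x_def)
    have "burst q (flow y) k t = strength q k * x"
      by (simp add: burst_def x_def)
    also have "\<dots> \<le> strength q k * (duration k powr (1 - \<theta>) * D powr \<theta>)"
      using min_le_powr_mult[OF x1 x2 x0 \<theta>(1,2)] strength_pos[of q k] by (intro mult_left_mono) auto
    also have "\<dots> \<le> D powr \<theta> * (1/2) ^ (k + 1)"
      using mult_left_mono[OF strength_times_duration_powr_le[OF q, of "1 - \<theta>" k], of "D powr \<theta>"] \<theta>(3)
      by (simp add: mult_ac)
    finally show ?thesis .
  qed
  have s: "summable (\<lambda>k. burst q (flow y) k t)"
    using velocity_bound(1)[OF q y] by (rule abs_bounded_imp_summable)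
  show "0 \<le> velocity q y t"
    unfolding velocity_def using nonneg by (intro suminf_nonneg s)
  show "velocity q y t \<le> (2 / gauss_mass * y) powr (1 - 1/q)"
    unfolding velocity_def using le sum_scaled_half_powers_le[of _ "D powr \<theta>"]
    by (intro suminf_le_const s) (auto simp: D_def \<theta>_def)
qed

lemma burst_layer_before_1:
  assumes "t < 1"
  shows "burst q (layer y) k t = pulse q k t * layer y (t - 1 + duration k)"
  using assms by (auto simp: burst_def pulse_def layer_def indicator_def)

lemma velocity_t_bounds:
  assumes "1 < q" "y > 0" "t < 1"
  shows "0 \<le> velocity_t q y t" "velocity_t q y t \<le> force q t"
    "pulse q k t * (1 - layer y (t - 1 + duration k)) \<le> velocity_t q y t"
proof -
  have eq: "pulse q k t - burst q (layer y) k t = pulse q k t * (1 - layer y (t - 1 + duration k))" for k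
    using assms by (simp add: burst_layer_before_1 algebra_simps)
  have nonneg: "0 \<le> pulse q k t - burst q (layer y) k t" for k
    unfolding eq using layer_bounds(2)[of y] pulse_nonneg assms by simp
  have le: "pulse q k t - burst q (layer y) k t \<le> pulse q k t" for k
    unfolding eq using layer_bounds(1)[of y] pulse_nonneg[of q k t] assms by (simp add: mult_left_le)
  have s: "summable (\<lambda>k. pulse q k t - burst q (layer y) k t)"
    by (rule summable_comparison_test'[OF summable_pulse, of 0 _ q t]) (use nonneg le in auto)
  show "0 \<le> velocity_t q y t"
    unfolding velocity_t_def by (intro suminf_nonneg s nonneg)
  show "velocity_t q y t \<le> force q t"
    unfolding velocity_t_def force_def by (intro suminf_le le s summable_pulse)
  show "pulse q k t * (1 - layer y (t - 1 + duration k)) \<le> velocity_t q y t"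
    unfolding velocity_t_def eq[symmetric]
    using sum_le_suminf[OF s, of "{k}"] nonneg by auto
qed

lemma velocity_yy_bounds:
  assumes "1 < q" "y > 0" "t < 1"
  shows "\<bar>velocity_yy q y t\<bar> = (\<Sum>k. pulse q k t * layer y (t - 1 + duration k))"
    "pulse q k t * layer y (t - 1 + duration k) \<le> \<bar>velocity_yy q y t\<bar>"
proof -
  have nonneg: "0 \<le> burst q (layer y) k t" for k
    using layer_increment(1)[OF assms(2)] by (rule burst_nonneg)
  have s: "summable (\<lambda>k. burst q (layer y) k t)"
    using velocity_bound(3)[OF assms(1,2)] by (rule abs_bounded_imp_summable)
  have eq: "\<bar>velocity_yy q y t\<bar> = (\<Sum>k. burst q (layer y) k t)"
    unfolding velocity_yy_def suminf_minus[OF s] using suminf_nonneg[OF s] nonneg by simp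
  then show "\<bar>velocity_yy q y t\<bar> = (\<Sum>k. pulse q k t * layer y (t - 1 + duration k))"
    using assms by (simp add: burst_layer_before_1)
  show "pulse q k t * layer y (t - 1 + duration k) \<le> \<bar>velocity_yy q y t\<bar>"
    unfolding eq burst_layer_before_1[OF assms(3), symmetric]
    using sum_le_suminf[OF s, of "{k}"] nonneg by auto
qed

text \<open>The expression equals \<open>4\<close> to the power \<open>\<epsilon> (k + 1)\<^sup>2 - r (k + 1)\<close> with \<open>\<epsilon> = r / q - \<beta> > 0\<close>. The values \<open>\<beta> = 1\<close> and
\<open>\<beta> = 3/2\<close> belong to the measures of space-time regions on which a burst is felt in full strength: away
from the wall, and in the boundary layer.\<close>

lemma strength_duration_growth:
  assumes "1 < q" and r: "r > q * \<beta>"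
  shows "filterlim (\<lambda>k. strength q k powr r * duration k powr \<beta>) at_top sequentially"
proof -
  define \<epsilon> where "\<epsilon> = r / q - \<beta>"
  have "\<beta> * q < r" using r by (simp only: mult.commute)
  moreover have "0 < q" using assms(1) by linarith
  ultimately have "\<beta> < r / q" by (metis pos_less_divide_eq)
  then have \<epsilon>: "\<epsilon> > 0" unfolding \<epsilon>_def by linarith
  have "strength q k powr r * duration k powr \<beta> =
      4 powr (\<epsilon> * (real k + 1)\<^sup>2 - r * (real k + 1))" for k
  proof -
    have quarter: "(1/4::real) ^ n = 4 powr (- real n)" for n
      by (simp only: powr_minus powr_realpow[of 4] zero_less_numeral power_one_over inverse_eq_divide)
    have d: "duration k = 4 powr (- ((real k + 1)\<^sup>2))"
      unfolding duration_def quarter by (simp add: add.commute)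
    have s: "strength q k = 4 powr (- (real k + 1) + (real k + 1)\<^sup>2 / q)"
      unfolding strength_def quarter d powr_powr powr_add[symmetric]
      by (rule arg_cong[where f = "\<lambda>x. 4 powr x"]) simp
    show ?thesis
      unfolding s unfolding d powr_powr powr_add[symmetric] \<epsilon>_def
      by (rule arg_cong[where f = "\<lambda>x. 4 powr x"]) (simp add: field_simps)
  qed
  moreover have "filterlim (\<lambda>k. 4 powr (\<epsilon> * (real k + 1)\<^sup>2 - r * (real k + 1))) at_top sequentially"
  proof -
    have "filterlim (\<lambda>k. 1 + real k) at_top sequentially"
      by (rule filterlim_tendsto_add_at_top[OF tendsto_const filterlim_real_sequentially])
    then have n: "filterlim (\<lambda>k. real k + 1) at_top sequentially"
      by (simp add: add.commute)
    then have "filterlim (\<lambda>k. - r + \<epsilon> * (real k + 1)) at_top sequentially"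
      by (intro filterlim_tendsto_add_at_top[OF tendsto_const]
          filterlim_tendsto_pos_mult_at_top[OF tendsto_const \<epsilon>])
    from filterlim_at_top_mult_at_top[OF n this]
    have "filterlim (\<lambda>k. \<epsilon> * (real k + 1)\<^sup>2 - r * (real k + 1)) at_top sequentially"
      by (simp add: algebra_simps power2_eq_square)
    then have "filterlim (\<lambda>k. (\<epsilon> * (real k + 1)\<^sup>2 - r * (real k + 1)) * ln 4) at_top sequentially"
      by (intro filterlim_at_top_mult_tendsto_pos[OF tendsto_const]) auto
    then show ?thesis
      unfolding powr_def using filterlim_compose[OF exp_at_top] by simp
  qed
  ultimately show ?thesis by simp
qed

section \<open>Integrals over the half cylinders\<close>

abbreviation height :: "('m::finite) space \<times> real \<Rightarrow> real" where
  "height z \<equiv> snd (fst z)"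

lemma flow_domain_bounds:
  assumes "z \<in> flow_domain"
  shows "norm (fst (fst z)) < 2" "0 < height z" "height z < 2" "0 < snd z" "snd z < 4" "norm (fst z) < 2"
proof -
  obtain x y t where z: "z = ((x, y), t)" by (metis surj_pair)
  show "norm (fst (fst z)) < 2" "0 < height z" "height z < 2" "0 < snd z" "snd z < 4" "norm (fst z) < 2"
    using assms norm_fst_le[of x y] norm_snd_le[of y x]
    by (auto simp: z flow_domain_def half_ball_def)
qed

lemma half_cylinder_1_subset: "half_cylinder 1 \<subseteq> flow_domain"
  by (auto simp: half_cylinder_def flow_domain_def half_ball_def)

lemma half_cylinder_before_1: "z \<in> half_cylinder r \<Longrightarrow> snd z < 1"
  by (auto simp: half_cylinder_def)

lemma open_half_ball: "open (half_ball r)"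
  unfolding half_ball_def by (intro open_Collect_conj open_Collect_less continuous_intros)

lemma open_flow_domain: "open flow_domain"
  unfolding flow_domain_def by (intro open_Times open_half_ball open_greaterThanLessThan)

lemma measurable_of_fst:
  fixes f :: "'a::euclidean_space \<Rightarrow> 'c::topological_space"
  assumes "f \<in> borel_measurable borel"
  shows "(\<lambda>z :: 'a \<times> 'b::euclidean_space. f (fst z)) \<in> borel_measurable borel"
  by (rule measurable_compose[OF _ assms], rule borel_measurable_continuous_onI) (intro continuous_intros)

lemma measurable_of_snd:
  fixes f :: "'b::euclidean_space \<Rightarrow> 'c::topological_space"
  assumes "f \<in> borel_measurable borel"
  shows "(\<lambda>z :: 'a::euclidean_space \<times> 'b. f (snd z)) \<in> borel_measurable borel"
  by (rule measurable_compose[OF _ assms], rule borel_measurable_continuous_onI) (intro continuous_intros)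

lemma borel_measurable_height_snd [measurable]:
  "(\<lambda>z :: ('m::finite) space \<times> real. height z) \<in> borel_measurable borel"
  "(\<lambda>z :: ('m::finite) space \<times> real. snd z) \<in> borel_measurable borel"
  by (intro borel_measurable_continuous_onI continuous_intros)+

lemma nn_integral_lborel_Times:
  fixes a :: "'a::euclidean_space \<Rightarrow> ennreal" and b :: "'b::euclidean_space \<Rightarrow> ennreal"
  assumes [measurable]: "a \<in> borel_measurable borel" "b \<in> borel_measurable borel"
  shows "(\<integral>\<^sup>+z. a (fst z) * b (snd z) \<partial>lborel) = (\<integral>\<^sup>+x. a x \<partial>lborel) * (\<integral>\<^sup>+y. b y \<partial>lborel)"
proof -
  have "(\<integral>\<^sup>+z. a (fst z) * b (snd z) \<partial>lborel) = (\<integral>\<^sup>+z. a (fst z) * b (snd z) \<partial>(lborel \<Otimes>\<^sub>M lborel))"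
    by (simp add: lborel_prod)
  also have "\<dots> = (\<integral>\<^sup>+x. \<integral>\<^sup>+y. a x * b y \<partial>lborel \<partial>lborel)"
    by (subst lborel.nn_integral_fst[symmetric]) (simp, simp)
  also have "\<dots> = (\<integral>\<^sup>+x. a x \<partial>lborel) * (\<integral>\<^sup>+y. b y \<partial>lborel)"
    by (simp add: nn_integral_cmult nn_integral_multc)
  finally show ?thesis .
qed

lemma nn_integral_slab:
  fixes g h :: "real \<Rightarrow> ennreal"
  assumes [measurable]: "g \<in> borel_measurable borel" "h \<in> borel_measurable borel"
  shows "(\<integral>\<^sup>+z. indicator (ball 0 R) (fst (fst z)) * g (height z) * h (snd z)
      \<partial>(lborel :: (('m::finite) space \<times> real) measure)) =
    emeasure lborel (ball 0 R :: (real ^ 'm) set) * (\<integral>\<^sup>+y. g y \<partial>lborel) * (\<integral>\<^sup>+t. h t \<partial>lborel)"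
proof -
  have b: "indicator (ball (0 :: real ^ 'm) R) \<in> borel_measurable borel"
    by (intro borel_measurable_indicator) auto
  then have m: "(\<lambda>x. indicator (ball (0 :: real ^ 'm) R) (fst x) * g (snd x)) \<in> borel_measurable borel"
    by (intro borel_measurable_times_ennreal measurable_of_fst measurable_of_snd) auto
  show ?thesis
    using nn_integral_lborel_Times[OF m assms(2)] nn_integral_lborel_Times[OF b assms(1)]
    by simp
qed

text \<open>A substitute for Minkowski's inequality: the weights sum to \<open>1\<close>, so the weighted sum is at most the supremum of the
\<open>a k\<close>, whose \<open>p\<close>-th power is at most the sum of all \<open>p\<close>-th powers.\<close>

lemma suminf_half_powers_powr_le:
  fixes a :: "nat \<Rightarrow> real"
  assumes a: "\<And>k. 0 \<le> a k" and p: "0 < p"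
  shows "ennreal ((\<Sum>k. (1/2) ^ (k + 1) * a k) powr p) \<le> (\<Sum>k. ennreal (a k powr p))"
proof (cases "(\<Sum>k. ennreal (a k powr p)) = \<infinity>")
  case False
  then obtain r where r: "0 \<le> r" "(\<Sum>k. ennreal (a k powr p)) = ennreal r"
    by (intro that[of "enn2real (\<Sum>k. ennreal (a k powr p))"]) (auto simp: less_top)
  have le: "a k \<le> r powr (1/p)" for k
  proof -
    have "ennreal (a k powr p) \<le> ennreal r"
    proof -
      have "(\<Sum>j\<in>{k}. ennreal (a j powr p)) \<le> (\<Sum>k. ennreal (a k powr p))"
        by (rule sum_le_suminf) (auto intro: summableI)
      then show ?thesis by (simp only: r(2)) simp
    qed
    then have "a k powr p \<le> r" using r(1) by simp
    then have "(a k powr p) powr (1/p) \<le> r powr (1/p)"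
      using p by (intro powr_mono2) auto
    then show ?thesis using a p by (simp add: powr_powr)
  qed
  have sums: "(\<Sum>k<n. (1/2) ^ (k + 1) * a k) \<le> r powr (1/p)" for n
    using le by (intro sum_scaled_half_powers_le) (auto simp: mult.commute)
  have "summable (\<lambda>k. (1/2) ^ (k + 1) * a k)"
    using sums a by (intro abs_bounded_imp_summable[of _ "r powr (1/p)"]) (simp add: abs_mult)
  then have "(\<Sum>k. (1/2) ^ (k + 1) * a k) \<le> r powr (1/p)" "0 \<le> (\<Sum>k. (1/2) ^ (k + 1) * a k)"
    using sums a by (auto intro!: suminf_le_const suminf_nonneg mult_nonneg_nonneg simp del: power_Suc)
  then have "(\<Sum>k. (1/2) ^ (k + 1) * a k) powr p \<le> (r powr (1/p)) powr p"
    using p by (intro powr_mono2) auto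
  then show ?thesis using p r by (simp add: powr_powr ennreal_leI del: power_Suc)
qed simp

lemma series_powr_integral_finite:
  fixes a :: "nat \<Rightarrow> real \<Rightarrow> real \<Rightarrow> real" and g h :: "nat \<Rightarrow> real \<Rightarrow> ennreal"
    and \<Omega> :: "(('m::finite) space \<times> real) set"
  assumes \<Omega>: "\<Omega> \<subseteq> flow_domain" and p: "0 < p" and a: "\<And>k z. z \<in> \<Omega> \<Longrightarrow> 0 \<le> a k (height z) (snd z)"
    and [measurable]: "\<And>k. g k \<in> borel_measurable borel" "\<And>k. h k \<in> borel_measurable borel"
    and le: "\<And>k z. z \<in> \<Omega> \<Longrightarrow> ennreal (a k (height z) (snd z) powr p) \<le> g k (height z) * h k (snd z)"
    and gh: "\<And>k. (\<integral>\<^sup>+y. g k y \<partial>lborel) * (\<integral>\<^sup>+t. h k t \<partial>lborel) \<le> ennreal (C * (1/2) ^ (k + 1))"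
    and C: "0 \<le> C"
  shows "(\<integral>\<^sup>+z\<in>\<Omega>. ennreal ((\<Sum>k. (1/2) ^ (k + 1) * a k (height z) (snd z)) powr p) \<partial>lebesgue) < \<infinity>"
proof -
  let ?M = "emeasure lborel (ball 0 2 :: (real ^ 'm) set)"
  have "(\<integral>\<^sup>+z\<in>\<Omega>. ennreal ((\<Sum>k. (1/2) ^ (k + 1) * a k (height z) (snd z)) powr p) \<partial>lebesgue)
      \<le> (\<integral>\<^sup>+z. (\<Sum>k. indicator (ball 0 2) (fst (fst z)) * g k (height z) * h k (snd z))
        \<partial>(lebesgue :: ('m space \<times> real) measure))"
  proof (rule nn_integral_mono)
    fix z :: "'m space \<times> real"
    show "ennreal ((\<Sum>k. (1/2) ^ (k + 1) * a k (height z) (snd z)) powr p) * indicator \<Omega> z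
        \<le> (\<Sum>k. indicator (ball 0 2) (fst (fst z)) * g k (height z) * h k (snd z))"
    proof (cases "z \<in> \<Omega>")
      case True
      have "norm (fst (fst z)) < 2"
        using True \<Omega> flow_domain_bounds(1) by blast
      have "ennreal ((\<Sum>k. (1/2) ^ (k + 1) * a k (height z) (snd z)) powr p)
          \<le> (\<Sum>k. ennreal (a k (height z) (snd z) powr p))"
        using a[OF True] p by (rule suminf_half_powers_powr_le)
      also have "\<dots> \<le> (\<Sum>k. g k (height z) * h k (snd z))"
        using le[OF True] by (intro suminf_le) auto
      finally show ?thesis
        using True \<open>norm (fst (fst z)) < 2\<close> by simp
    qed simp
  qed
  also have "\<dots> = (\<integral>\<^sup>+z. (\<Sum>k. indicator (ball 0 2) (fst (fst z)) * g k (height z) * h k (snd z))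
      \<partial>(lborel :: ('m space \<times> real) measure))"
    by (rule nn_integral_completion)
  also have "\<dots> = (\<Sum>k. \<integral>\<^sup>+z. indicator (ball 0 2) (fst (fst z)) * g k (height z) * h k (snd z)
      \<partial>(lborel :: ('m space \<times> real) measure))"
  proof (rule nn_integral_suminf)
    fix k
    have "(\<lambda>z :: 'm space \<times> real. indicator (ball 0 2) (fst (fst z)) * g k (height z) * h k (snd z))
        \<in> borel_measurable borel"
      by (intro borel_measurable_times_ennreal measurable_of_fst measurable_of_snd
          borel_measurable_indicator) auto
    then show "(\<lambda>z :: 'm space \<times> real. indicator (ball 0 2) (fst (fst z)) * g k (height z) * h k (snd z))
        \<in> borel_measurable lborel"
      by simp
  qed
  also have "\<dots> = (\<Sum>k. ?M * ((\<integral>\<^sup>+y. g k y \<partial>lborel) * (\<integral>\<^sup>+t. h k t \<partial>lborel)))"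
    by (simp only: nn_integral_slab[OF assms(4,5)]) (simp only: mult.assoc)
  also have "\<dots> \<le> (\<Sum>k. ?M * ennreal (C * (1/2) ^ (k + 1)))"
    using gh by (intro suminf_le mult_left_mono) auto
  also have "\<dots> = ?M * (\<Sum>k. ennreal (C * (1/2) ^ (k + 1)))"
    by (rule ennreal_suminf_cmult)
  also have "(\<Sum>k. ennreal (C * (1/2) ^ (k + 1))) = ennreal (\<Sum>k. C * (1/2) ^ (k + 1))"
    using C by (intro suminf_ennreal2) (auto intro!: summable_mult)
  also have "?M * ennreal (\<Sum>k. C * (1/2) ^ (k + 1)) < \<infinity>"
    using emeasure_lborel_ball_finite[of "0 :: real ^ 'm" 2] by (simp add: ennreal_mult_less_top)
  finally show ?thesis .
qed

lemma Lp_norm_finite_iff: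
  "Lp_norm p S f < \<infinity> \<longleftrightarrow> (\<integral>\<^sup>+x\<in>S. ennreal (norm (f x) powr p) \<partial>lebesgue) < \<infinity>"
  by (auto simp: Lp_norm_def Let_def top.not_eq_extremum)

text \<open>What remains of the strength after one factor \<open>2\<^sup>-\<^sup>(\<^sup>k\<^sup>+\<^sup>1\<^sup>)\<close> has been split off as a weight.\<close>

definition amplitude :: "real \<Rightarrow> nat \<Rightarrow> real" where
  "amplitude q k = (1/2) ^ (k + 1) * duration k powr (- (1/q))"

lemma strength_eq_amplitude: "strength q k = (1/2) ^ (k + 1) * amplitude q k"
proof -
  have "(1/4::real) ^ (k + 1) = (1/2) ^ (k + 1) * (1/2) ^ (k + 1)"
    by (simp only: power_mult_distrib[symmetric]) simp
  then show ?thesis by (simp only: strength_def amplitude_def mult.assoc)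
qed

lemma amplitude_pos: "amplitude q k > 0"
  by (simp add: amplitude_def)

lemma amplitude_powr:
  assumes "1 < q" "1 \<le> p"
  shows "amplitude q k powr p * duration k powr (p/q) \<le> (1/2) ^ (k + 1)"
proof -
  have "amplitude q k powr p = ((1/2) ^ (k + 1)) powr p * duration k powr (- (p/q))"
    by (simp add: amplitude_def powr_mult powr_powr del: power_Suc)
  then have "amplitude q k powr p * duration k powr (p/q) = ((1/2) ^ (k + 1)) powr p"
    by (simp add: mult.assoc powr_add[symmetric] del: power_Suc)
  also have "\<dots> \<le> ((1/2) ^ (k + 1)) powr 1"
    using assms(2) by (intro powr_mono') (auto simp: power_le_one simp del: power_Suc)
  also have "\<dots> = (1/2) ^ (k + 1)" by simp
  finally show ?thesis .
qed

lemma pulse_eq_amplitude: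
  "pulse q k t = (1/2) ^ (k + 1) * (amplitude q k * indicator {1 - duration k<..<1} t)"
  by (simp add: pulse_def strength_eq_amplitude)

lemma force_powr_integral_finite:
  assumes q: "1 < q"
  shows "(\<integral>\<^sup>+z\<in>flow_domain. ennreal (force q (snd z) powr q)
    \<partial>(lebesgue :: (('m::finite) space \<times> real) measure)) < \<infinity>"
proof -
  have "(\<integral>\<^sup>+z\<in>flow_domain. ennreal ((\<Sum>k. (1/2) ^ (k + 1) *
      (amplitude q k * indicator {1 - duration k<..<1} (snd z))) powr q)
      \<partial>(lebesgue :: ('m space \<times> real) measure)) < \<infinity>"
  proof (rule series_powr_integral_finite[where
        g = "\<lambda>k. indicator {0..2}" and C = 2 and
        h = "\<lambda>k t. ennreal (amplitude q k powr q) * indicator {1 - duration k<..<1} t" and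
        a = "\<lambda>k y t. amplitude q k * indicator {1 - duration k<..<1} t"])
    fix k and z :: "'m space \<times> real" assume "z \<in> flow_domain"
    then show "ennreal ((amplitude q k * indicator {1 - duration k<..<1} (snd z)) powr q)
        \<le> indicator {0..2} (height z) * (ennreal (amplitude q k powr q) * indicator {1 - duration k<..<1} (snd z))"
      using flow_domain_bounds[of z] by (auto simp: indicator_def)
  next
    fix k
    have "ennreal (amplitude q k powr q * duration k) \<le> ennreal ((1/2) ^ (k + 1))"
      using amplitude_powr[OF q, of q k] q by (intro ennreal_leI) simp
    then have "ennreal 2 * ennreal (amplitude q k powr q * duration k) \<le> ennreal 2 * ennreal ((1/2) ^ (k + 1))"
      by (rule mult_left_mono) simp
    then show "(\<integral>\<^sup>+y. indicator {0..2::real} y \<partial>lborel) *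
        (\<integral>\<^sup>+t. ennreal (amplitude q k powr q) * indicator {1 - duration k<..<1} t \<partial>lborel)
        \<le> ennreal (2 * (1/2) ^ (k + 1))"
      by (simp add: nn_integral_cmult ennreal_mult del: power_Suc)
  qed (use q amplitude_pos[of q] in \<open>auto simp: less_imp_le\<close>)
  then show ?thesis
    by (simp only: force_def pulse_eq_amplitude)
qed

lemma nn_integral_exp_decay:
  assumes "c > 0"
  shows "(\<integral>\<^sup>+y. ennreal (exp (- (y / c))) * indicator {0..} y \<partial>lborel) = ennreal c"
proof -
  have "filterlim (\<lambda>y::real. y / c) at_top at_top"
    using filterlim_tendsto_pos_mult_at_top[OF tendsto_const[of "1 / c"] _ filterlim_ident] assms by simp
  then have "((\<lambda>y. - c * exp (- (y / c))) \<longlongrightarrow> - c * 0) at_top"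
    by (intro tendsto_intros filterlim_compose[OF exp_at_bot])
       (simp add: filterlim_uminus_at_bot)
  then have "((\<lambda>y. - c * exp (- (y / c))) \<longlongrightarrow> 0) at_top" by simp
  moreover have "DERIV (\<lambda>y. - c * exp (- (y / c))) y :> exp (- (y / c))" for y
    using assms by (auto intro!: derivative_eq_intros)
  ultimately have "(\<integral>\<^sup>+y. ennreal (exp (- (y / c))) * indicator {0..} y \<partial>lborel)
      = ennreal (0 - - c * exp (- (0 / c)))"
    by (intro nn_integral_FTC_atLeast) auto
  then show ?thesis by simp
qed

text \<open>During its \<open>k\<close>-th burst the boundary layer is dominated by its final profile, which decays exponentially on the length scale
\<open>sqrt (duration k)\<close>. So the integral of the \<open>p\<close>-th power of \<open>layer\<close> over the burst is of the order \<open>duration k powr (3/2)\<close>, and for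
\<open>p = 3 q / 2\<close> this cancels the factor \<open>duration k powr (- p / q)\<close> exactly.\<close>

lemma velocity_yy_powr_integral_finite:
  assumes q: "1 < q"
  shows "(\<integral>\<^sup>+z\<in>half_cylinder 1. ennreal (\<bar>velocity_yy q (height z) (snd z)\<bar> powr (3 * q / 2))
    \<partial>(lebesgue :: (('m::finite) space \<times> real) measure)) < \<infinity>"
proof -
  define p where "p = 3 * q / 2"
  have p: "1 \<le> p" "0 < p" using q by (auto simp: p_def)
  define C where "C = exp (1/4) / gauss_mass"
  have C: "C > 0" using gauss_mass_pos by (simp add: C_def)
  define a where "a = (\<lambda>k y t. amplitude q k * indicator {1 - duration k<..<1} t
      * layer y (t - 1 + duration k))"
  define g where "g = (\<lambda>k y. ennreal ((amplitude q k * C) powr p) *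
      (ennreal (exp (- (y / (2 * sqrt (duration k))))) * indicator {0..} y))"
  define h where "h = (\<lambda>k t. indicator {1 - duration k<..<1} t :: ennreal)"
  have "(\<integral>\<^sup>+z\<in>half_cylinder 1. ennreal ((\<Sum>k. (1/2) ^ (k + 1) * a k (height z) (snd z)) powr p)
      \<partial>(lebesgue :: ('m space \<times> real) measure)) < \<infinity>"
  proof (rule series_powr_integral_finite)
    show "half_cylinder 1 \<subseteq> flow_domain" by (rule half_cylinder_1_subset)
    show "0 < p" by (rule p)
    show "g k \<in> borel_measurable borel" "h k \<in> borel_measurable borel" for k
      by (simp_all add: g_def h_def)
    show "0 \<le> 2 * C powr p" by simp
    show "0 \<le> a k (height z) (snd z)" if "z \<in> half_cylinder 1" for k and z :: "'m space \<times> real"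
    proof -
      have "0 \<le> layer (height z) (snd z - 1 + duration k)"
        using that half_cylinder_1_subset flow_domain_bounds(2)[of z]
        by (intro layer_bounds(1) less_imp_le) auto
      then show ?thesis
        using amplitude_pos[of q k] by (simp add: a_def less_imp_le)
    qed
  next
    fix k and z :: "'m space \<times> real" assume z: "z \<in> half_cylinder 1"
    define y where "y = height z"
    have y: "y > 0" using z half_cylinder_1_subset flow_domain_bounds[of z] by (auto simp: y_def)
    show "ennreal (a k (height z) (snd z) powr p) \<le> g k (height z) * h k (snd z)"
    proof (cases "snd z \<in> {1 - duration k<..<1}")
      case True
      have "layer y (snd z - 1 + duration k) \<le> layer y (snd z - 1 + duration k + (1 - snd z))"
        using layer_increment(1)[OF y, of "1 - snd z" "snd z - 1 + duration k"] True
        by (simp only: diff_ge_0_iff_ge) simp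
      also have "\<dots> = erfc (y / (2 * sqrt (duration k)))"
        by (simp add: layer_def)
      also have "\<dots> \<le> C * exp (- (y / (2 * sqrt (duration k))))"
        unfolding C_def using y by (intro erfc_le_exp) simp
      finally have "a k y (snd z) \<le> amplitude q k * C * exp (- (y / (2 * sqrt (duration k))))"
        using True amplitude_pos[of q k] by (simp add: a_def mult.assoc)
      then have "a k y (snd z) powr p \<le> (amplitude q k * C * exp (- (y / (2 * sqrt (duration k))))) powr p"
        using p layer_bounds(1)[of y] y amplitude_pos[of q k]
        by (intro powr_mono2) (auto simp: a_def less_imp_le)
      also have "\<dots> = (amplitude q k * C) powr p * exp (- (y / (2 * sqrt (duration k)))) powr p"
        using C amplitude_pos[of q k] by (simp add: powr_mult)
      also have "\<dots> \<le> (amplitude q k * C) powr p * exp (- (y / (2 * sqrt (duration k)))) powr 1"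
        using p y by (intro mult_left_mono powr_mono') auto
      finally show ?thesis
        using True y unfolding g_def h_def y_def[symmetric]
        by (simp add: ennreal_mult[symmetric] ennreal_leI)
    qed (use p in \<open>auto simp: a_def\<close>)
  next
    fix k
    have "(\<integral>\<^sup>+y. g k y \<partial>lborel) * (\<integral>\<^sup>+t. h k t \<partial>lborel) =
        ennreal ((amplitude q k * C) powr p) * ennreal (2 * sqrt (duration k)) * ennreal (duration k)"
      using nn_integral_exp_decay[of "2 * sqrt (duration k)"]
      by (simp add: g_def h_def nn_integral_cmult)
    also have "\<dots> = ennreal (2 * C powr p * (amplitude q k powr p * (sqrt (duration k) * duration k)))"
      using C amplitude_pos[of q k] by (simp add: ennreal_mult[symmetric] powr_mult mult_ac)
    also have "sqrt (duration k) * duration k = duration k powr (p / q)"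
    proof -
      have "sqrt (duration k) * duration k = duration k powr (1/2) * duration k powr 1"
        by (simp add: powr_half_sqrt)
      also have "\<dots> = duration k powr (p / q)"
        unfolding powr_add[symmetric] using q by (simp add: p_def)
      finally show ?thesis .
    qed
    also have "ennreal (2 * C powr p * (amplitude q k powr p * duration k powr (p / q)))
        \<le> ennreal (2 * C powr p * (1/2) ^ (k + 1))"
      using amplitude_powr[OF q p(1), of k] by (intro ennreal_leI mult_left_mono) auto
    finally show "(\<integral>\<^sup>+y. g k y \<partial>lborel) * (\<integral>\<^sup>+t. h k t \<partial>lborel) \<le> ennreal (2 * C powr p * (1/2) ^ (k + 1))" .
  qed
  also have "(\<integral>\<^sup>+z\<in>half_cylinder 1. ennreal ((\<Sum>k. (1/2) ^ (k + 1) * a k (height z) (snd z)) powr p)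
      \<partial>(lebesgue :: ('m space \<times> real) measure)) =
    (\<integral>\<^sup>+z\<in>half_cylinder 1. ennreal (\<bar>velocity_yy q (height z) (snd z)\<bar> powr p)
      \<partial>(lebesgue :: ('m space \<times> real) measure))"
  proof (rule nn_integral_cong)
    fix z :: "'m space \<times> real"
    have "\<bar>velocity_yy q (height z) (snd z)\<bar> = (\<Sum>k. (1/2) ^ (k + 1) * a k (height z) (snd z))"
      if "z \<in> half_cylinder 1"
    proof -
      have "height z > 0" "snd z < 1"
        using that half_cylinder_1_subset flow_domain_bounds[of z] half_cylinder_before_1[of z] by auto
      then show ?thesis
        using velocity_yy_bounds(1)[OF q] by (simp only: a_def pulse_eq_amplitude mult.assoc)
    qed
    then show "ennreal ((\<Sum>k. (1/2) ^ (k + 1) * a k (height z) (snd z)) powr p) * indicator (half_cylinder 1) z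
      = ennreal (\<bar>velocity_yy q (height z) (snd z)\<bar> powr p) * indicator (half_cylinder 1) z"
      by (cases "z \<in> half_cylinder 1") (auto simp del: power_Suc)
  qed
  finally show ?thesis by (simp only: p_def)
qed

text \<open>The boxes \<open>ball 0 (1/4) \<times> {a k<..<b k} \<times> {c k<..<1}\<close> lie in the half cylinder, and the integral over the \<open>k\<close>-th of them is
at least \<open>m k powr r\<close> times its measure.\<close>

lemma Lp_norm_infinite_of_boxes:
  fixes f :: "('m::finite) space \<times> real \<Rightarrow> 'b::real_normed_vector"
  assumes r: "0 < r"
    and box: "\<And>k. 0 \<le> a k \<and> a k \<le> b k \<and> b k \<le> 1/4 \<and> 3/4 \<le> c k \<and> c k \<le> 1"
    and m: "\<And>k. 0 \<le> m k"
    and le: "\<And>k z. z \<in> half_cylinder (1/2) \<Longrightarrow> a k < height z \<Longrightarrow> height z < b k \<Longrightarrow>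
      c k < snd z \<Longrightarrow> m k \<le> norm (f z)"
    and lim: "filterlim (\<lambda>k. m k powr r * ((b k - a k) * (1 - c k))) at_top sequentially"
  shows "Lp_norm r (half_cylinder (1/2)) f = \<infinity>"
proof -
  define I where "I = (\<integral>\<^sup>+z\<in>half_cylinder (1/2). ennreal (norm (f z) powr r) \<partial>lebesgue)"
  define \<mu> where "\<mu> = measure lborel (ball 0 (1/4) :: (real ^ 'm) set)"
  have \<mu>: "\<mu> > 0" "emeasure lborel (ball 0 (1/4) :: (real ^ 'm) set) = ennreal \<mu>"
    using content_ball_pos[of "1/4" "0 :: real ^ 'm"] emeasure_lborel_ball_finite[of "0 :: real ^ 'm" "1/4"]
    by (auto simp: \<mu>_def emeasure_eq_ennreal_measure)
  have ge: "ennreal (\<mu> * (m k powr r * ((b k - a k) * (1 - c k)))) \<le> I" for k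
  proof -
    have "ennreal (\<mu> * (m k powr r * ((b k - a k) * (1 - c k)))) =
        ennreal \<mu> * (ennreal (m k powr r) * ennreal (b k - a k)) * ennreal (1 - c k)"
      using \<mu>(1) box[of k] by (simp add: ennreal_mult[symmetric] mult.assoc)
    also have "\<dots> = (\<integral>\<^sup>+z. indicator (ball 0 (1/4)) (fst (fst z)) *
        (ennreal (m k powr r) * indicator {a k<..<b k} (height z)) * indicator {c k<..<1} (snd z)
        \<partial>(lborel :: ('m space \<times> real) measure))"
      using box[of k]
      by (subst nn_integral_slab[where g = "\<lambda>y. ennreal (m k powr r) * indicator {a k<..<b k} y"
            and h = "indicator {c k<..<1}"]) (simp_all add: \<mu>(2) nn_integral_cmult)
    also have "\<dots> = (\<integral>\<^sup>+z. indicator (ball 0 (1/4)) (fst (fst z)) *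
        (ennreal (m k powr r) * indicator {a k<..<b k} (height z)) * indicator {c k<..<1} (snd z)
        \<partial>(lebesgue :: ('m space \<times> real) measure))"
      by (rule nn_integral_completion[symmetric])
    also have "\<dots> \<le> I"
      unfolding I_def
    proof (rule nn_integral_mono)
      fix z :: "'m space \<times> real"
      obtain x y t where z: "z = ((x, y), t)" by (metis surj_pair)
      show "indicator (ball 0 (1/4)) (fst (fst z)) *
        (ennreal (m k powr r) * indicator {a k<..<b k} (height z)) * indicator {c k<..<1} (snd z)
        \<le> ennreal (norm (f z) powr r) * indicator (half_cylinder (1/2)) z"
      proof (cases "norm x < 1/4 \<and> a k < y \<and> y < b k \<and> c k < t \<and> t < 1")
        case True
        have "norm (x, y) \<le> norm x + \<bar>y\<bar>"
          using sqrt_sum_squares_le_sum_abs[of "norm x" "y"] by (simp add: norm_Pair)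
        then have "z \<in> half_cylinder (1/2)"
          using True box[of k] by (auto simp: z half_cylinder_def half_ball_def power2_eq_square)
        moreover from this have "m k powr r \<le> norm (f z) powr r"
          using le[of z k] True m[of k] r by (intro powr_mono2) (auto simp: z)
        ultimately show ?thesis
          using True by (simp add: z ennreal_leI)
      qed (auto simp: z indicator_def)
    qed
    finally show ?thesis .
  qed
  have "I = \<infinity>"
  proof (rule ccontr)
    assume "I \<noteq> \<infinity>"
    then obtain B where B: "0 \<le> B" "I = ennreal B" by (cases I) auto
    have "filterlim (\<lambda>k. \<mu> * (m k powr r * ((b k - a k) * (1 - c k)))) at_top sequentially"
      by (rule filterlim_tendsto_pos_mult_at_top[OF tendsto_const \<mu>(1) lim])
    then obtain k where "B < \<mu> * (m k powr r * ((b k - a k) * (1 - c k)))"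
      by (auto simp: filterlim_at_top_dense eventually_sequentially)
    then show False using ge[of k] B by (simp add: not_le[symmetric])
  qed
  then show ?thesis by (simp add: Lp_norm_def I_def)
qed

section \<open>Weak derivatives of the superposition\<close>

lemma locally_integrable_continuous:
  fixes F :: "'a::euclidean_space \<Rightarrow> real"
  assumes "continuous_on \<Omega> F"
  shows "locally_integrable \<Omega> F"
  unfolding locally_integrable_def set_integrable_def
proof (intro allI impI)
  fix K assume "compact K \<and> K \<subseteq> \<Omega>"
  then have "integrable lborel (\<lambda>x. indicator K x *\<^sub>R F x)"
    using assms by (intro borel_integrable_compact) (auto intro: continuous_on_subset)
  then show "integrable lebesgue (\<lambda>x. indicator K x *\<^sub>R F x)"
    by (subst integrable_completion) auto
qed

lemma locally_integrable_add:
  fixes f g :: "'a::euclidean_space \<Rightarrow> real"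
  assumes "locally_integrable \<Omega> f" "locally_integrable \<Omega> g"
  shows "locally_integrable \<Omega> (\<lambda>x. f x + g x)"
  using assms by (auto simp: locally_integrable_def)

lemma force_measurable [measurable]: "force q \<in> borel_measurable borel"
  unfolding force_def[abs_def] pulse_def by measurable

lemma burst_measurable [measurable (raw)]:
  assumes [measurable]: "f \<in> borel_measurable M" "g \<in> borel_measurable M"
  shows "(\<lambda>x. burst q (flow (f x)) k (g x)) \<in> borel_measurable M"
    and "(\<lambda>x. burst q (flow_y (f x)) k (g x)) \<in> borel_measurable M"
    and "(\<lambda>x. burst q (layer (f x)) k (g x)) \<in> borel_measurable M"
    and "(\<lambda>x. pulse q k (g x)) \<in> borel_measurable M"
  unfolding burst_def pulse_def by measurable

lemma velocity_measurable [measurable (raw)]: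
  assumes [measurable]: "f \<in> borel_measurable M" "g \<in> borel_measurable M"
  shows "(\<lambda>x. velocity q (f x) (g x)) \<in> borel_measurable M"
    and "(\<lambda>x. velocity_y q (f x) (g x)) \<in> borel_measurable M"
  unfolding velocity_def velocity_y_def by measurable

text \<open>The force is unbounded at time \<open>1\<close>, but \<open>force \<le> 1 + force powr q\<close>, and both summands are integrable on compact subsets of the domain.\<close>

lemma force_locally_integrable:
  assumes q: "1 < q"
  shows "locally_integrable flow_domain (\<lambda>z :: ('m::finite) space \<times> real. force q (snd z))"
  unfolding locally_integrable_def
proof (intro allI impI)
  fix K :: "('m space \<times> real) set" assume K: "compact K \<and> K \<subseteq> flow_domain"
  then have [measurable]: "K \<in> sets borel" by (simp add: compact_imp_closed borel_closed)
  have "integrable lborel (\<lambda>z :: 'm space \<times> real. indicator K z *\<^sub>R force q (snd z))"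
  proof (rule integrableI_bounded)
    show "(\<lambda>z :: 'm space \<times> real. indicator K z *\<^sub>R force q (snd z)) \<in> borel_measurable lborel"
      by simp
    have le: "force q t \<le> 1 + force q t powr q" for t
    proof (cases "force q t \<le> 1")
      case False
      then have "force q t powr 1 \<le> force q t powr q"
        using q by (intro powr_mono) auto
      then show ?thesis using False by simp
    qed (simp add: add_increasing2)
    have "(\<integral>\<^sup>+z. ennreal (norm (indicator K z *\<^sub>R force q (snd z))) \<partial>(lborel :: ('m space \<times> real) measure))
      \<le> (\<integral>\<^sup>+z. indicator K z + ennreal (force q (snd z) powr q) * indicator flow_domain z
          \<partial>(lborel :: ('m space \<times> real) measure))"
    proof (rule nn_integral_mono)
      fix z :: "'m space \<times> real"
      show "ennreal (norm (indicator K z *\<^sub>R force q (snd z)))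
        \<le> indicator K z + ennreal (force q (snd z) powr q) * indicator flow_domain z"
      proof (cases "z \<in> K")
        case True
        have "ennreal (force q (snd z)) \<le> ennreal (1 + force q (snd z) powr q)"
          by (rule ennreal_leI[OF le])
        also have "\<dots> = 1 + ennreal (force q (snd z) powr q)" by (simp add: ennreal_plus)
        finally show ?thesis
          using True K force_nonneg[of q "snd z"] by auto
      qed simp
    qed
    also have "\<dots> = emeasure lborel K + (\<integral>\<^sup>+z\<in>flow_domain. ennreal (force q (snd z) powr q)
        \<partial>(lborel :: ('m space \<times> real) measure))"
    proof (subst nn_integral_add)
      have "(\<lambda>z :: 'm space \<times> real. ennreal (force q (snd z) powr q) * indicator flow_domain z)
          \<in> borel_measurable borel"
        by (intro borel_measurable_times_ennreal borel_measurable_indicator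
            borel_open[OF open_flow_domain]) simp
      then show "(\<lambda>z :: 'm space \<times> real. ennreal (force q (snd z) powr q) * indicator flow_domain z)
          \<in> borel_measurable lborel"
        by simp
    qed auto
    also have "\<dots> < \<infinity>"
      using emeasure_compact_finite[of K] K force_powr_integral_finite[OF q, where 'm = 'm]
      by (simp add: nn_integral_completion)
    finally show "(\<integral>\<^sup>+z. ennreal (norm (indicator K z *\<^sub>R force q (snd z)))
      \<partial>(lborel :: ('m space \<times> real) measure)) < \<infinity>" .
  qed
  then show "(\<lambda>z. force q (snd z)) absolutely_integrable_on K"
    unfolding set_integrable_def by (subst integrable_completion) auto
qed

text \<open>Powers of the inverse distance to the wall dominate the series. They are locally integrable because compact subsets
of the open domain stay away from the wall.\<close>

lemma wall_weight_locally_integrable: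
  "locally_integrable flow_domain (\<lambda>z :: ('m::finite) space \<times> real. c / height z ^ n)"
  using flow_domain_bounds(2)
  by (intro locally_integrable_continuous continuous_intros) force

lemma DERIV_zero_on_negative_axis:
  fixes g :: "real \<Rightarrow> real"
  assumes "\<And>t. t < 0 \<Longrightarrow> g t = 0" "t < 0"
  shows "(g has_real_derivative 0) (at t)"
proof -
  have "((\<lambda>t. 0) has_real_derivative 0) (at t)" by simp
  then show ?thesis
    by (rule has_field_derivative_transform_within_open[of _ _ _ "{..<0}"]) (use assms in auto)
qed

lemma flow_DERIV_t_all:
  assumes "y > 0" "t \<noteq> 0"
  shows "(flow y has_real_derivative (if t > 0 then 1 else 0) - layer y t) (at t)"
proof (cases "t > 0")
  case False
  then have "(flow y has_real_derivative 0) (at t)"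
    using assms(2) by (intro DERIV_zero_on_negative_axis) (auto simp: flow_def)
  then show ?thesis using False by (simp add: layer_def)
qed (use flow_DERIV_t assms in auto)

lemma flow_isCont:
  assumes "y > 0"
  shows "isCont (flow y) t"
  using flow_isCont_0[OF assms] DERIV_isCont[OF flow_DERIV_t_all[OF assms]] by (cases "t = 0") auto

lemma burst_flow_isCont:
  assumes "y > 0"
  shows "isCont (burst q (flow y) k) t"
proof -
  have "isCont (\<lambda>t. flow y (t + c)) t" for c
    by (intro isCont_o2[OF _ flow_isCont[OF assms]] continuous_intros)
  from this[of "duration k - 1"] this[of "- 1"] show ?thesis
    unfolding burst_def[abs_def] by (intro continuous_intros) (simp_all add: algebra_simps)
qed

text \<open>At the two excluded times the pulse is switched on and off, and the velocity has a corner.\<close>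

lemma burst_flow_DERIV_t:
  assumes "y > 0" "t \<noteq> 1" "t \<noteq> 1 - duration k"
  shows "(burst q (flow y) k has_real_derivative pulse q k t - burst q (layer y) k t) (at t)"
proof -
  have d: "((\<lambda>t. flow y (t + c)) has_real_derivative (if t + c > 0 then 1 else 0) - layer y (t + c)) (at t)"
    if "t + c \<noteq> 0" for c
    using flow_DERIV_t_all[OF assms(1) that] by (simp add: DERIV_shift)
  have "((\<lambda>t. strength q k * (flow y (t + (duration k - 1)) - flow y (t + - 1))) has_real_derivative
    strength q k * (((if t + (duration k - 1) > 0 then 1 else 0) - layer y (t + (duration k - 1)))
      - ((if t + - 1 > 0 then 1 else 0) - layer y (t + - 1)))) (at t)"
    using assms by (intro DERIV_cmult DERIV_diff d) auto
  moreover have "strength q k * (((if t + (duration k - 1) > 0 then 1 else 0) - layer y (t + (duration k - 1)))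
      - ((if t + - 1 > 0 then 1 else 0) - layer y (t + - 1))) = pulse q k t - burst q (layer y) k t"
    using assms duration_pos[of k]
    by (auto simp: pulse_def burst_def indicator_def algebra_simps simp del: duration_pos)
  ultimately show ?thesis
    by (simp add: burst_def[abs_def] algebra_simps)
qed

lemma burst_flow_DERIV_y:
  assumes "y > 0"
  shows "((\<lambda>y. burst q (flow y) k t) has_real_derivative burst q (flow_y y) k t) (at y)"
    and "((\<lambda>y. burst q (flow_y y) k t) has_real_derivative - burst q (layer y) k t) (at y)"
proof -
  show "((\<lambda>y. burst q (flow y) k t) has_real_derivative burst q (flow_y y) k t) (at y)"
    unfolding burst_def by (intro DERIV_cmult DERIV_diff flow_DERIV_y[OF assms])
  have "((\<lambda>y. burst q (flow_y y) k t) has_real_derivative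
      strength q k * (- layer y (t - 1 + duration k) - - layer y (t - 1))) (at y)"
    unfolding burst_def by (intro DERIV_cmult DERIV_diff flow_y_DERIV_y[OF assms])
  then show "((\<lambda>y. burst q (flow_y y) k t) has_real_derivative - burst q (layer y) k t) (at y)"
    by (simp add: burst_def algebra_simps)
qed

lemma locally_integrable_burst:
  assumes q: "1 < q"
  shows "locally_integrable flow_domain (\<lambda>z :: ('m::finite) space \<times> real. burst q (flow (height z)) k (snd z))"
    and "locally_integrable flow_domain (\<lambda>z :: 'm space \<times> real. burst q (flow_y (height z)) k (snd z))"
    and "locally_integrable flow_domain (\<lambda>z :: 'm space \<times> real. burst q (layer (height z)) k (snd z))"
    and "locally_integrable flow_domain (\<lambda>z :: 'm space \<times> real. pulse q k (snd z))"
proof -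
  have single: "\<bar>f k\<bar> \<le> B" if "\<And>n. (\<Sum>j<n. \<bar>f j\<bar>) \<le> B" for f :: "nat \<Rightarrow> real" and B
  proof -
    have "0 \<le> (\<Sum>j<k. \<bar>f j\<bar>)" by (intro sum_nonneg) simp
    then show ?thesis using that[of "Suc k"] unfolding sum.lessThan_Suc by linarith
  qed
  note y = flow_domain_bounds(2)
  show "locally_integrable flow_domain (\<lambda>z :: 'm space \<times> real. burst q (flow (height z)) k (snd z))"
    by (rule locally_integrable_bounded_by[OF _ wall_weight_locally_integrable[of 1 0]])
       (use single[OF velocity_bound(1)[OF q y]] in simp_all)
  show "locally_integrable flow_domain (\<lambda>z :: 'm space \<times> real. burst q (flow_y (height z)) k (snd z))"
    by (rule locally_integrable_bounded_by[OF _ wall_weight_locally_integrable[of "1 / gauss_mass" 1]])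
       (use single[OF velocity_bound(2)[OF q y]] in simp_all)
  show "locally_integrable flow_domain (\<lambda>z :: 'm space \<times> real. burst q (layer (height z)) k (snd z))"
    by (rule locally_integrable_bounded_by[OF _ wall_weight_locally_integrable[of "2 / gauss_mass" 2]])
       (use single[OF velocity_bound(3)[OF q y]] in simp_all)
  show "locally_integrable flow_domain (\<lambda>z :: 'm space \<times> real. pulse q k (snd z))"
    by (rule locally_integrable_bounded_by[OF _ force_locally_integrable[OF q]])
       (use single[OF sum_pulse_le_force] in simp_all)
qed

lemma Basis_space_cases:
  fixes b :: "('m::finite) space"
  assumes "b \<in> Basis"
  obtains "snd b = 0" | "b = (0, 1)"
  using assms by (auto simp: Basis_prod_def)

lemma Basis_vertical: "((0, 1) :: ('m::finite) space) \<in> Basis"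
  by (simp add: Basis_prod_def)

lemma weak_deriv_tangential:
  fixes f :: "real \<Rightarrow> real \<Rightarrow> real"
  assumes "b \<in> Basis" "snd b = 0"
    and f: "locally_integrable flow_domain (\<lambda>z :: ('m::finite) space \<times> real. f (height z) (snd z))"
    and m: "(\<lambda>z :: 'm space \<times> real. f (height z) (snd z)) \<in> borel_measurable borel"
  shows "weak_deriv flow_domain [(b, 0)] (\<lambda>z :: 'm space \<times> real. f (height z) (snd z)) (\<lambda>z. 0)"
  by (rule weak_deriv_along_lines[OF open_flow_domain _ m _ f])
     (use assms(1,2) in \<open>auto simp: Basis_pair locally_integrable_def set_integrable_def\<close>)

lemma weak_deriv_vertical:
  fixes f g :: "real \<Rightarrow> real \<Rightarrow> real"
  assumes f: "locally_integrable flow_domain (\<lambda>z :: ('m::finite) space \<times> real. f (height z) (snd z))"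
    and g: "locally_integrable flow_domain (\<lambda>z :: 'm space \<times> real. g (height z) (snd z))"
    and fm: "(\<lambda>z :: 'm space \<times> real. f (height z) (snd z)) \<in> borel_measurable borel"
    and gm: "(\<lambda>z :: 'm space \<times> real. g (height z) (snd z)) \<in> borel_measurable borel"
    and der: "\<And>y t. y > 0 \<Longrightarrow> ((\<lambda>y. f y t) has_real_derivative g y t) (at y)"
  shows "weak_deriv flow_domain [((0, 1), 0)] (\<lambda>z :: 'm space \<times> real. f (height z) (snd z))
    (\<lambda>z. g (height z) (snd z))"
proof (rule weak_deriv_along_lines[OF open_flow_domain _ fm gm f g])
  show "((0, 1), 0) \<in> (Basis :: ('m space \<times> real) set)"
    by (intro Basis_pair Basis_vertical)
  fix x :: "'m space \<times> real"
  have d: "((\<lambda>s. f (height (x + s *\<^sub>R ((0, 1), 0))) (snd (x + s *\<^sub>R ((0, 1), 0))))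
      has_real_derivative g (height (x + s *\<^sub>R ((0, 1), 0))) (snd (x + s *\<^sub>R ((0, 1), 0)))) (at s)"
    if "x + s *\<^sub>R ((0, 1), 0) \<in> flow_domain" for s
  proof -
    have "height x + s > 0" using flow_domain_bounds(2)[OF that] by simp
    from der[OF this, of "snd x"] show ?thesis
      using DERIV_shift[of "\<lambda>y. f y (snd x)" _ s "height x"] by (simp add: add.commute)
  qed
  then show "isCont (\<lambda>s. f (height (x + s *\<^sub>R ((0, 1), 0))) (snd (x + s *\<^sub>R ((0, 1), 0)))) s"
    if "x + s *\<^sub>R ((0, 1), 0) \<in> flow_domain" for s
    using that DERIV_isCont by blast
  show "\<exists>S. finite S \<and> (\<forall>s. s \<notin> S \<longrightarrow> x + s *\<^sub>R ((0, 1), 0) \<in> flow_domain \<longrightarrow>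
      ((\<lambda>s. f (height (x + s *\<^sub>R ((0, 1), 0))) (snd (x + s *\<^sub>R ((0, 1), 0))))
      has_real_derivative g (height (x + s *\<^sub>R ((0, 1), 0))) (snd (x + s *\<^sub>R ((0, 1), 0)))) (at s))"
    using d by (intro exI[of _ "{}"]) blast
qed

lemma burst_weak_deriv_t:
  assumes q: "1 < q"
  shows "weak_deriv flow_domain [(0, 1)] (\<lambda>z :: ('m::finite) space \<times> real. burst q (flow (height z)) k (snd z))
    (\<lambda>z. pulse q k (snd z) - burst q (layer (height z)) k (snd z))"
proof (rule weak_deriv_along_lines[OF open_flow_domain])
  show "locally_integrable flow_domain (\<lambda>z :: 'm space \<times> real.
      pulse q k (snd z) - burst q (layer (height z)) k (snd z))"
    using locally_integrable_burst(3,4)[OF q, where 'm = 'm] by (auto simp: locally_integrable_def)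
  fix x :: "'m space \<times> real"
  have shift: "height (x + s *\<^sub>R (0, 1)) = height x" "snd (x + s *\<^sub>R (0, 1)) = snd x + s" for s
    by simp_all
  show "isCont (\<lambda>s. burst q (flow (height (x + s *\<^sub>R (0, 1)))) k (snd (x + s *\<^sub>R (0, 1)))) s"
    if "x + s *\<^sub>R (0, 1) \<in> flow_domain" for s
    unfolding shift using flow_domain_bounds(2)[OF that]
    by (intro isCont_o2[OF _ burst_flow_isCont] continuous_intros) simp
  show "\<exists>S. finite S \<and> (\<forall>s. s \<notin> S \<longrightarrow> x + s *\<^sub>R (0, 1) \<in> flow_domain \<longrightarrow>
      ((\<lambda>s. burst q (flow (height (x + s *\<^sub>R (0, 1)))) k (snd (x + s *\<^sub>R (0, 1))))
      has_real_derivative pulse q k (snd (x + s *\<^sub>R (0, 1)))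
        - burst q (layer (height (x + s *\<^sub>R (0, 1)))) k (snd (x + s *\<^sub>R (0, 1)))) (at s))"
  proof (intro exI[of _ "{1 - snd x, 1 - duration k - snd x}"] conjI allI impI)
    fix s assume s: "s \<notin> {1 - snd x, 1 - duration k - snd x}" "x + s *\<^sub>R (0, 1) \<in> flow_domain"
    have "height x > 0" using flow_domain_bounds(2)[OF s(2)] by simp
    then have "(burst q (flow (height x)) k has_real_derivative
        pulse q k (snd x + s) - burst q (layer (height x)) k (snd x + s)) (at (snd x + s))"
      using s(1) by (intro burst_flow_DERIV_t) auto
    then show "((\<lambda>s. burst q (flow (height (x + s *\<^sub>R (0, 1)))) k (snd (x + s *\<^sub>R (0, 1))))
      has_real_derivative pulse q k (snd (x + s *\<^sub>R (0, 1)))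
        - burst q (layer (height (x + s *\<^sub>R (0, 1)))) k (snd (x + s *\<^sub>R (0, 1)))) (at s)"
      unfolding shift using DERIV_shift[of "burst q (flow (height x)) k" _ s "snd x"]
      by (simp add: add.commute)
  qed simp
qed (use locally_integrable_burst(1)[OF q, where 'm = 'm] in \<open>simp_all add: Basis_pair\<close>)

text \<open>The partial sums are dominated by \<open>1\<close> for the velocity, by multiples of \<open>1 / y\<close> and \<open>1 / y\<^sup>2\<close> for its two space
derivatives, and by the force plus the latter multiple for the time derivative.\<close>

lemma velocity_weak_derivs:
  assumes q: "1 < q"
  shows "weak_deriv flow_domain [(0, 1)] (\<lambda>z :: ('m::finite) space \<times> real. velocity q (height z) (snd z))
      (\<lambda>z. velocity_t q (height z) (snd z))"
    and "weak_deriv flow_domain [((0, 1), 0)] (\<lambda>z :: 'm space \<times> real. velocity q (height z) (snd z))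
      (\<lambda>z. velocity_y q (height z) (snd z))"
    and "weak_deriv flow_domain [((0, 1), 0)] (\<lambda>z :: 'm space \<times> real. velocity_y q (height z) (snd z))
      (\<lambda>z. velocity_yy q (height z) (snd z))"
proof -
  note y = flow_domain_bounds(2)
  note li = locally_integrable_burst[OF q, where 'm = 'm]
  have b1: "locally_integrable flow_domain (\<lambda>z :: 'm space \<times> real. 1 :: real)"
    using wall_weight_locally_integrable[of 1 0] by simp
  note b2 = wall_weight_locally_integrable[of "1 / gauss_mass" 1, where 'm = 'm]
  note b3 = wall_weight_locally_integrable[of "2 / gauss_mass" 2, where 'm = 'm]
  have vertical: "set [((0, 1), 0)] \<subseteq> (Basis :: ('m space \<times> real) set)"
    using Basis_pair(1)[OF Basis_vertical] by simp
  have time: "set [(0, 1)] \<subseteq> (Basis :: ('m space \<times> real) set)"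
    by (simp add: Basis_pair)
  show "weak_deriv flow_domain [(0, 1)] (\<lambda>z :: 'm space \<times> real. velocity q (height z) (snd z))
      (\<lambda>z. velocity_t q (height z) (snd z))"
    unfolding velocity_def velocity_t_def
  proof (rule weak_deriv_suminf[OF time burst_weak_deriv_t[OF q] _ _ b1 _
        locally_integrable_add[OF force_locally_integrable[OF q] b3]])
    fix z :: "'m space \<times> real" and n assume z: "z \<in> flow_domain"
    show "(\<Sum>k<n. \<bar>burst q (flow (height z)) k (snd z)\<bar>) \<le> 1"
      by (rule velocity_bound(1)[OF q y[OF z]])
    have "(\<Sum>k<n. \<bar>pulse q k (snd z) - burst q (layer (height z)) k (snd z)\<bar>)
        \<le> (\<Sum>k<n. \<bar>pulse q k (snd z)\<bar>) + (\<Sum>k<n. \<bar>burst q (layer (height z)) k (snd z)\<bar>)"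
      unfolding sum.distrib[symmetric] by (intro sum_mono abs_triangle_ineq4)
    also have "\<dots> \<le> force q (snd z) + 2 / gauss_mass / height z ^ 2"
      using sum_pulse_le_force[of q "snd z" n] velocity_bound(3)[OF q y[OF z], of "snd z" n]
      by (intro add_mono) auto
    finally show "(\<Sum>k<n. \<bar>pulse q k (snd z) - burst q (layer (height z)) k (snd z)\<bar>)
      \<le> force q (snd z) + 2 / gauss_mass / height z ^ 2" .
  qed simp_all
  show "weak_deriv flow_domain [((0, 1), 0)] (\<lambda>z :: 'm space \<times> real. velocity q (height z) (snd z))
      (\<lambda>z. velocity_y q (height z) (snd z))"
    unfolding velocity_def velocity_y_def
  proof (rule weak_deriv_suminf[OF vertical _ _ _ b1 _ b2])
    show "weak_deriv flow_domain [((0, 1), 0)] (\<lambda>z :: 'm space \<times> real. burst q (flow (height z)) k (snd z))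
        (\<lambda>z. burst q (flow_y (height z)) k (snd z))" for k
      using weak_deriv_vertical[of "\<lambda>y. burst q (flow y) k" "\<lambda>y. burst q (flow_y y) k", OF li(1,2)]
        burst_flow_DERIV_y(1) by simp
  qed (use velocity_bound(1,2)[OF q y] in simp_all)
  show "weak_deriv flow_domain [((0, 1), 0)] (\<lambda>z :: 'm space \<times> real. velocity_y q (height z) (snd z))
      (\<lambda>z. velocity_yy q (height z) (snd z))"
    unfolding velocity_y_def velocity_yy_def
  proof (rule weak_deriv_suminf[OF vertical _ _ _ b2 _ b3])
    have "locally_integrable flow_domain (\<lambda>z :: 'm space \<times> real. - burst q (layer (height z)) k (snd z))" for k
      using locally_integrable_scaleR[OF li(3)[of k], of "- 1 :: real"] by simp
    then show "weak_deriv flow_domain [((0, 1), 0)] (\<lambda>z :: 'm space \<times> real. burst q (flow_y (height z)) k (snd z))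
        (\<lambda>z. - burst q (layer (height z)) k (snd z))" for k
      using weak_deriv_vertical[of "\<lambda>y. burst q (flow_y y) k" "\<lambda>y t. - burst q (layer y) k t", OF li(2)]
        burst_flow_DERIV_y(2) by simp
  qed (use velocity_bound(2,3)[OF q y] in simp_all)
qed


section \<open>The singular shear flow\<close>

lemma pressure_weak_gradient:
  fixes e :: "('m::finite) space"
  assumes q: "1 < q"
  shows "weak_gradient flow_domain (\<lambda>z. - force q (snd z) * (fst z \<bullet> e)) (\<lambda>z. - force q (snd z) *\<^sub>R e)"
  unfolding weak_gradient_def
proof
  fix b :: "'m space" assume b: "b \<in> Basis"
  have int: "locally_integrable flow_domain (\<lambda>z :: 'm space \<times> real. force q (snd z) * c)" for c :: real
    using locally_integrable_scaleR[OF force_locally_integrable[OF q, where 'm = 'm], of c] by simp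
  have [measurable]: "(\<lambda>z :: 'm space \<times> real. fst z \<bullet> e) \<in> borel_measurable borel"
    by (intro borel_measurable_continuous_onI continuous_intros)
  show "weak_deriv flow_domain [(b, 0)] (\<lambda>z. - force q (snd z) * (fst z \<bullet> e))
      (\<lambda>z. (- force q (snd z) *\<^sub>R e) \<bullet> b)"
  proof (rule weak_deriv_along_lines[OF open_flow_domain])
    show "locally_integrable flow_domain (\<lambda>z :: 'm space \<times> real. - force q (snd z) * (fst z \<bullet> e))"
    proof (rule locally_integrable_bounded_by[OF _ int[of "2 * norm e"]])
      fix z :: "'m space \<times> real" assume "z \<in> flow_domain"
      then have "\<bar>fst z \<bullet> e\<bar> \<le> 2 * norm e"
        using Cauchy_Schwarz_ineq2[of "fst z" e] flow_domain_bounds(6)[of z]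
        by (meson less_imp_le mult_right_mono norm_ge_zero order_trans)
      then show "\<bar>- force q (snd z) * (fst z \<bullet> e)\<bar> \<le> force q (snd z) * (2 * norm e)"
        using force_nonneg[of q "snd z"] by (simp add: abs_mult mult_left_mono)
    qed simp
    show "locally_integrable flow_domain (\<lambda>z :: 'm space \<times> real. (- force q (snd z) *\<^sub>R e) \<bullet> b)"
      using int[of "- (e \<bullet> b)"] by simp
    fix x :: "'m space \<times> real"
    have d: "((\<lambda>s. - force q (snd (x + s *\<^sub>R (b, 0))) * (fst (x + s *\<^sub>R (b, 0)) \<bullet> e))
        has_real_derivative (- force q (snd (x + s *\<^sub>R (b, 0))) *\<^sub>R e) \<bullet> b) (at s)" for s
    proof -
      have eq: "(\<lambda>s. - force q (snd (x + s *\<^sub>R (b, 0))) * (fst (x + s *\<^sub>R (b, 0)) \<bullet> e)) =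
          (\<lambda>s. - force q (snd x) * (fst x \<bullet> e + s * (b \<bullet> e)))"
        by (simp add: fun_eq_iff inner_add_left)
      show ?thesis
        unfolding eq by (auto intro!: derivative_eq_intros simp: inner_commute)
    qed
    then show "isCont (\<lambda>s. - force q (snd (x + s *\<^sub>R (b, 0))) * (fst (x + s *\<^sub>R (b, 0)) \<bullet> e)) s" for s
      using DERIV_isCont by blast
    show "\<exists>S. finite S \<and> (\<forall>s. s \<notin> S \<longrightarrow> x + s *\<^sub>R (b, 0) \<in> flow_domain \<longrightarrow>
        ((\<lambda>s. - force q (snd (x + s *\<^sub>R (b, 0))) * (fst (x + s *\<^sub>R (b, 0)) \<bullet> e))
        has_real_derivative (- force q (snd (x + s *\<^sub>R (b, 0))) *\<^sub>R e) \<bullet> b) (at s))"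
      using d by (intro exI[of _ "{}"]) blast
  qed (use b in \<open>simp_all add: Basis_pair\<close>)
qed

definition shear_gradient ::
  "real \<Rightarrow> ('m::finite) space \<Rightarrow> 'm space \<Rightarrow> 'm space \<times> real \<Rightarrow> 'm space" where
  "shear_gradient q e b z = (if b = (0, 1) then velocity_y q (height z) (snd z) else 0) *\<^sub>R e"

definition shear_hessian ::
  "real \<Rightarrow> ('m::finite) space \<Rightarrow> 'm space \<Rightarrow> 'm space \<Rightarrow> 'm space \<times> real \<Rightarrow> 'm space" where
  "shear_hessian q e b c z =
    (if b = (0, 1) \<and> c = (0, 1) then velocity_yy q (height z) (snd z) else 0) *\<^sub>R e"

lemma velocity_tangential_weak_deriv:
  assumes q: "1 < q" and b: "b \<in> Basis" "b \<noteq> (0, 1)"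
  shows "weak_deriv flow_domain [(b, 0)] (\<lambda>z :: ('m::finite) space \<times> real. velocity q (height z) (snd z)) (\<lambda>z. 0)"
    and "weak_deriv flow_domain [(b, 0)] (\<lambda>z :: 'm space \<times> real. velocity_y q (height z) (snd z)) (\<lambda>z. 0)"
proof -
  have b0: "snd b = 0" using Basis_space_cases[OF b(1)] b(2) by metis
  show "weak_deriv flow_domain [(b, 0)] (\<lambda>z :: 'm space \<times> real. velocity q (height z) (snd z)) (\<lambda>z. 0)"
    using velocity_weak_derivs(2)[OF q, where 'm = 'm]
    by (intro weak_deriv_tangential[OF b(1) b0]) (auto simp: weak_deriv_def)
  show "weak_deriv flow_domain [(b, 0)] (\<lambda>z :: 'm space \<times> real. velocity_y q (height z) (snd z)) (\<lambda>z. 0)"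
    using velocity_weak_derivs(2)[OF q, where 'm = 'm]
    by (intro weak_deriv_tangential[OF b(1) b0]) (auto simp: weak_deriv_def)
qed

lemma shear_weak_gradient:
  assumes q: "1 < q" and b: "b \<in> Basis"
  shows "weak_deriv flow_domain [(b, 0)] (\<lambda>z :: ('m::finite) space \<times> real. velocity q (height z) (snd z) *\<^sub>R e)
    (shear_gradient q e b)"
proof -
  have "weak_deriv flow_domain [(b, 0)] (\<lambda>z :: 'm space \<times> real. velocity q (height z) (snd z))
    (\<lambda>z. if b = (0, 1) then velocity_y q (height z) (snd z) else 0)"
    using velocity_weak_derivs(2)[OF q, where 'm = 'm] velocity_tangential_weak_deriv(1)[OF q b]
    by (cases "b = (0, 1)") simp_all
  then show ?thesis
    unfolding shear_gradient_def [abs_def] using b by (intro weak_deriv_scaleR) (simp_all add: Basis_pair)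
qed

lemma shear_weak_hessian:
  assumes q: "1 < q"
  shows "weak_hessian flow_domain (\<lambda>z :: ('m::finite) space \<times> real. velocity q (height z) (snd z) *\<^sub>R e)
    (shear_hessian q e)"
  unfolding weak_hessian_def
proof (intro ballI)
  fix b c :: "'m space" assume b: "b \<in> Basis" and c: "c \<in> Basis"
  note B = Basis_pair(1)[OF b] Basis_pair(1)[OF c]
  have "weak_deriv flow_domain [(b, 0), (c, 0)] (\<lambda>z :: 'm space \<times> real. velocity q (height z) (snd z))
    (\<lambda>z. if b = (0, 1) \<and> c = (0, 1) then velocity_yy q (height z) (snd z) else 0)"
  proof (cases "b = (0, 1)")
    case True
    have "weak_deriv flow_domain [(c, 0)] (\<lambda>z :: 'm space \<times> real. velocity_y q (height z) (snd z))
        (\<lambda>z. if c = (0, 1) then velocity_yy q (height z) (snd z) else 0)"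
      using velocity_weak_derivs(3)[OF q, where 'm = 'm] velocity_tangential_weak_deriv(2)[OF q c]
      by (cases "c = (0, 1)") simp_all
    then show ?thesis
      using weak_deriv_compose[OF _ _ B] velocity_weak_derivs(2)[OF q, where 'm = 'm] True by simp
  next
    case False
    have "weak_deriv flow_domain [(c, 0)] (\<lambda>z :: 'm space \<times> real. 0 :: real) (\<lambda>z. 0)"
      using B by (intro weak_deriv_0) simp
    then show ?thesis
      using weak_deriv_compose[OF velocity_tangential_weak_deriv(1)[OF q b False] _ B] False by simp
  qed
  then show "weak_deriv flow_domain [(b, 0), (c, 0)]
      (\<lambda>z :: 'm space \<times> real. velocity q (height z) (snd z) *\<^sub>R e) (shear_hessian q e b c)"
    unfolding shear_hessian_def [abs_def] using B by (intro weak_deriv_scaleR) simp_all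
qed

lemma shear_weak_time_deriv:
  assumes q: "1 < q"
  shows "weak_time_deriv flow_domain (\<lambda>z :: ('m::finite) space \<times> real. velocity q (height z) (snd z) *\<^sub>R e)
    (\<lambda>z. velocity_t q (height z) (snd z) *\<^sub>R e)"
  unfolding weak_time_deriv_def
  by (intro weak_deriv_scaleR velocity_weak_derivs(1)[OF q]) (simp add: Basis_pair)

lemma shear_no_slip:
  assumes q: "1 < q" and e: "norm e = 1"
  shows "no_slip (\<lambda>z :: ('m::finite) space \<times> real. velocity q (height z) (snd z) *\<^sub>R e)"
  unfolding no_slip_def
proof
  fix p :: "'m space \<times> real" assume "p \<in> flat_boundary"
  then have p: "height p = 0" by (auto simp: flat_boundary_def)
  have lim: "((\<lambda>z. 2 / gauss_mass * height z) \<longlongrightarrow> 0) (at p within flow_domain)"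
    using tendsto_mult[OF tendsto_const[of "2 / gauss_mass"]
        tendsto_snd[OF tendsto_fst[OF tendsto_ident_at[of p flow_domain]]]] p by simp
  have dom: "eventually (\<lambda>z. z \<in> flow_domain) (at p within flow_domain)"
    by (simp add: eventually_at_filter)
  have "((\<lambda>z. (2 / gauss_mass * height z) powr (1 - 1/q)) \<longlongrightarrow> 0) (at p within flow_domain)"
  proof (rule tendsto_zero_powrI[OF lim tendsto_const])
    show "eventually (\<lambda>z. 0 \<le> 2 / gauss_mass * height z) (at p within flow_domain)"
      using dom
    proof eventually_elim
      case (elim z)
      then show ?case using flow_domain_bounds(2)[OF elim] gauss_mass_pos by simp
    qed
    show "0 < 1 - 1/q" using q by simp
  qed
  then have "((\<lambda>z. velocity q (height z) (snd z) *\<^sub>R e) \<longlongrightarrow> 0) (at p within flow_domain)"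
  proof (rule Lim_null_comparison[rotated])
    show "eventually (\<lambda>z. norm (velocity q (height z) (snd z) *\<^sub>R e)
        \<le> (2 / gauss_mass * height z) powr (1 - 1/q)) (at p within flow_domain)"
      using dom
    proof eventually_elim
      case (elim z)
      then show ?case
        using velocity_le_wall_distance[OF q flow_domain_bounds(2,5)[OF elim]] e by simp
    qed
  qed
  then show "velocity q (height p) (snd p) *\<^sub>R e = 0 \<and>
      ((\<lambda>z. velocity q (height z) (snd z) *\<^sub>R e) \<longlongrightarrow> 0) (at p within flow_domain)"
    using p by simp
qed

lemma shear_distributional_solution:
  fixes e :: "('m::finite) space"
  assumes q: "1 < q" and e: "snd e = 0"
  shows "distributional_solution flow_domain (\<lambda>z. 0)
    (\<lambda>z. velocity q (height z) (snd z) *\<^sub>R e) (\<lambda>z. - force q (snd z) * (fst z \<bullet> e))"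
proof (rule distributional_solution_of_weak_derivs[OF shear_weak_time_deriv[OF q]
      shear_weak_hessian[OF q] pressure_weak_gradient[OF q] shear_weak_gradient[OF q]])
  show "locally_integrable flow_domain (\<lambda>z :: 'm space \<times> real. 0 :: 'm space)"
    by (simp add: locally_integrable_def set_integrable_def)
  fix z :: "'m space \<times> real" assume z: "z \<in> flow_domain"
  have "(\<Sum>b\<in>Basis. shear_hessian q e b b z) = velocity_yy q (height z) (snd z) *\<^sub>R e"
    unfolding shear_hessian_def scaleR_sum_left[symmetric]
    by (simp add: Basis_vertical sum.delta)
  then show "velocity_t q (height z) (snd z) *\<^sub>R e - (\<Sum>b\<in>Basis. shear_hessian q e b b z) + 0
      + - force q (snd z) *\<^sub>R e = 0"
    using velocity_equation[OF q flow_domain_bounds(2)[OF z], of "snd z"]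
    by (simp add: scaleR_left_diff_distrib[symmetric])
  have "shear_gradient q e b z \<bullet> b = 0" for b
    using e by (auto simp: shear_gradient_def inner_prod_def)
  then show "(\<Sum>b\<in>Basis. shear_gradient q e b z \<bullet> b) = 0"
    by simp
qed

text \<open>A basis vector \<open>b\<close> with \<open>e \<bullet> b \<noteq> 0\<close> is parallel to the wall, and in these directions \<open>u\<close> does not vary.\<close>

lemma shear_convection_eq_0:
  fixes e :: "('m::finite) space"
  assumes "snd e = 0"
  shows "(\<lambda>z. \<Sum>b\<in>Basis. ((velocity q (height z) (snd z) *\<^sub>R e) \<bullet> b) *\<^sub>R shear_gradient q e b z) = (\<lambda>z. 0)"
proof -
  have "((v *\<^sub>R e) \<bullet> b) *\<^sub>R shear_gradient q e b z = 0" for v :: real and b z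
    using assms by (auto simp: shear_gradient_def inner_prod_def)
  then show ?thesis by (intro ext sum.neutral ballI)
qed

lemma shear_solutions:
  fixes e :: "('m::finite) space"
  assumes q: "1 < q" and e: "snd e = 0"
  shows "stokes_solution flow_domain (\<lambda>z. velocity q (height z) (snd z) *\<^sub>R e)
      (\<lambda>z. - force q (snd z) * (fst z \<bullet> e))"
    and "navier_stokes_solution flow_domain (\<lambda>z. velocity q (height z) (snd z) *\<^sub>R e)
      (\<lambda>z. - force q (snd z) * (fst z \<bullet> e))"
proof -
  show "stokes_solution flow_domain (\<lambda>z. velocity q (height z) (snd z) *\<^sub>R e)
      (\<lambda>z. - force q (snd z) * (fst z \<bullet> e))"
    unfolding stokes_solution_def by (rule shear_distributional_solution[OF assms])
  show "navier_stokes_solution flow_domain (\<lambda>z. velocity q (height z) (snd z) *\<^sub>R e)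
      (\<lambda>z. - force q (snd z) * (fst z \<bullet> e))"
    unfolding navier_stokes_solution_def
  proof (intro exI[of _ "shear_gradient q e"] conjI ballI)
    show "weak_deriv flow_domain [(b, 0)] (\<lambda>z. velocity q (height z) (snd z) *\<^sub>R e) (shear_gradient q e b)"
      if "b \<in> Basis" for b
      by (rule shear_weak_gradient[OF q that])
    show "distributional_solution flow_domain
        (\<lambda>z. \<Sum>b\<in>Basis. ((velocity q (height z) (snd z) *\<^sub>R e) \<bullet> b) *\<^sub>R shear_gradient q e b z)
        (\<lambda>z. velocity q (height z) (snd z) *\<^sub>R e) (\<lambda>z. - force q (snd z) * (fst z \<bullet> e))"
      unfolding shear_convection_eq_0[OF e] by (rule shear_distributional_solution[OF assms])
  qed
qed

lemma hessian_norm_shear: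
  assumes "norm e = 1"
  shows "hessian_norm (shear_hessian q e) z = \<bar>velocity_yy q (height z) (snd z)\<bar>"
proof -
  have "(norm (shear_hessian q e b c z))\<^sup>2 =
      (if c = (0, 1) then if b = (0, 1) then (velocity_yy q (height z) (snd z))\<^sup>2 else 0 else 0)" for b c
    using assms by (simp add: shear_hessian_def)
  then show ?thesis
    by (simp add: hessian_norm_def Basis_vertical sum.delta)
qed

text \<open>Before time \<open>1\<close> the acceleration is between \<open>0\<close> and the force, so one estimate for the force covers both
\<open>D\<^sub>t u\<close> and \<open>\<nabla>\<pi>\<close>.\<close>

lemma shear_Lp_norms_finite:
  fixes e :: "('m::finite) space"
  assumes q: "1 < q" and e: "norm e = 1"
  shows "Lp_norm (3 * q / 2) (half_cylinder 1) (hessian_norm (shear_hessian q e)) < \<infinity>"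
    and "Lp_norm q (half_cylinder 1) (\<lambda>z :: 'm space \<times> real. velocity_t q (height z) (snd z) *\<^sub>R e) < \<infinity>"
    and "Lp_norm q (half_cylinder 1) (\<lambda>z :: 'm space \<times> real. - force q (snd z) *\<^sub>R e) < \<infinity>"
proof -
  show "Lp_norm (3 * q / 2) (half_cylinder 1) (hessian_norm (shear_hessian q e)) < \<infinity>"
    unfolding Lp_norm_finite_iff hessian_norm_shear[OF e]
    using velocity_yy_powr_integral_finite[OF q, where 'm = 'm] by simp
  have le: "(\<integral>\<^sup>+z\<in>half_cylinder 1. ennreal (norm (f z) powr q) \<partial>lebesgue) < \<infinity>"
    if "\<And>z. z \<in> half_cylinder 1 \<Longrightarrow> norm (f z) \<le> force q (snd z)" for f :: "'m space \<times> real \<Rightarrow> 'm space"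
  proof (rule order.strict_trans1[OF _ force_powr_integral_finite[OF q, where 'm = 'm]],
      rule nn_integral_mono)
    fix z :: "'m space \<times> real"
    show "ennreal (norm (f z) powr q) * indicator (half_cylinder 1) z
        \<le> ennreal (force q (snd z) powr q) * indicator flow_domain z"
    proof (cases "z \<in> half_cylinder 1")
      case True
      then have "norm (f z) powr q \<le> force q (snd z) powr q"
        using that q by (intro powr_mono2) auto
      then show ?thesis
        using True half_cylinder_1_subset by (auto simp: ennreal_leI)
    qed simp
  qed
  show "Lp_norm q (half_cylinder 1) (\<lambda>z :: 'm space \<times> real. velocity_t q (height z) (snd z) *\<^sub>R e) < \<infinity>"
    unfolding Lp_norm_finite_iff
  proof (rule le[of "\<lambda>z. velocity_t q (height z) (snd z) *\<^sub>R e"])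
    fix z :: "'m space \<times> real" assume z: "z \<in> half_cylinder 1"
    have "height z > 0" using z half_cylinder_1_subset flow_domain_bounds(2) by blast
    then show "norm (velocity_t q (height z) (snd z) *\<^sub>R e) \<le> force q (snd z)"
      using velocity_t_bounds(1,2)[OF q _ half_cylinder_before_1[OF z]] e by simp
  qed
  show "Lp_norm q (half_cylinder 1) (\<lambda>z :: 'm space \<times> real. - force q (snd z) *\<^sub>R e) < \<infinity>"
    unfolding Lp_norm_finite_iff
    by (rule le[of "\<lambda>z. - force q (snd z) *\<^sub>R e"]) (use force_nonneg e in simp)
qed

lemma filterlim_rescaled_growth:
  assumes q: "1 < q" and r: "r > q * \<beta>" and "0 < c" "0 < d"
  shows "filterlim (\<lambda>k. (strength q k * c) powr r * (d * duration k powr \<beta>)) at_top sequentially"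
proof -
  have "filterlim (\<lambda>k. (c powr r * d) * (strength q k powr r * duration k powr \<beta>)) at_top sequentially"
    using assms by (intro filterlim_tendsto_pos_mult_at_top[OF tendsto_const _ strength_duration_growth]) auto
  moreover have "(strength q k * c) powr r * (d * duration k powr \<beta>) =
      (c powr r * d) * (strength q k powr r * duration k powr \<beta>)" for k
    using assms strength_pos[of q k] by (simp add: powr_mult)
  ultimately show ?thesis by (simp only:)
qed

text \<open>For \<open>D\<^sub>t u\<close> and \<open>\<nabla>\<pi>\<close> the \<open>k\<close>-th box has height between \<open>1/8\<close> and \<open>1/4\<close>, which the boundary layer of a burst
does not reach in full: there \<open>layer \<le> erfc (1/8) < 1\<close>. For the second derivatives it is
\<open>y < sqrt (duration k) / 4\<close> in the second half of the burst, where the boundary layer has already grown past \<open>y\<close>.\<close>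

lemma shear_Lp_norms_infinite:
  fixes e :: "('m::finite) space"
  assumes q: "1 < q" and e: "norm e = 1"
  shows "r > q \<Longrightarrow> Lp_norm r (half_cylinder (1/2)) (\<lambda>z :: 'm space \<times> real. velocity_t q (height z) (snd z) *\<^sub>R e) = \<infinity>"
    and "r > q \<Longrightarrow> Lp_norm r (half_cylinder (1/2)) (\<lambda>z :: 'm space \<times> real. - force q (snd z) *\<^sub>R e) = \<infinity>"
    and "r > 3 * q / 2 \<Longrightarrow> Lp_norm r (half_cylinder (1/2)) (hessian_norm (shear_hessian q e)) = \<infinity>"
proof -
  have pulse: "pulse q k t = strength q k" if "1 - duration k < t" "t < 1" for k t
    using that by (simp add: pulse_def)
  define c where "c = 1 - erfc (1/8)"
  have c: "0 < c" "c \<le> 1" using erfc_less_1[of "1/8"] erfc_pos[of "1/8"] by (auto simp: c_def)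
  have growth: "filterlim (\<lambda>k. (strength q k * c) powr r * ((1/4 - 1/8) * (1 - (1 - duration k)))) at_top sequentially"
    if "r > q" for r
    using filterlim_rescaled_growth[OF q, of 1 r c "1/8"] that c by simp
  have box: "0 \<le> (1/8::real) \<and> (1/8::real) \<le> 1/4 \<and> (1/4::real) \<le> 1/4 \<and> 3/4 \<le> 1 - duration k \<and> 1 - duration k \<le> 1"
    for k using duration_le[of k] by simp
  have strength_c: "0 \<le> strength q k * c" for k
    using strength_pos[of q k] c by simp
  show "Lp_norm r (half_cylinder (1/2)) (\<lambda>z :: 'm space \<times> real. velocity_t q (height z) (snd z) *\<^sub>R e) = \<infinity>" if r: "r > q"
  proof (rule Lp_norm_infinite_of_boxes[where a = "\<lambda>_. 1/8" and b = "\<lambda>_. 1/4"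
        and c = "\<lambda>k. 1 - duration k" and m = "\<lambda>k. strength q k * c", OF _ box strength_c _ growth[OF r]])
    show "0 < r" using q r by simp
    fix k and z :: "'m space \<times> real"
    assume z: "1/8 < height z" "1 - duration k < snd z" "z \<in> half_cylinder (1/2)"
    define y s where "y = height z" and "s = snd z - 1 + duration k"
    have t: "snd z < 1" by (rule half_cylinder_before_1[OF z(3)])
    have s: "0 < s" "s \<le> 1/4" using z(2) t duration_le[of k] by (auto simp: s_def)
    have "sqrt s \<le> sqrt (1/4)" using s(2) by (rule real_sqrt_le_mono)
    also have "\<dots> = 1/2" by (simp add: real_sqrt_divide)
    finally have "2 * sqrt s * (1/8) \<le> y" using z(1) by (simp add: y_def)
    then have "1/8 \<le> y / (2 * sqrt s)" using s(1) by (simp add: field_simps)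
    then have "layer y s \<le> erfc (1/8)"
      using s(1) erfc_antimono[of "1/8"] by (simp add: layer_def)
    then have "strength q k * c \<le> strength q k * (1 - layer y s)"
      using strength_pos[of q k] by (simp add: c_def)
    also have "\<dots> \<le> velocity_t q y (snd z)"
      using velocity_t_bounds(3)[OF q _ t, of y k] z(1) pulse[OF z(2) t] by (simp add: y_def s_def)
    finally show "strength q k * c \<le> norm (velocity_t q (height z) (snd z) *\<^sub>R e)"
      using e by (simp add: y_def)
  qed
  show "Lp_norm r (half_cylinder (1/2)) (\<lambda>z :: 'm space \<times> real. - force q (snd z) *\<^sub>R e) = \<infinity>" if r: "r > q"
  proof (rule Lp_norm_infinite_of_boxes[where a = "\<lambda>_. 1/8" and b = "\<lambda>_. 1/4"
        and c = "\<lambda>k. 1 - duration k" and m = "\<lambda>k. strength q k * c", OF _ box strength_c _ growth[OF r]])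
    show "0 < r" using q r by simp
    fix k and z :: "'m space \<times> real"
    assume z: "1 - duration k < snd z" "z \<in> half_cylinder (1/2)"
    have "strength q k * c \<le> strength q k * 1"
      using c strength_pos[of q k] by (intro mult_left_mono) auto
    also have "\<dots> \<le> force q (snd z)"
      using pulse_le_force[of q k "snd z"] pulse[OF z(1) half_cylinder_before_1[OF z(2)]] by simp
    finally show "strength q k * c \<le> norm (- force q (snd z) *\<^sub>R e)"
      using e by simp
  qed
  show "Lp_norm r (half_cylinder (1/2)) (hessian_norm (shear_hessian q e)) = \<infinity>" if r: "r > 3 * q / 2"
  proof (rule Lp_norm_infinite_of_boxes[where a = "\<lambda>_. 0" and b = "\<lambda>k. sqrt (duration k) / 4"
        and c = "\<lambda>k. 1 - duration k / 2" and m = "\<lambda>k. strength q k * erfc 1"])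
    show "0 < r" using q r by simp
    show "0 \<le> (0::real) \<and> 0 \<le> sqrt (duration k) / 4 \<and> sqrt (duration k) / 4 \<le> 1/4 \<and>
        3/4 \<le> 1 - duration k / 2 \<and> 1 - duration k / 2 \<le> 1" for k
      using duration_le[of k] real_sqrt_le_mono[of "duration k" 1] by simp
    show "0 \<le> strength q k * erfc 1" for k
      using strength_pos[of q k] erfc_pos[of 1] by simp
    have "sqrt (duration k) / 4 * (duration k / 2) = 1/8 * duration k powr (3/2)" for k
    proof -
      have "duration k powr (3/2) = duration k powr (1/2) * duration k powr 1"
        unfolding powr_add[symmetric] by simp
      then show ?thesis by (simp add: powr_half_sqrt)
    qed
    then show "filterlim (\<lambda>k. (strength q k * erfc 1) powr r *
        ((sqrt (duration k) / 4 - 0) * (1 - (1 - duration k / 2)))) at_top sequentially"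
      using filterlim_rescaled_growth[OF q, of "3/2" r "erfc 1" "1/8"] r erfc_pos[of 1] by simp
    fix k and z :: "'m space \<times> real"
    assume z: "0 < height z" "height z < sqrt (duration k) / 4" "1 - duration k / 2 < snd z"
      "z \<in> half_cylinder (1/2)"
    define y s where "y = height z" and "s = snd z - 1 + duration k"
    have t: "snd z < 1" by (rule half_cylinder_before_1[OF z(4)])
    have s: "duration k / 4 \<le> s" using z(3) duration_pos[of k] unfolding s_def by linarith
    have s0: "0 < s" using z(3) duration_pos[of k] unfolding s_def by linarith
    have "sqrt (duration k) / 2 = sqrt (duration k / 4)" by (simp add: real_sqrt_divide)
    also have "\<dots> \<le> sqrt s" using s by (rule real_sqrt_le_mono)
    finally have "y \<le> 2 * sqrt s" using z(1,2) real_sqrt_gt_zero[OF s0] by (simp add: y_def)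
    then have "y / (2 * sqrt s) \<le> 1" using s0 by simp
    then have "erfc 1 \<le> layer y s"
      using s0 z(1) erfc_antimono[of "y / (2 * sqrt s)" 1] by (simp add: layer_def y_def)
    then have "strength q k * erfc 1 \<le> strength q k * layer y s"
      using strength_pos[of q k] by simp
    also have "\<dots> \<le> \<bar>velocity_yy q y (snd z)\<bar>"
      using velocity_yy_bounds(2)[OF q z(1) t, of k] pulse[OF _ t, of k] z(3) duration_pos[of k]
      by (simp add: y_def s_def del: duration_pos)
    finally show "strength q k * erfc 1 \<le> norm (hessian_norm (shear_hessian q e) z)"
      unfolding hessian_norm_shear[OF e] by (simp add: y_def)
  qed
qed

theorem theorem1p6:
  fixes q :: real
  assumes "1 < q"
  shows "\<forall>solution \<in> {stokes_solution, navier_stokes_solution}.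
    \<exists>(u :: ('m::finite) space \<times> real \<Rightarrow> 'm space) (\<pi> :: 'm space \<times> real \<Rightarrow> real)
      Dtu D2u Dpi.
      solution flow_domain u \<pi> \<and>
      no_slip u \<and>
      weak_time_deriv (half_cylinder 1) u Dtu \<and>
      weak_hessian (half_cylinder 1) u D2u \<and>
      weak_gradient (half_cylinder 1) \<pi> Dpi \<and>
      Lp_norm (3 * q / 2) (half_cylinder 1) (hessian_norm D2u)
        + Lp_norm q (half_cylinder 1) Dtu
        + Lp_norm q (half_cylinder 1) Dpi < \<infinity> \<and>
      (\<forall>r1 > q. Lp_norm r1 (half_cylinder (1/2)) Dtu = \<infinity>) \<and>
      (\<forall>r1 > q. Lp_norm r1 (half_cylinder (1/2)) Dpi = \<infinity>) \<and>
      (\<forall>r2 > 3 * q / 2. Lp_norm r2 (half_cylinder (1/2)) (hessian_norm D2u) = \<infinity>)"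
proof
  fix solution :: "('m space \<times> real) set \<Rightarrow> ('m space \<times> real \<Rightarrow> 'm space) \<Rightarrow> ('m space \<times> real \<Rightarrow> real) \<Rightarrow> bool"
  assume solution: "solution \<in> {stokes_solution, navier_stokes_solution}"
  obtain i :: 'm where True by simp
  define e :: "'m space" where "e = (axis i 1, 0)"
  have e: "snd e = 0" "norm e = 1" by (simp_all add: e_def norm_Pair)
  define u where "u = (\<lambda>z :: 'm space \<times> real. velocity q (height z) (snd z) *\<^sub>R e)"
  define \<pi> where "\<pi> = (\<lambda>z :: 'm space \<times> real. - force q (snd z) * (fst z \<bullet> e))"
  define Dtu where "Dtu = (\<lambda>z :: 'm space \<times> real. velocity_t q (height z) (snd z) *\<^sub>R e)"
  define Dpi where "Dpi = (\<lambda>z :: 'm space \<times> real. - force q (snd z) *\<^sub>R e)"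
  have restrict: "weak_deriv (half_cylinder 1) ds f g"
    if "weak_deriv flow_domain ds f g" "set ds \<subseteq> Basis"
    for ds :: "('m space \<times> real) list" and f g :: "'m space \<times> real \<Rightarrow> 'b::euclidean_space"
    by (rule weak_deriv_subset[OF that(1) half_cylinder_1_subset that(2)])
  show "\<exists>u \<pi> Dtu D2u Dpi.
      solution flow_domain u \<pi> \<and>
      no_slip u \<and>
      weak_time_deriv (half_cylinder 1) u Dtu \<and>
      weak_hessian (half_cylinder 1) u D2u \<and>
      weak_gradient (half_cylinder 1) \<pi> Dpi \<and>
      Lp_norm (3 * q / 2) (half_cylinder 1) (hessian_norm D2u)
        + Lp_norm q (half_cylinder 1) Dtu
        + Lp_norm q (half_cylinder 1) Dpi < \<infinity> \<and>
      (\<forall>r1 > q. Lp_norm r1 (half_cylinder (1/2)) Dtu = \<infinity>) \<and>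
      (\<forall>r1 > q. Lp_norm r1 (half_cylinder (1/2)) Dpi = \<infinity>) \<and>
      (\<forall>r2 > 3 * q / 2. Lp_norm r2 (half_cylinder (1/2)) (hessian_norm D2u) = \<infinity>)"
  proof (intro exI conjI allI impI)
    show "solution flow_domain u \<pi>"
      using solution shear_solutions[OF assms e(1)] by (auto simp: u_def \<pi>_def)
    show "no_slip u"
      unfolding u_def by (rule shear_no_slip[OF assms e(2)])
    show "weak_time_deriv (half_cylinder 1) u Dtu"
      using shear_weak_time_deriv[OF assms, of e]
      by (auto simp: weak_time_deriv_def u_def Dtu_def Basis_pair intro!: restrict)
    show "weak_hessian (half_cylinder 1) u (shear_hessian q e)"
      using shear_weak_hessian[OF assms, of e]
      by (auto simp: weak_hessian_def u_def Basis_pair intro!: restrict)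
    show "weak_gradient (half_cylinder 1) \<pi> Dpi"
      using pressure_weak_gradient[OF assms, of e]
      unfolding weak_gradient_def \<pi>_def Dpi_def by (intro ballI restrict) (simp_all add: Basis_pair)
    show "Lp_norm (3 * q / 2) (half_cylinder 1) (hessian_norm (shear_hessian q e))
        + Lp_norm q (half_cylinder 1) Dtu + Lp_norm q (half_cylinder 1) Dpi < \<infinity>"
      using shear_Lp_norms_finite[OF assms e(2)] by (simp add: Dtu_def Dpi_def)
  qed (use shear_Lp_norms_infinite[OF assms e(2)] in \<open>simp_all add: Dtu_def Dpi_def\<close>)
qed

end
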